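(* Let $m\ge 2$ be any fixed integer and let $\rho=\rho_n\in[0,1]$ be the correlation parameter of the Gaussian-Wigner $m$-uniform hypergraph testing problem described in the context, with laws $P=P_n$ under $H_0$ and $Q=Q_n$ under $H_1$. As $n\to\infty$: (i) If $$\rho^2\ \ge\ \frac{2n\log n}{\binom{n}{m}},$$ then $H_0$ and $H_1$ are distinguishable, i.e. $TV(P,Q)=1+o(1)$. (ii) For any constant $\epsilon>0$, if $$\rho^2\ <\ \frac{(1-\epsilon)\,2n\log n}{\binom{n}{m}},$$ then $H_0$ and $H_1$ are indistinguishable, i.e. $TV(P,Q)=o(1)$.
   Context: An $m$-uniform weighted hypergraph on $[n]=\{1,\dots,n\}$ is encoded by a symmetric $m$-dimensional real array $A$ with entries $A_{i_1\dots i_m}$, invariant under permutations of the indices and equal to $0$ whenever the indices are not all distinct; so it is determined by the entries with $1\le i_1<\dots<i_m\le n$. $P_n$ denotes the group of permutations of $[n]$ and $\pi\sim \mathrm{Unif}(P_n)$ means that $\pi$ is uniformly distributed on it. Gaussian-Wigner testing problem. One observes a pair $(A_1,A_2)$ of such symmetric arrays. Under $H_0$ the pairs $(A_{1,i_1\dots i_m},A_{2,i_1\dots i_m})$, $1\le i_1<\dots<i_m\le n$, are i.i.d. bivariate normal with mean zero and identity covariance matrix. Under $H_1$, there is a latent $\pi\sim\mathrm{Unif}(P_n)$ (not observed) such that, conditional on $\pi$, the pairs $(A_{1,i_1\dots i_m},A_{2,\pi_{i_1}\dots\pi_{i_m}})$, $1\le i_1<\dots<i_m\le n$, are i.i.d.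 bivariate normal with mean zero, unit variances and correlation $\rho$. $P$ and $Q$ denote the laws of $(A_1,A_2)$ under $H_0$ and $H_1$ respectively. The total variation distance is $TV(P,Q)=\sup_{E}|P(E)-Q(E)|$ over measurable events $E$. The parameter $\rho$ may depend on $n$, and all asymptotics are as $n\to\infty$ with $m$ fixed. *)

theory Defs
  imports "HOL-Probability.Probability" "HOL-Combinatorics.Permutations"
begin

section \<open>Bivariate normal laws\<close>

text \<open>
  The law of \<open>(X, \<rho> X + sqrt (1 - \<rho>\<^sup>2) Z)\<close> for independent standard normal \<open>X\<close> and \<open>Z\<close>.
  This form also covers the degenerate case \<open>\<rho> = 1\<close>, where there is no Lebesgue density.
\<close>

definition bivariate_normal :: "real \<Rightarrow> (real \<times> real) measure" where
  "bivariate_normal \<rho> =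
     distr (density lborel std_normal_density \<Otimes>\<^sub>M density lborel std_normal_density)
       (borel \<Otimes>\<^sub>M borel) (\<lambda>(x, z). (x, \<rho> * x + sqrt (1 - \<rho>\<^sup>2) * z))"

lemma sets_bivariate_normal [simp, measurable_cong]:
  "sets (bivariate_normal \<rho>) = sets (borel \<Otimes>\<^sub>M borel)"
  by (simp add: bivariate_normal_def)

lemma space_bivariate_normal [simp]: "space (bivariate_normal \<rho>) = UNIV"
  by (simp add: bivariate_normal_def space_pair_measure)

lemma prob_space_std_normal_pair:
  "prob_space (density lborel std_normal_density \<Otimes>\<^sub>M density lborel std_normal_density)"
proof -
  interpret N: prob_space "density lborel std_normal_density"
    by (rule prob_space_normal_density) simp
  interpret pair_prob_space "density lborel std_normal_density" "density lborel std_normal_density" ..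
  show ?thesis by unfold_locales
qed

lemma prob_space_bivariate_normal: "prob_space (bivariate_normal \<rho>)"
  unfolding bivariate_normal_def
  by (intro prob_space.prob_space_distr prob_space_std_normal_pair) measurable

text \<open>At \<open>\<rho> = 0\<close> this is the bivariate normal law with identity covariance matrix.\<close>

lemma bivariate_normal_0:
  "bivariate_normal 0 =
     density lborel std_normal_density \<Otimes>\<^sub>M density lborel std_normal_density"
proof -
  have "sets (borel \<Otimes>\<^sub>M borel) =
    sets (density lborel std_normal_density \<Otimes>\<^sub>M density lborel std_normal_density)"
    by (intro sets_pair_measure_cong) simp_all
  then show ?thesis
    unfolding bivariate_normal_def by (simp add: case_prod_eta id_def distr_id2)
qed

section \<open>The Gaussian-Wigner testing problem\<close>

text \<open>
  A symmetric \<open>m\<close>-dimensional array on \<open>{1..n}\<close> that vanishes off tuples of distinct indices is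
  the same thing as a real function on the \<open>m\<close>-element subsets of \<open>{1..n}\<close>: the entry at
  \<open>i\<^sub>1 < \<dots> < i\<^sub>m\<close> is the value at \<open>{i\<^sub>1, \<dots>, i\<^sub>m}\<close>, and by symmetry the entry at
  \<open>\<pi> i\<^sub>1, \<dots>, \<pi> i\<^sub>m\<close> is the value at \<open>\<pi> ` {i\<^sub>1, \<dots>, i\<^sub>m}\<close>.
\<close>

definition hyperedges :: "nat \<Rightarrow> nat \<Rightarrow> nat set set" where
  "hyperedges n m = {e. e \<subseteq> {1..n} \<and> card e = m}"

definition array_space :: "nat \<Rightarrow> nat \<Rightarrow> (nat set \<Rightarrow> real) measure" where
  "array_space n m = PiM (hyperedges n m) (\<lambda>_. borel)"

definition H0_law ::
  "nat \<Rightarrow> nat \<Rightarrow> ((nat set \<Rightarrow> real) \<times> (nat set \<Rightarrow> real)) measure" where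
  "H0_law n m =
     distr (PiM (hyperedges n m) (\<lambda>_. bivariate_normal 0))
       (array_space n m \<Otimes>\<^sub>M array_space n m)
       (\<lambda>w. (\<lambda>e\<in>hyperedges n m. fst (w e), \<lambda>e\<in>hyperedges n m. snd (w e)))"

text \<open>
  The law of \<open>(A\<^sub>1, A\<^sub>2)\<close> given \<open>\<pi>\<close>. The i.i.d. pairs are \<open>w e = (A\<^sub>1 e, A\<^sub>2 (\<pi> ` e))\<close>, so that
  \<open>A\<^sub>2 e\<close> is the second component of \<open>w\<close> at the preimage of \<open>e\<close>; see \<open>distr_H1_cond_law\<close>.
\<close>

definition H1_cond_law ::
  "nat \<Rightarrow> nat \<Rightarrow> real \<Rightarrow> (nat \<Rightarrow> nat) \<Rightarrow> ((nat set \<Rightarrow> real) \<times> (nat set \<Rightarrow> real)) measure" where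
  "H1_cond_law n m \<rho> \<pi> =
     distr (PiM (hyperedges n m) (\<lambda>_. bivariate_normal \<rho>))
       (array_space n m \<Otimes>\<^sub>M array_space n m)
       (\<lambda>w. (\<lambda>e\<in>hyperedges n m. fst (w e), \<lambda>e\<in>hyperedges n m. snd (w (inv \<pi> ` e))))"

definition H1_law ::
  "nat \<Rightarrow> nat \<Rightarrow> real \<Rightarrow> ((nat set \<Rightarrow> real) \<times> (nat set \<Rightarrow> real)) measure" where
  "H1_law n m \<rho> = measure_pmf (pmf_of_set {\<pi>. \<pi> permutes {1..n}}) \<bind> H1_cond_law n m \<rho>"

definition total_variation :: "'a measure \<Rightarrow> 'a measure \<Rightarrow> real" where
  "total_variation P Q = (SUP E\<in>sets P. \<bar>measure P E - measure Q E\<bar>)"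

section \<open>Well-definedness\<close>

lemma hyperedges_image:
  assumes "\<pi> permutes {1..n}" "e \<in> hyperedges n m"
  shows "\<pi> ` e \<in> hyperedges n m"
proof -
  have "\<pi> ` e \<subseteq> {1..n}"
    using assms permutes_image[OF assms(1)] by (auto simp: hyperedges_def)
  moreover have "card (\<pi> ` e) = card e"
    by (rule card_image) (rule permutes_inj_on[OF assms(1)])
  ultimately show ?thesis using assms(2) by (auto simp: hyperedges_def)
qed

text \<open>
  For \<open>w\<close> in the product space \<open>w e\<close> is a constant whenever \<open>e\<close> is not a hyperedge, so the
  following holds for every \<open>\<pi>\<close>, permutation of \<open>{1..n}\<close> or not. Hence \<open>H1_cond_law\<close> is a
  kernel on the discrete space of all functions, as the monadic bind in \<open>H1_law\<close> requires.
\<close>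

lemma measurable_arrays [measurable]:
  "(\<lambda>w. (\<lambda>e\<in>hyperedges n m. fst (w e), \<lambda>e\<in>hyperedges n m. snd (w (inv \<pi> ` e))))
    \<in> PiM (hyperedges n m) (\<lambda>_. bivariate_normal \<rho>) \<rightarrow>\<^sub>M
      array_space n m \<Otimes>\<^sub>M array_space n m"
proof -
  let ?M = "PiM (hyperedges n m) (\<lambda>_. bivariate_normal \<rho>)"
  have f: "fst \<in> bivariate_normal \<rho> \<rightarrow>\<^sub>M borel"
    and s: "snd \<in> bivariate_normal \<rho> \<rightarrow>\<^sub>M borel"
    using measurable_fst[of borel borel] measurable_snd[of borel borel]
    by (simp_all cong: measurable_cong_sets)
  have "(\<lambda>w. fst (w e)) \<in> ?M \<rightarrow>\<^sub>M borel" if "e \<in> hyperedges n m" for e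
    by (rule measurable_compose[OF measurable_component_singleton[OF that] f])
  moreover have "(\<lambda>w. snd (w e)) \<in> ?M \<rightarrow>\<^sub>M borel" for e
  proof (cases "e \<in> hyperedges n m")
    case True
    show ?thesis
      by (rule measurable_compose[OF measurable_component_singleton[OF True] s])
  next
    case False
    then have "(\<lambda>w. snd (w e)) \<in> ?M \<rightarrow>\<^sub>M borel \<longleftrightarrow> (\<lambda>w. snd (undefined :: real \<times> real)) \<in> ?M \<rightarrow>\<^sub>M borel"
      by (intro measurable_cong) (auto simp: space_PiM PiE_def extensional_def)
    then show ?thesis by simp
  qed
  ultimately show ?thesis
    unfolding array_space_def by (intro measurable_Pair measurable_restrict)
qed

lemma prob_space_H1_cond_law: "prob_space (H1_cond_law n m \<rho> \<pi>)"
  unfolding H1_cond_law_def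
  by (intro prob_space.prob_space_distr prob_space_PiM prob_space_bivariate_normal
      measurable_arrays)

lemma prob_space_H0_law: "prob_space (H0_law n m)"
  using prob_space_H1_cond_law[of n m 0 id] by (simp add: H0_law_def H1_cond_law_def)

lemma sets_H0_law [simp]: "sets (H0_law n m) = sets (array_space n m \<Otimes>\<^sub>M array_space n m)"
  by (simp add: H0_law_def)

lemma sets_H1_cond_law [simp]:
  "sets (H1_cond_law n m \<rho> \<pi>) = sets (array_space n m \<Otimes>\<^sub>M array_space n m)"
  by (simp add: H1_cond_law_def)

text \<open>Given \<open>\<pi>\<close>, the pairs \<open>(A\<^sub>1 e, A\<^sub>2 (\<pi> ` e))\<close> are i.i.d. with law \<open>bivariate_normal \<rho>\<close>.\<close>

lemma distr_H1_cond_law: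
  assumes "\<pi> permutes {1..n}"
  shows "distr (H1_cond_law n m \<rho> \<pi>) (PiM (hyperedges n m) (\<lambda>_. borel \<Otimes>\<^sub>M borel))
      (\<lambda>(A\<^sub>1, A\<^sub>2). \<lambda>e\<in>hyperedges n m. (A\<^sub>1 e, A\<^sub>2 (\<pi> ` e)))
    = PiM (hyperedges n m) (\<lambda>_. bivariate_normal \<rho>)"
proof -
  let ?E = "hyperedges n m"
  let ?M = "PiM ?E (\<lambda>_. bivariate_normal \<rho>)"
  have sets: "sets (PiM ?E (\<lambda>_. borel \<Otimes>\<^sub>M borel)) = sets ?M"
    by (intro sets_PiM_cong) simp_all
  have im: "\<pi> ` e \<in> ?E" "inv \<pi> ` \<pi> ` e = e" if "e \<in> ?E" for e
    using hyperedges_image[OF assms that] permutes_inj[OF assms]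
    by (auto simp: image_image)
  have m: "(\<lambda>(A\<^sub>1, A\<^sub>2). \<lambda>e\<in>?E. (A\<^sub>1 e, A\<^sub>2 (\<pi> ` e)))
      \<in> array_space n m \<Otimes>\<^sub>M array_space n m \<rightarrow>\<^sub>M PiM ?E (\<lambda>_. borel \<Otimes>\<^sub>M borel)"
    unfolding array_space_def case_prod_beta
    by (intro measurable_restrict measurable_Pair)
      (simp_all add: im measurable_compose[OF measurable_fst]
        measurable_compose[OF measurable_snd])
  have "distr (H1_cond_law n m \<rho> \<pi>) (PiM ?E (\<lambda>_. borel \<Otimes>\<^sub>M borel))
      (\<lambda>(A\<^sub>1, A\<^sub>2). \<lambda>e\<in>?E. (A\<^sub>1 e, A\<^sub>2 (\<pi> ` e)))
    = distr ?M (PiM ?E (\<lambda>_. borel \<Otimes>\<^sub>M borel)) (\<lambda>w. w)"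
    unfolding H1_cond_law_def
  proof (subst distr_distr[OF m measurable_arrays], rule distr_cong[OF refl refl])
    fix w assume "w \<in> space ?M"
    then have "w \<in> extensional ?E" by (simp add: space_PiM PiE_def)
    then show "((\<lambda>(A\<^sub>1, A\<^sub>2). \<lambda>e\<in>?E. (A\<^sub>1 e, A\<^sub>2 (\<pi> ` e))) \<circ>
        (\<lambda>w. (\<lambda>e\<in>?E. fst (w e), \<lambda>e\<in>?E. snd (w (inv \<pi> ` e))))) w = w"
      by (intro ext) (auto simp: im restrict_def extensional_def)
  qed
  also have "\<dots> = ?M" by (rule distr_id2[OF sets])
  finally show ?thesis .
qed

lemma measurable_H1_cond_law:
  "H1_cond_law n m \<rho> \<in> measure_pmf p \<rightarrow>\<^sub>M subprob_algebra (array_space n m \<Otimes>\<^sub>M array_space n m)"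
  by (auto simp: measurable_def space_subprob_algebra
      intro!: prob_space_imp_subprob_space prob_space_H1_cond_law)

lemma sets_H1_law [simp]:
  "sets (H1_law n m \<rho>) = sets (array_space n m \<Otimes>\<^sub>M array_space n m)"
  unfolding H1_law_def by (rule sets_bind) simp_all

lemma prob_space_H1_law: "prob_space (H1_law n m \<rho>)"
  unfolding H1_law_def
  by (rule measure_pmf.prob_space_bind[OF _ measurable_H1_cond_law])
    (simp add: prob_space_H1_cond_law)

lemma measure_H1_law:
  assumes "E \<in> sets (array_space n m \<Otimes>\<^sub>M array_space n m)"
  shows "measure (H1_law n m \<rho>) E =
    (\<Sum>\<pi> | \<pi> permutes {1..n}. measure (H1_cond_law n m \<rho> \<pi>) E) / fact n"
proof -
  have "measure (H1_law n m \<rho>) E =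
      (\<integral>\<pi>. measure (H1_cond_law n m \<rho> \<pi>) E \<partial>measure_pmf (pmf_of_set {\<pi>. \<pi> permutes {1..n}}))"
    unfolding H1_law_def by (rule measure_pmf.measure_bind[OF measurable_H1_cond_law assms])
  also have "\<dots> = (\<Sum>\<pi> | \<pi> permutes {1..n}. measure (H1_cond_law n m \<rho> \<pi>) E) /
      real (card {\<pi>. \<pi> permutes {1..n}})"
    by (rule integral_pmf_of_set) (auto intro: permutes_id finite_permutations)
  also have "card {\<pi>. \<pi> permutes {1..n}} = fact n"
    by (rule card_permutations) simp_all
  finally show ?thesis by simp
qed

end

theory Submission
  imports Defs "HOL-Real_Asymp.Real_Asymp"
begin

text \<open>
  Distinguishing: the statistic \<open>max\<^sub>\<pi> \<Sum>\<^sub>e A\<^sub>1 e * A\<^sub>2 (\<pi> ` e)\<close> is compared with a level slightly below its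
  value under \<open>H\<^sub>1\<close>. Chernoff bounds control both errors, and the union bound over \<open>fact n\<close>
  permutations is affordable because \<open>fact n\<close> is smaller than \<open>n ^ n\<close> by the factor \<open>exp (- n)\<close>.

  Indistinguishing: given \<open>\<pi>\<close>, the likelihood ratio is a product of Mehler kernels, and the mixed
  second moment of two of them factorises over the orbits of \<open>\<sigma> = \<pi>' \<circ> inv \<pi>\<close> on hyperedges, an orbit of
  length \<open>k\<close> contributing \<open>1 / (1 - \<rho> ^ (2 * k))\<close>. Only fixed hyperedges matter to leading order, and
  the plain second moment loses a factor of two in \<open>\<rho>\<^sup>2\<close> because of permutations \<open>\<sigma>\<close> with about \<open>n\<close>
  fixed points. Truncating each likelihood ratio to the event that
  \<open>\<Sum>\<^sub>e A\<^sub>1 e * A\<^sub>2 (\<pi> ` e)\<close> is not atypically large on any large vertex set halves the exponent for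
  such \<open>\<sigma>\<close>. What remains is an average over \<open>\<sigma>\<close> in which \<open>p\<close> fixed points have probability at most
  \<open>1 / fact p\<close>, and in which fixed hyperedges that contain moved vertices, as well as orbits of length
  two, are controlled by the number of points in two-cycles of \<open>\<sigma>\<close>.
\<close>

section \<open>Gaussian integrals and the Mehler kernel\<close>

text \<open>The constant in the threshold is where two exponents meet. Put
  \<open>D = 2 * n * ln n\<close> and \<open>N = n choose m\<close>. That is the size of
  \<open>1 / fact n\<close> up to \<open>exp (- n)\<close>. In the other direction the identity
  overlap has probability \<open>1 / fact n\<close>, while its plain second moment is about
  \<open>exp ((1 - \<epsilon>) * D)\<close>; truncation replaces this by roughly its square root.

  The vertex set on which two permutations agree depends on the pair, so the truncation has to hold
  on all large vertex sets at once. This costs a factor \<open>2 ^ n\<close>, against failure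
  probabilities \<open>exp (- c * n * ln n)\<close>.

  Since \<rho> may lie far below the threshold, the truncation level is set by the value
  \<open>\<rho>\<^sub>1\<close> at the threshold instead of \<rho>. Nothing is lost, because
  \<open>\<rho> * \<rho>\<^sub>1 - \<rho>\<^sup>2 / 2 \<le> \<rho>\<^sub>1\<^sup>2 /
  2\<close>.\<close>

abbreviation std_normal :: "real measure" where
  "std_normal \<equiv> density lborel std_normal_density"

lemma prob_space_std_normal: "prob_space std_normal"
  by (rule prob_space_normal_density) simp

lemma nn_integral_normal_density:
  assumes "0 < \<sigma>"
  shows "(\<integral>\<^sup>+x. ennreal (normal_density \<mu> \<sigma> x) \<partial>lborel) = 1"
proof -
  interpret prob_space "density lborel (normal_density \<mu> \<sigma>)"
    using assms by (rule prob_space_normal_density)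
  show ?thesis
    using emeasure_space_1 by (simp add: emeasure_density)
qed

text \<open>Completing the square makes the integrand a multiple of the normal density with mean
  \<open>b / (1 + a)\<close> and variance \<open>1 / (1 + a)\<close>. The exponential moments below
  reduce to this one by integrating a single variable at a time.\<close>

lemma nn_integral_std_normal_exp_quadratic:
  assumes "-1 < a"
  shows "(\<integral>\<^sup>+x. ennreal (exp (b * x - a * x\<^sup>2 / 2)) \<partial>std_normal) =
    ennreal (exp (b\<^sup>2 / (2 * (1 + a))) / sqrt (1 + a))"
proof -
  define \<sigma> where "\<sigma> = 1 / sqrt (1 + a)"
  define \<mu> where "\<mu> = b / (1 + a)"
  define C where "C = exp (b\<^sup>2 / (2 * (1 + a))) / sqrt (1 + a)"
  have a: "1 + a > 0" using assms by simp
  have s: "\<sigma> > 0" "\<sigma>\<^sup>2 = 1 / (1 + a)" using a by (auto simp: \<sigma>_def power_divide)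
  have C0: "C \<ge> 0" using a by (auto simp: C_def)
  have ex: "- x\<^sup>2 / 2 + (b * x - a * x\<^sup>2 / 2) = b\<^sup>2 / (2 * (1 + a)) + - (x - \<mu>)\<^sup>2 / (2 * \<sigma>\<^sup>2)" for x
  proof -
    have "(x - b / (1 + a))\<^sup>2 * (1 + a) = (1 + a) * x\<^sup>2 - 2 * b * x + b\<^sup>2 / (1 + a)"
      using a by (simp add: divide_simps power2_eq_square) algebra
    moreover have "- (x - b / (1 + a))\<^sup>2 / (2 * (1 / (1 + a))) = - ((x - b / (1 + a))\<^sup>2 * (1 + a)) / 2"
      "b\<^sup>2 / (2 * (1 + a)) = (b\<^sup>2 / (1 + a)) / 2"
      by simp_all
    ultimately have "b\<^sup>2 / (2 * (1 + a)) + - (x - b / (1 + a))\<^sup>2 / (2 * (1 / (1 + a))) =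
        (b\<^sup>2 / (1 + a)) / 2 - ((1 + a) * x\<^sup>2 - 2 * b * x + b\<^sup>2 / (1 + a)) / 2"
      by (simp only:)
    then show ?thesis unfolding s(2) \<mu>_def by (simp add: diff_divide_distrib add_divide_distrib distrib_right)
  qed
  have sq: "sqrt (2 * pi * \<sigma>\<^sup>2) = sqrt (2 * pi) / sqrt (1 + a)"
    unfolding s(2) by (simp add: real_sqrt_divide real_sqrt_mult)
  have pt: "std_normal_density x * exp (b * x - a * x\<^sup>2 / 2) = C * normal_density \<mu> \<sigma> x" for x
  proof -
    have "std_normal_density x * exp (b * x - a * x\<^sup>2 / 2) =
        1 / sqrt (2 * pi) * exp (- x\<^sup>2 / 2 + (b * x - a * x\<^sup>2 / 2))"
      by (simp add: std_normal_density_def exp_add[symmetric])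
    also have "\<dots> = 1 / sqrt (2 * pi) * (exp (b\<^sup>2 / (2 * (1 + a))) * exp (- (x - \<mu>)\<^sup>2 / (2 * \<sigma>\<^sup>2)))"
      by (simp only: ex exp_add)
    also have "\<dots> = C * normal_density \<mu> \<sigma> x"
      unfolding normal_density_def sq C_def using a by simp
    finally show ?thesis .
  qed
  have "(\<integral>\<^sup>+x. ennreal (exp (b * x - a * x\<^sup>2 / 2)) \<partial>std_normal) =
     (\<integral>\<^sup>+x. ennreal (std_normal_density x) * ennreal (exp (b * x - a * x\<^sup>2 / 2)) \<partial>lborel)"
    by (rule nn_integral_density) auto
  also have "\<dots> = (\<integral>\<^sup>+x. ennreal C * ennreal (normal_density \<mu> \<sigma> x) \<partial>lborel)"
    using C0 by (intro nn_integral_cong) (simp add: ennreal_mult'[symmetric] pt)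
  also have "\<dots> = ennreal C"
    by (subst nn_integral_cmult) (auto simp: nn_integral_normal_density[OF s(1)])
  finally show ?thesis by (simp add: C_def)
qed

text \<open>
  The density of \<open>bivariate_normal a\<close> with respect to the product of its margins. As the kernel of
  the Ornstein-Uhlenbeck semigroup, it composes by multiplying the parameters.
\<close>

definition mehler :: "real \<Rightarrow> real \<Rightarrow> real \<Rightarrow> real" where
  "mehler a x y = exp ((2 * a * x * y - a\<^sup>2 * (x\<^sup>2 + y\<^sup>2)) / (2 * (1 - a\<^sup>2))) / sqrt (1 - a\<^sup>2)"

lemma borel_measurable_mehler [measurable]:
  "case_prod (mehler a) \<in> borel_measurable (borel \<Otimes>\<^sub>M borel)"
  unfolding mehler_def case_prod_beta by measurable

lemma borel_measurable_mehler_comp [measurable]: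
  assumes [measurable]: "f \<in> borel_measurable M" "g \<in> borel_measurable M"
  shows "(\<lambda>x. mehler a (f x) (g x)) \<in> borel_measurable M"
  unfolding mehler_def by measurable

lemma mehler_nonneg: "\<bar>a\<bar> < 1 \<Longrightarrow> 0 \<le> mehler a x y"
  by (simp add: mehler_def abs_square_less_1 less_imp_le)

lemma mehler_0 [simp]: "mehler 0 x y = 1"
  by (simp add: mehler_def)

lemma mehler_commute: "mehler a x y = mehler a y x"
  by (simp add: mehler_def algebra_simps)

text \<open>The kernel is diagonal in the Hermite basis with eigenvalues \<open>a ^ k\<close>, so
  its trace is a geometric series; the proof evaluates the integral directly. This is what an orbit
  contributes once all its kernels are merged into one.\<close>

lemma nn_integral_mehler_trace:
  assumes "0 \<le> a" "a < 1"
  shows "(\<integral>\<^sup>+y. ennreal (mehler a y y) \<partial>std_normal) = ennreal (1 / (1 - a))"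
proof -
  define A where "A = - 2 * a / (1 + a)"
  have A: "1 + A = (1 - a) / (1 + a)" using assms by (simp add: A_def field_simps)
  have "-1 < A" using A assms by (smt (verit) divide_pos_pos)
  have e: "(2 * a * y * y - a\<^sup>2 * (y\<^sup>2 + y\<^sup>2)) / (2 * (1 - a\<^sup>2)) = 0 * y - A * y\<^sup>2 / 2" for y
  proof -
    have "(2 * a * y * y - a\<^sup>2 * (y\<^sup>2 + y\<^sup>2)) = (1 - a) * (2 * a * y\<^sup>2)"
      "2 * (1 - a\<^sup>2) = (1 - a) * (2 * (1 + a))"
      by (simp_all add: power2_eq_square algebra_simps)
    then show ?thesis unfolding A_def using assms by simp
  qed
  have "(\<integral>\<^sup>+y. ennreal (mehler a y y) \<partial>std_normal) =
     (\<integral>\<^sup>+y. ennreal (1 / sqrt (1 - a\<^sup>2)) * ennreal (exp (0 * y - A * y\<^sup>2 / 2)) \<partial>std_normal)"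
    unfolding mehler_def e using assms
    by (intro nn_integral_cong) (simp add: ennreal_mult'[symmetric] abs_square_le_1)
  also have "\<dots> = ennreal (1 / sqrt (1 - a\<^sup>2)) * ennreal (exp (0\<^sup>2 / (2 * (1 + A))) / sqrt (1 + A))"
    by (subst nn_integral_cmult, simp, subst nn_integral_std_normal_exp_quadratic[OF \<open>-1 < A\<close>]) simp
  also have "\<dots> = ennreal (1 / sqrt ((1 - a\<^sup>2) * (1 + A)))"
    using assms \<open>-1 < A\<close> by (simp add: ennreal_mult'[symmetric] abs_square_le_1 real_sqrt_mult)
  also have "(1 - a\<^sup>2) * (1 + A) = (1 - a)\<^sup>2"
    unfolding A using assms by (simp add: field_simps power2_eq_square)
  finally show ?thesis using assms by simp
qed

lemma nn_integral_mehler_mult: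
  assumes "0 \<le> a" "a < 1" "0 \<le> b" "b < 1"
  shows "(\<integral>\<^sup>+y. ennreal (mehler a x y) * ennreal (mehler b y z) \<partial>std_normal) =
    ennreal (mehler (a * b) x z)"
proof -
  define \<alpha> where "\<alpha> = 1 - a\<^sup>2"
  define \<beta> where "\<beta> = 1 - b\<^sup>2"
  have p: "\<alpha> > 0" "\<beta> > 0" using assms by (auto simp: \<alpha>_def \<beta>_def abs_square_less_1)
  define A where "A = a\<^sup>2 / \<alpha> + b\<^sup>2 / \<beta>"
  define B where "B = a * x / \<alpha> + b * z / \<beta>"
  define C where "C = exp (- a\<^sup>2 * x\<^sup>2 / (2 * \<alpha>) - b\<^sup>2 * z\<^sup>2 / (2 * \<beta>)) / (sqrt \<alpha> * sqrt \<beta>)"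
  define \<kappa> where "\<kappa> = 1 - (a * b)\<^sup>2"
  have "a * b < 1" using assms by (metis mult_left_le less_eq_real_def mult.commute not_le order_le_less_trans)
  then have \<kappa>: "\<kappa> > 0" using assms by (auto simp: \<kappa>_def abs_square_less_1 abs_mult)
  \<comment> \<open>The coefficient left by completing the square carries the normalisation
    \<open>\<kappa>\<close> of the kernel with parameter \<open>a * b\<close>.\<close>
  have A1: "1 + A = \<kappa> / (\<alpha> * \<beta>)"
    using p unfolding A_def \<kappa>_def by (simp add: field_simps) (simp add: \<alpha>_def \<beta>_def algebra_simps)
  have "-1 < A" using p by (simp add: A_def add_nonneg_nonneg less_le_trans[of "-1" 0])
  have pt: "mehler a x y * mehler b y z = C * exp (B * y - A * y\<^sup>2 / 2)" for y
  proof -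
    have "(2 * a * x * y - a\<^sup>2 * (x\<^sup>2 + y\<^sup>2)) / (2 * \<alpha>) + (2 * b * y * z - b\<^sup>2 * (y\<^sup>2 + z\<^sup>2)) / (2 * \<beta>)
       = (- a\<^sup>2 * x\<^sup>2 / (2 * \<alpha>) - b\<^sup>2 * z\<^sup>2 / (2 * \<beta>)) + (B * y - A * y\<^sup>2 / 2)"
      using p unfolding A_def B_def by (simp add: field_simps)
    then show ?thesis
      unfolding mehler_def C_def \<alpha>_def[symmetric] \<beta>_def[symmetric]
      by (simp add: exp_add[symmetric])
  qed
  have fin: "C * (exp (B\<^sup>2 / (2 * (1 + A))) / sqrt (1 + A)) = mehler (a * b) x z"
  proof -
    have "(- a\<^sup>2 * x\<^sup>2 / (2 * \<alpha>) - b\<^sup>2 * z\<^sup>2 / (2 * \<beta>)) + B\<^sup>2 / (2 * (1 + A)) =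
      (2 * (a * b) * x * z - (a * b)\<^sup>2 * (x\<^sup>2 + z\<^sup>2)) / (2 * \<kappa>)"
    proof -
      have B2: "B\<^sup>2 / (2 * (1 + A)) = (a * x * \<beta> + b * z * \<alpha>)\<^sup>2 / (2 * \<alpha> * \<beta> * \<kappa>)"
        unfolding A1 B_def using p \<kappa> by (simp add: field_simps power2_eq_square)
      have "(- a\<^sup>2 * x\<^sup>2 / (2 * \<alpha>) - b\<^sup>2 * z\<^sup>2 / (2 * \<beta>)) =
         (- a\<^sup>2 * x\<^sup>2 * \<beta> * \<kappa> - b\<^sup>2 * z\<^sup>2 * \<alpha> * \<kappa>) / (2 * \<alpha> * \<beta> * \<kappa>)"
        using p \<kappa> by (simp add: field_simps)
      moreover have "(2 * (a * b) * x * z - (a * b)\<^sup>2 * (x\<^sup>2 + z\<^sup>2)) / (2 * \<kappa>) =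
          (2 * (a * b) * x * z - (a * b)\<^sup>2 * (x\<^sup>2 + z\<^sup>2)) * \<alpha> * \<beta> / (2 * \<alpha> * \<beta> * \<kappa>)"
        using p \<kappa> by (simp add: field_simps)
      \<comment> \<open>Over the common denominator \<open>2 * \<alpha> * \<beta> * \<kappa>\<close>
        the comparison of exponents becomes this polynomial identity.\<close>
      moreover have "- a\<^sup>2 * x\<^sup>2 * \<beta> * \<kappa> - b\<^sup>2 * z\<^sup>2 * \<alpha> * \<kappa> + (a * x * \<beta> + b * z * \<alpha>)\<^sup>2 =
          (2 * (a * b) * x * z - (a * b)\<^sup>2 * (x\<^sup>2 + z\<^sup>2)) * \<alpha> * \<beta>"
        unfolding \<alpha>_def \<beta>_def \<kappa>_def by algebra
      ultimately show ?thesis unfolding B2 by (simp add: add_divide_distrib[symmetric])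
    qed
    moreover have "sqrt \<alpha> * sqrt \<beta> * sqrt (1 + A) = sqrt \<kappa>"
      unfolding A1 using p by (simp add: real_sqrt_mult real_sqrt_divide)
    ultimately show ?thesis
      unfolding C_def mehler_def \<kappa>_def[symmetric] by (simp add: exp_add[symmetric])
  qed
  have C0: "C \<ge> 0" using p by (simp add: C_def)
  have "(\<integral>\<^sup>+y. ennreal (mehler a x y) * ennreal (mehler b y z) \<partial>std_normal) =
     (\<integral>\<^sup>+y. ennreal C * ennreal (exp (B * y - A * y\<^sup>2 / 2)) \<partial>std_normal)"
    using assms C0
    by (intro nn_integral_cong) (simp add: ennreal_mult'[symmetric] pt mehler_nonneg)
  also have "\<dots> = ennreal C * ennreal (exp (B\<^sup>2 / (2 * (1 + A))) / sqrt (1 + A))"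
    by (subst nn_integral_cmult, simp, subst nn_integral_std_normal_exp_quadratic[OF \<open>-1 < A\<close>]) simp
  also have "\<dots> = ennreal (mehler (a * b) x z)"
    using C0 fin by (simp add: ennreal_mult'[symmetric])
  finally show ?thesis .
qed

text \<open>
  The tilt \<open>\<rho> / (1 - \<rho>\<^sup>2)\<close> agrees to leading order with the optimal Chernoff parameter \<open>\<rho>\<close>, and it
  makes the determinant of the Gaussian integral factor.
\<close>

lemma nn_integral_mehler_tilted:
  assumes "0 \<le> \<rho>" "\<rho> < 1"
  shows "(\<integral>\<^sup>+y. \<integral>\<^sup>+x. ennreal (mehler \<rho> x y) * ennreal (mehler \<rho> x y) *
       ennreal (exp (- (\<rho> / (1 - \<rho>\<^sup>2)) * (x * y))) \<partial>std_normal \<partial>std_normal)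
     = ennreal (1 / sqrt (1 + \<rho>\<^sup>2 + \<rho>\<^sup>2 * \<rho>\<^sup>2))"
proof -
  define r where "r = \<rho>\<^sup>2"
  have r: "0 \<le> r" "r < 1" using assms by (auto simp: r_def abs_square_less_1)
  define A where "A = 2 * r / (1 - r)"
  have A1: "1 + A = (1 + r) / (1 - r)" using r by (simp add: A_def field_simps)
  have A: "-1 < A" using r by (smt (verit, best) A_def divide_nonneg_pos)
  \<comment> \<open>\<open>A'\<close> is the quadratic coefficient in \<open>y\<close> that remains
    after \<open>x\<close> has been integrated out.\<close>
  define A' where "A' = (r + 2 * r\<^sup>2) / (1 - r\<^sup>2)"
  have r2: "1 - r\<^sup>2 > 0" using r by (auto simp: abs_square_less_1)
  have A'1: "1 + A' = (1 + r + r\<^sup>2) / (1 - r\<^sup>2)" using r2 by (simp add: A'_def field_simps)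
  have A': "-1 < A'" using r r2 by (smt (verit, best) A'_def divide_nonneg_pos zero_le_power2)
  define C where "C y = exp (- r * y\<^sup>2 / (1 - r)) / (1 - r)" for y
  have pt: "mehler \<rho> x y * mehler \<rho> x y * exp (- (\<rho> / (1 - \<rho>\<^sup>2)) * (x * y)) =
      C y * exp (\<rho> * y / (1 - r) * x - A * x\<^sup>2 / 2)" for x y
  proof -
    have "(2 * \<rho> * x * y - r * (x\<^sup>2 + y\<^sup>2)) / (2 * (1 - r)) + (2 * \<rho> * x * y - r * (x\<^sup>2 + y\<^sup>2)) / (2 * (1 - r))
        + (- (\<rho> / (1 - r)) * (x * y)) = - r * y\<^sup>2 / (1 - r) + (\<rho> * y / (1 - r) * x - A * x\<^sup>2 / 2)"
    proof -
      have h: "u / (2 * v) + u / (2 * v) = u / v" for u v :: real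
        by (simp add: add_divide_distrib[symmetric])
      have Ax: "A * x\<^sup>2 / 2 = r * x\<^sup>2 / (1 - r)" using r by (simp add: A_def field_simps)
      have "(2 * \<rho> * x * y - r * (x\<^sup>2 + y\<^sup>2)) / (1 - r) + (- (\<rho> / (1 - r)) * (x * y)) =
          - r * y\<^sup>2 / (1 - r) + (\<rho> * y / (1 - r) * x - r * x\<^sup>2 / (1 - r))"
        unfolding divide_inverse by algebra
      then show ?thesis unfolding h Ax .
    qed
    moreover have "sqrt (1 - r) * sqrt (1 - r) = 1 - r" using r by simp
    ultimately show ?thesis unfolding mehler_def C_def r_def[symmetric]
      by (simp add: exp_add[symmetric])
  qed
  have inner: "(\<integral>\<^sup>+x. ennreal (mehler \<rho> x y) * ennreal (mehler \<rho> x y) *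
       ennreal (exp (- (\<rho> / (1 - \<rho>\<^sup>2)) * (x * y))) \<partial>std_normal)
     = ennreal (1 / ((1 - r) * sqrt (1 + A))) * ennreal (exp (0 * y - A' * y\<^sup>2 / 2))" for y
  proof -
    have C0: "C y \<ge> 0" using r by (simp add: C_def)
    have "(\<integral>\<^sup>+x. ennreal (mehler \<rho> x y) * ennreal (mehler \<rho> x y) *
       ennreal (exp (- (\<rho> / (1 - \<rho>\<^sup>2)) * (x * y))) \<partial>std_normal) =
      (\<integral>\<^sup>+x. ennreal (C y) * ennreal (exp (\<rho> * y / (1 - r) * x - A * x\<^sup>2 / 2)) \<partial>std_normal)"
      using assms C0
      by (intro nn_integral_cong)
        (simp only: ennreal_mult'[symmetric] pt[symmetric] mult_nonneg_nonneg mehler_nonneg abs_of_nonneg)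
    also have "\<dots> = ennreal (C y) * ennreal (exp ((\<rho> * y / (1 - r))\<^sup>2 / (2 * (1 + A))) / sqrt (1 + A))"
      by (subst nn_integral_cmult, simp, subst nn_integral_std_normal_exp_quadratic[OF A]) simp
    also have "\<dots> = ennreal (C y * (exp ((\<rho> * y / (1 - r))\<^sup>2 / (2 * (1 + A))) / sqrt (1 + A)))"
      using C0 by (simp add: ennreal_mult'[symmetric])
    also have "C y * (exp ((\<rho> * y / (1 - r))\<^sup>2 / (2 * (1 + A))) / sqrt (1 + A)) =
       1 / ((1 - r) * sqrt (1 + A)) * exp (0 * y - A' * y\<^sup>2 / 2)"
    proof -
      have "(\<rho> * y / (1 - r))\<^sup>2 = r * y\<^sup>2 / (1 - r)\<^sup>2" by (simp add: power_divide power_mult_distrib r_def)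
      then have "(\<rho> * y / (1 - r))\<^sup>2 / (2 * (1 + A)) = r * y\<^sup>2 / (2 * ((1 - r) * (1 + r)))"
      proof -
        have "t / c\<^sup>2 / (2 * (d / c)) = t / (2 * (c * d))" if "c > 0" "d > 0" for t c d :: real
          using that by (simp add: field_simps power2_eq_square)
        from this[of "1 - r" "1 + r" "r * y\<^sup>2"] show ?thesis
          unfolding A1 \<open>(\<rho> * y / (1 - r))\<^sup>2 = r * y\<^sup>2 / (1 - r)\<^sup>2\<close> using r by simp
      qed
      moreover have "- r * y\<^sup>2 / (1 - r) + r * y\<^sup>2 / (2 * ((1 - r) * (1 + r))) = - A' * y\<^sup>2 / 2"
      proof -
        have e: "1 - r\<^sup>2 = (1 - r) * (1 + r)" by (simp add: power2_eq_square algebra_simps)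
        have "- r * y\<^sup>2 / (1 - r) = - 2 * r * (1 + r) * y\<^sup>2 / (2 * ((1 - r) * (1 + r)))"
          using r by simp
        then have "- r * y\<^sup>2 / (1 - r) + r * y\<^sup>2 / (2 * ((1 - r) * (1 + r))) =
            (- 2 * r * (1 + r) * y\<^sup>2 + r * y\<^sup>2) / (2 * ((1 - r) * (1 + r)))"
          by (simp only: add_divide_distrib)
        also have "- 2 * r * (1 + r) * y\<^sup>2 + r * y\<^sup>2 = - ((r + 2 * r\<^sup>2) * y\<^sup>2)"
          by (simp add: power2_eq_square algebra_simps)
        finally show ?thesis unfolding A'_def e by simp
      qed
      ultimately show ?thesis unfolding C_def by (simp add: exp_add[symmetric])
    qed
    finally show ?thesis using r A by (simp add: ennreal_mult'[symmetric])
  qed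
  have "(\<integral>\<^sup>+y. \<integral>\<^sup>+x. ennreal (mehler \<rho> x y) * ennreal (mehler \<rho> x y) *
       ennreal (exp (- (\<rho> / (1 - \<rho>\<^sup>2)) * (x * y))) \<partial>std_normal \<partial>std_normal) =
       ennreal (1 / ((1 - r) * sqrt (1 + A))) * ennreal (exp (0\<^sup>2 / (2 * (1 + A'))) / sqrt (1 + A'))"
    unfolding inner
    by (subst nn_integral_cmult, simp, subst nn_integral_std_normal_exp_quadratic[OF A']) simp
  also have "\<dots> = ennreal (1 / ((1 - r) * sqrt (1 + A) * sqrt (1 + A')))"
    using r A A' by (simp add: ennreal_mult'[symmetric])
  also have "(1 - r) * sqrt (1 + A) * sqrt (1 + A') = sqrt ((1 - r)\<^sup>2 * (1 + A) * (1 + A'))"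
    using r by (simp add: real_sqrt_mult)
  also have "(1 - r)\<^sup>2 * (1 + A) * (1 + A') = 1 + r + r * r"
  proof -
    have "1 - r\<^sup>2 = (1 - r) * (1 + r)" by (simp add: power2_eq_square algebra_simps)
    moreover have "c\<^sup>2 * (d / c) * (t / (c * d)) = t" if "c > 0" "d > 0" for t c d :: real
      using that by (simp add: power2_eq_square)
    ultimately show ?thesis unfolding A1 A'1 using r by (simp add: power2_eq_square)
  qed
  finally show ?thesis by (simp add: r_def)
qed

text \<open>No density is used here, since \<open>\<rho> = 1\<close> has to be covered.\<close>

lemma nn_integral_bivariate_normal_exp_mult:
  assumes \<rho>: "0 \<le> \<rho>" "\<rho> \<le> 1" and pos: "0 < 1 - 2 * \<rho> * \<theta> - \<theta>\<^sup>2 * (1 - \<rho>\<^sup>2)"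
  shows "(\<integral>\<^sup>+w. ennreal (exp (\<theta> * (fst w * snd w))) \<partial>bivariate_normal \<rho>) =
    ennreal (1 / sqrt (1 - 2 * \<rho> * \<theta> - \<theta>\<^sup>2 * (1 - \<rho>\<^sup>2)))"
proof -
  interpret N: prob_space std_normal by (rule prob_space_std_normal)
  interpret pair_prob_space std_normal std_normal ..
  have r: "0 \<le> 1 - \<rho>\<^sup>2" using \<rho> by (auto simp: abs_square_le_1)
  define A where "A = - 2 * \<rho> * \<theta> - \<theta>\<^sup>2 * (1 - \<rho>\<^sup>2)"
  have A: "-1 < A" using pos by (simp add: A_def)
  have "(\<integral>\<^sup>+w. ennreal (exp (\<theta> * (fst w * snd w))) \<partial>bivariate_normal \<rho>) =
    (\<integral>\<^sup>+p. ennreal (exp (\<theta> * (fst p * (\<rho> * fst p + sqrt (1 - \<rho>\<^sup>2) * snd p)))) \<partial>(std_normal \<Otimes>\<^sub>M std_normal))"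
    unfolding bivariate_normal_def by (subst nn_integral_distr) (auto simp: case_prod_beta)
  also have "\<dots> = (\<integral>\<^sup>+x. \<integral>\<^sup>+z. ennreal (exp (\<theta> * (x * (\<rho> * x + sqrt (1 - \<rho>\<^sup>2) * z)))) \<partial>std_normal \<partial>std_normal)"
    by (subst N.nn_integral_fst[symmetric]) auto
  also have "\<dots> = (\<integral>\<^sup>+x. ennreal (exp (0 * x - A * x\<^sup>2 / 2)) \<partial>std_normal)"
  proof (rule nn_integral_cong)
    fix x
    have "(\<integral>\<^sup>+z. ennreal (exp (\<theta> * (x * (\<rho> * x + sqrt (1 - \<rho>\<^sup>2) * z)))) \<partial>std_normal) =
      (\<integral>\<^sup>+z. ennreal (exp (\<theta> * \<rho> * x\<^sup>2)) * ennreal (exp (\<theta> * x * sqrt (1 - \<rho>\<^sup>2) * z - 0 * z\<^sup>2 / 2)) \<partial>std_normal)"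
      by (intro nn_integral_cong)
        (simp add: ennreal_mult'[symmetric] exp_add[symmetric] power2_eq_square algebra_simps)
    also have "\<dots> = ennreal (exp (\<theta> * \<rho> * x\<^sup>2)) * ennreal (exp ((\<theta> * x * sqrt (1 - \<rho>\<^sup>2))\<^sup>2 / (2 * (1 + 0))) / sqrt (1 + 0))"
      by (subst nn_integral_cmult, simp, subst nn_integral_std_normal_exp_quadratic) auto
    also have "\<dots> = ennreal (exp (0 * x - A * x\<^sup>2 / 2))"
      using r by (simp add: ennreal_mult'[symmetric] exp_add[symmetric] A_def power_mult_distrib)
        (simp add: field_simps)
    finally show "(\<integral>\<^sup>+z. ennreal (exp (\<theta> * (x * (\<rho> * x + sqrt (1 - \<rho>\<^sup>2) * z)))) \<partial>std_normal) =
      ennreal (exp (0 * x - A * x\<^sup>2 / 2))" .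
  qed
  also have "\<dots> = ennreal (exp (0\<^sup>2 / (2 * (1 + A))) / sqrt (1 + A))"
    by (rule nn_integral_std_normal_exp_quadratic[OF A])
  finally show ?thesis by (simp add: A_def algebra_simps)
qed

text \<open>For fixed \<open>x\<close> the substitution \<open>y = \<rho> * x + c * z\<close> turns
  the standard normal law of \<open>z\<close> into the conditional law of \<open>y\<close>, whose
  density relative to the standard normal law is the Mehler kernel. It needs \<open>c > 0\<close>,
  hence \<open>\<rho> < 1\<close>.\<close>

lemma emeasure_bivariate_normal:
  assumes \<rho>: "0 \<le> \<rho>" "\<rho> < 1" and A [measurable]: "A \<in> sets (borel \<Otimes>\<^sub>M borel)"
  shows "emeasure (bivariate_normal \<rho>) A =
    (\<integral>\<^sup>+x. \<integral>\<^sup>+y. ennreal (mehler \<rho> x y) * indicator A (x, y) \<partial>std_normal \<partial>std_normal)"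
proof -
  interpret N: prob_space std_normal by (rule prob_space_std_normal)
  interpret pair_prob_space std_normal std_normal ..
  define c where "c = sqrt (1 - \<rho>\<^sup>2)"
  have c2: "c\<^sup>2 = 1 - \<rho>\<^sup>2" using \<rho> by (auto simp: c_def abs_square_le_1)
  have c: "c > 0" using \<rho> by (auto simp: c_def abs_square_less_1)
  have "emeasure (bivariate_normal \<rho>) A = (\<integral>\<^sup>+w. indicator A w \<partial>bivariate_normal \<rho>)"
    by simp
  also have "\<dots> =
    (\<integral>\<^sup>+p. indicator A (fst p, \<rho> * fst p + c * snd p) \<partial>(std_normal \<Otimes>\<^sub>M std_normal))"
    unfolding bivariate_normal_def c_def by (subst nn_integral_distr) (auto simp: case_prod_beta)
  also have "\<dots> = (\<integral>\<^sup>+x. \<integral>\<^sup>+z. indicator A (x, \<rho> * x + c * z) \<partial>std_normal \<partial>std_normal)"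
    by (subst N.nn_integral_fst[symmetric]) auto
  also have "\<dots> = (\<integral>\<^sup>+x. \<integral>\<^sup>+y. ennreal (mehler \<rho> x y) * indicator A (x, y) \<partial>std_normal \<partial>std_normal)"
  proof (rule nn_integral_cong)
    fix x :: real
    define g where "g y = ennreal (std_normal_density ((y - \<rho> * x) / c)) * indicator A (x, y)" for y
    have [measurable]: "g \<in> borel_measurable borel" unfolding g_def by measurable
    have pt: "std_normal_density ((y - \<rho> * x) / c) / c = std_normal_density y * mehler \<rho> x y" for y
    proof -
      have "- ((y - \<rho> * x) / c)\<^sup>2 / 2 = - y\<^sup>2 / 2 + (2 * \<rho> * x * y - \<rho>\<^sup>2 * (x\<^sup>2 + y\<^sup>2)) / (2 * c\<^sup>2)"
      proof -
        have "(2 * \<rho> * x * y - \<rho>\<^sup>2 * (x\<^sup>2 + y\<^sup>2)) - y\<^sup>2 * c\<^sup>2 = - (y - \<rho> * x)\<^sup>2"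
          unfolding c2 by (simp add: power2_eq_square algebra_simps)
        then have "- (y - \<rho> * x)\<^sup>2 / (2 * c\<^sup>2) = ((2 * \<rho> * x * y - \<rho>\<^sup>2 * (x\<^sup>2 + y\<^sup>2)) - y\<^sup>2 * c\<^sup>2) / (2 * c\<^sup>2)"
          by simp
        also have "\<dots> = - y\<^sup>2 / 2 + (2 * \<rho> * x * y - \<rho>\<^sup>2 * (x\<^sup>2 + y\<^sup>2)) / (2 * c\<^sup>2)"
          using c by (simp add: diff_divide_distrib)
        finally show ?thesis by (simp add: power_divide)
      qed
      then show ?thesis
        unfolding std_normal_density_def mehler_def c2[symmetric] using c
        by (simp add: exp_add[symmetric])
    qed
    have "(\<integral>\<^sup>+z. indicator A (x, \<rho> * x + c * z) \<partial>std_normal) =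
        (\<integral>\<^sup>+z. ennreal (std_normal_density z) * indicator A (x, \<rho> * x + c * z) \<partial>lborel)"
      by (rule nn_integral_density) auto
    also have "\<dots> = (\<integral>\<^sup>+z. g (\<rho> * x + c * z) \<partial>lborel)"
      unfolding g_def using c by simp
    \<comment> \<open>The Jacobian \<open>\<bar>c\<bar>\<close> is inserted to match the affine
      substitution rule.\<close>
    also have "\<dots> = ennreal (1 / c) * (ennreal \<bar>c\<bar> * (\<integral>\<^sup>+z. g (\<rho> * x + c * z) \<partial>lborel))"
      using c by (simp add: mult.assoc[symmetric] ennreal_mult'[symmetric])
    also have "\<dots> = ennreal (1 / c) * (\<integral>\<^sup>+y. g y \<partial>lborel)"
      using c by (subst nn_integral_real_affine[of g c "\<rho> * x", symmetric]) auto
    also have "\<dots> = (\<integral>\<^sup>+y. ennreal (1 / c) * g y \<partial>lborel)"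
      by (rule nn_integral_cmult[symmetric]) auto
    also have "\<dots> = (\<integral>\<^sup>+y. ennreal (std_normal_density y) * (ennreal (mehler \<rho> x y) * indicator A (x, y)) \<partial>lborel)"
      using c \<rho> by (intro nn_integral_cong)
        (simp add: g_def mult.assoc[symmetric] ennreal_mult'[symmetric] mehler_nonneg pt[symmetric])
    also have "\<dots> = (\<integral>\<^sup>+y. ennreal (mehler \<rho> x y) * indicator A (x, y) \<partial>std_normal)"
      by (rule nn_integral_density[symmetric]) auto
    finally show "(\<integral>\<^sup>+z. indicator A (x, \<rho> * x + c * z) \<partial>std_normal) = \<dots>" .
  qed
  finally show ?thesis .
qed

section \<open>Cyclic products of Mehler kernels\<close>

lemma borel_measurable_kernel:
  assumes "\<And>e. e \<in> I \<Longrightarrow> case_prod (\<kappa> e) \<in> borel_measurable (borel \<Otimes>\<^sub>M borel)"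
    and "s permutes I" "J \<subseteq> I" "\<And>e. e \<in> I \<Longrightarrow> sets (N e) = sets borel"
  shows "(\<lambda>y. \<Prod>e\<in>J. \<kappa> e (y e) (y (s e)) :: ennreal) \<in> borel_measurable (PiM I N)"
proof (rule borel_measurable_prod_ennreal)
  fix e assume "e \<in> J"
  then have e: "e \<in> I" "s e \<in> I" using assms(3) permutes_in_image[OF assms(2)] by auto
  have m: "(\<lambda>y. y f) \<in> borel_measurable (PiM I N)" if "f \<in> I" for f
    using measurable_component_singleton[OF that, of N] assms(4)[OF that]
    by (simp cong: measurable_cong_sets)
  have "(\<lambda>y. (y e, y (s e))) \<in> PiM I N \<rightarrow>\<^sub>M borel \<Otimes>\<^sub>M borel"
    by (intro measurable_Pair m e)
  from measurable_compose[OF this assms(1)[OF e(1)]]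
  show "(\<lambda>y. \<kappa> e (y e) (y (s e))) \<in> borel_measurable (PiM I N)" by simp
qed

text \<open>
  The bound is proved by integrating out one coordinate that is not fixed by \<open>s\<close>, which merges its
  kernel with that of its predecessor. The conditions on the weights \<open>W\<close> distinguish orbits of
  length one, two and more; they are local and survive the merging, so that no cycle decomposition
  is needed.
\<close>

lemma nn_integral_cyclic_kernel_le:
  fixes s :: "'i \<Rightarrow> 'i" and \<kappa> :: "'i \<Rightarrow> real \<Rightarrow> real \<Rightarrow> ennreal"
  assumes fin: "finite I" and s: "s permutes I" and r: "0 \<le> r" "r < 1"
    and meas: "\<And>e. e \<in> I \<Longrightarrow> case_prod (\<kappa> e) \<in> borel_measurable (borel \<Otimes>\<^sub>M borel)"
    and W: "\<And>e. e \<in> I \<Longrightarrow> 0 \<le> W e"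
    and fixed: "\<And>e. e \<in> I \<Longrightarrow> s e = e \<Longrightarrow> (\<integral>\<^sup>+y. \<kappa> e y y \<partial>std_normal) \<le> ennreal (W e)"
    and \<kappa>: "\<And>e. e \<in> I \<Longrightarrow> s e \<noteq> e \<Longrightarrow> \<kappa> e = (\<lambda>x y. ennreal (mehler (a e) x y))"
    and a: "\<And>e. e \<in> I \<Longrightarrow> s e \<noteq> e \<Longrightarrow> 0 \<le> a e" "\<And>e. e \<in> I \<Longrightarrow> s e \<noteq> e \<Longrightarrow> a e \<le> r"
    and two: "\<And>e. e \<in> I \<Longrightarrow> s e \<noteq> e \<Longrightarrow> s (s e) = e \<Longrightarrow> 1 / (1 - a e * a (s e)) \<le> W e * W (s e)"
    and more: "\<And>e. e \<in> I \<Longrightarrow> s (s e) \<noteq> e \<Longrightarrow> 1 / (1 - r ^ 3) \<le> W e"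
  shows "(\<integral>\<^sup>+y. (\<Prod>e\<in>I. \<kappa> e (y e) (y (s e))) \<partial>PiM I (\<lambda>_. std_normal)) \<le> ennreal (\<Prod>e\<in>I. W e)"
  using assms
proof (induction "card I" arbitrary: I s \<kappa> W a rule: less_induct)
  case less
  note fin = less.prems(1) and s = less.prems(2) and meas = less.prems(5)
    and W = less.prems(6) and fixed = less.prems(7) and \<kappa> = less.prems(8)
    and a = less.prems(9,10) and two = less.prems(11) and more = less.prems(12)
  interpret N: prob_space std_normal by (rule prob_space_std_normal)
  interpret product_sigma_finite "\<lambda>_::'i. std_normal"
    by (simp add: product_sigma_finite_def N.sigma_finite_measure_axioms)
  show ?case
  proof (cases "\<forall>e\<in>I. s e = e")
    case True
    have m: "(\<lambda>y. \<kappa> e y y) \<in> borel_measurable std_normal" if "e \<in> I" for e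
    proof -
      have "(\<lambda>y::real. (y, y)) \<in> borel \<rightarrow>\<^sub>M borel \<Otimes>\<^sub>M borel" by simp
      from measurable_compose[OF this meas[OF that]] show ?thesis by simp
    qed
    have "(\<integral>\<^sup>+y. (\<Prod>e\<in>I. \<kappa> e (y e) (y (s e))) \<partial>PiM I (\<lambda>_. std_normal)) =
      (\<integral>\<^sup>+y. (\<Prod>e\<in>I. \<kappa> e (y e) (y e)) \<partial>PiM I (\<lambda>_. std_normal))"
      using True by (intro nn_integral_cong prod.cong) auto
    also have "\<dots> = (\<Prod>e\<in>I. \<integral>\<^sup>+y. \<kappa> e y y \<partial>std_normal)"
      by (rule product_nn_integral_prod[OF fin m])
    also have "\<dots> \<le> (\<Prod>e\<in>I. ennreal (W e))"
      using True fixed by (intro prod_mono_ennreal) auto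
    also have "\<dots> = ennreal (\<Prod>e\<in>I. W e)"
      using W by (intro prod_ennreal) auto
    finally show ?thesis .
  next
    case False
    then obtain e where e: "e \<in> I" "s e \<noteq> e" by auto
    define p where "p = inv s e"
    have inj: "s x = s y \<longleftrightarrow> x = y" for x y using permutes_inj[OF s] by (auto simp: inj_eq)
    have sp: "s p = e" unfolding p_def using permutes_inverses(1)[OF s] .
    have p: "p \<in> I" "p \<noteq> e" "s p \<noteq> p" using e sp permutes_in_image[OF s, of p] by auto
    have seI: "s e \<in> I" using e permutes_in_image[OF s] by auto
    define J where "J = I - {e}"
    \<comment> \<open>Composing with the transposition cuts \<open>e\<close> out of its cycle:
      \<open>p\<close> is now followed by \<open>s e\<close>, and all other arrows stay.\<close>
    define s' where "s' = Transposition.transpose e (s e) \<circ> s"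
    have s': "s' permutes J" unfolding s'_def J_def 
      using permutes_insert_lemma[of s e "I - {e}"] s e(1) by (simp add: insert_absorb)
    have s'p: "s' p = s e" by (simp add: s'_def sp)
    have s'o: "s' x = s x" if "x \<noteq> e" "x \<noteq> p" for x
    proof -
      have "s x \<noteq> e" using that sp inj[of x p] by auto
      moreover have "s x \<noteq> s e" using that inj by auto
      ultimately show ?thesis by (simp add: s'_def Transposition.transpose_def)
    qed
    \<comment> \<open>Integrating out \<open>e\<close> composes the kernels at \<open>p\<close> and
      \<open>e\<close>, so their parameters multiply. The weights are multiplied as well, which
      leaves the product of all weights unchanged.\<close>
    define a' where "a' = a(p := a p * a e)"
    define W' where "W' = W(p := W p * W e)"
    define \<kappa>' where "\<kappa>' = \<kappa>(p := \<lambda>x y. ennreal (mehler (a p * a e) x y))"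
    have finJ: "finite J" "e \<notin> J" "I = insert e J" using fin e by (auto simp: J_def)
    have pJ: "p \<in> J" "s e \<in> J" using p e seI by (auto simp: J_def)
    have s'J: "s' x = s x" if "x \<in> J" "x \<noteq> p" for x using s'o[of x] that finJ(2) by auto
    have ap: "0 \<le> a p" "a p \<le> r" "0 \<le> a e" "a e \<le> r" using a p e by auto
    have ape: "0 \<le> a p * a e" "a p * a e \<le> r * r" "a p * a e \<le> r"
    proof -
      show "0 \<le> a p * a e" "a p * a e \<le> r * r" using ap by (auto intro: mult_mono)
      then show "a p * a e \<le> r" using r by (meson mult_left_le order_trans less_imp_le)
    qed
    have integrate: "(\<integral>\<^sup>+y. (\<Prod>f\<in>I. \<kappa> f (y f) (y (s f))) \<partial>PiM I (\<lambda>_. std_normal)) =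
      (\<integral>\<^sup>+y. (\<Prod>f\<in>J. \<kappa>' f (y f) (y (s' f))) \<partial>PiM J (\<lambda>_. std_normal))"
    proof -
      have mI: "(\<lambda>y. \<Prod>f\<in>I. \<kappa> f (y f) (y (s f))) \<in> borel_measurable (PiM (insert e J) (\<lambda>_. std_normal))"
        unfolding finJ(3)[symmetric] by (rule borel_measurable_kernel[OF meas s]) auto
      have "(\<integral>\<^sup>+y. (\<Prod>f\<in>I. \<kappa> f (y f) (y (s f))) \<partial>PiM I (\<lambda>_. std_normal)) =
        (\<integral>\<^sup>+y. \<integral>\<^sup>+z. (\<Prod>f\<in>I. \<kappa> f ((y(e := z)) f) ((y(e := z)) (s f))) \<partial>std_normal \<partial>PiM J (\<lambda>_. std_normal))"
        using product_nn_integral_insert[OF finJ(1,2) mI] by (simp add: finJ(3)[symmetric])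
      also have "\<dots> = (\<integral>\<^sup>+y. (\<Prod>f\<in>J. \<kappa>' f (y f) (y (s' f))) \<partial>PiM J (\<lambda>_. std_normal))"
      proof (rule nn_integral_cong)
        fix y :: "'i \<Rightarrow> real"
        define R where "R = (\<Prod>f\<in>J - {p}. \<kappa> f (y f) (y (s f)))"
        have "(\<Prod>f\<in>I. \<kappa> f ((y(e := z)) f) ((y(e := z)) (s f))) =
            ennreal (mehler (a p) (y p) z) * ennreal (mehler (a e) z (y (s e))) * R" for z
        proof -
          have "(\<Prod>f\<in>J - {p}. \<kappa> f ((y(e := z)) f) ((y(e := z)) (s f))) = R"
            unfolding R_def
          proof (rule prod.cong[OF refl])
            fix f assume "f \<in> J - {p}"
            then have "f \<noteq> e" "s f \<noteq> e" using finJ sp inj[of f p] by auto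
            then show "\<kappa> f ((y(e := z)) f) ((y(e := z)) (s f)) = \<kappa> f (y f) (y (s f))" by simp
          qed
          then show ?thesis
            using finJ(1,2) p(2) e sp \<kappa>[OF e] \<kappa>[OF p(1,3)]
            by (simp add: finJ(3) prod.remove[OF finJ(1) pJ(1)] mult.assoc mult.left_commute)
        qed
        then have "(\<integral>\<^sup>+z. (\<Prod>f\<in>I. \<kappa> f ((y(e := z)) f) ((y(e := z)) (s f))) \<partial>std_normal) =
          (\<integral>\<^sup>+z. ennreal (mehler (a p) (y p) z) * ennreal (mehler (a e) z (y (s e))) * R \<partial>std_normal)"
          by simp
        also have "\<dots> = (\<integral>\<^sup>+z. ennreal (mehler (a p) (y p) z) * ennreal (mehler (a e) z (y (s e))) \<partial>std_normal) * R"
          by (rule nn_integral_multc) measurable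
        also have "\<dots> = ennreal (mehler (a p * a e) (y p) (y (s e))) * R"
          using ap r by (subst nn_integral_mehler_mult) auto
        also have "R = (\<Prod>f\<in>J - {p}. \<kappa>' f (y f) (y (s' f)))"
          unfolding R_def using finJ by (intro prod.cong) (auto simp: \<kappa>'_def s'J)
        also have "ennreal (mehler (a p * a e) (y p) (y (s e))) * \<dots> = (\<Prod>f\<in>J. \<kappa>' f (y f) (y (s' f)))"
          by (subst prod.remove[OF finJ(1) pJ(1)]) (simp add: \<kappa>'_def s'p)
        finally show "(\<integral>\<^sup>+z. (\<Prod>f\<in>I. \<kappa> f ((y(e := z)) f) ((y(e := z)) (s f))) \<partial>std_normal) =
          (\<Prod>f\<in>J. \<kappa>' f (y f) (y (s' f)))" .
      qed
      finally show ?thesis .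
    qed
    have r3: "1 \<le> 1 / (1 - r ^ 3)" "r ^ 3 < 1" using r power_strict_mono[of r 1 3]
      by (auto simp: divide_simps)
    \<comment> \<open>Merging inside a long orbit multiplies a weight by another one. Lower bounds
      survive because weights on orbits of length three or more are at least one.\<close>
    have W1: "1 \<le> W x" if "x \<in> I" "s (s x) \<noteq> x" for x using more[OF that] r3(1) by linarith
    have "(\<integral>\<^sup>+y. (\<Prod>f\<in>J. \<kappa>' f (y f) (y (s' f))) \<partial>PiM J (\<lambda>_. std_normal)) \<le> ennreal (\<Prod>f\<in>J. W' f)"
    proof (rule less.hyps[where a = a'])
      show "card J < card I" using finJ by simp
      show "finite J" "s' permutes J" "0 \<le> r" "r < 1" by fact+
      show "case_prod (\<kappa>' f) \<in> borel_measurable (borel \<Otimes>\<^sub>M borel)" if "f \<in> J" for f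
      proof (cases "f = p")
        case True
        then show ?thesis by (simp add: \<kappa>'_def case_prod_beta)
      next
        case False
        then show ?thesis using meas that finJ by (simp add: \<kappa>'_def)
      qed
      show "0 \<le> W' f" if "f \<in> J" for f using W that finJ p e by (auto simp: W'_def)
      show "(\<integral>\<^sup>+y. \<kappa>' f y y \<partial>std_normal) \<le> ennreal (W' f)" if f: "f \<in> J" "s' f = f" for f
      proof (cases "f = p")
        case True
        \<comment> \<open>The merged coordinate became a fixed point, so \<open>p\<close> and
          \<open>e\<close> formed a two-cycle, and the remaining integral is a trace.\<close>
        then have sep: "s e = p" using f s'p by simp
        have "(\<integral>\<^sup>+y. \<kappa>' f y y \<partial>std_normal) = ennreal (1 / (1 - a p * a e))"
          using True ape r by (simp add: \<kappa>'_def nn_integral_mehler_trace)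
        also have "\<dots> \<le> ennreal (W' f)"
          using two[OF p(1,3)] sp sep True by (intro ennreal_leI) (simp add: W'_def)
        finally show ?thesis .
      next
        case False
        then show ?thesis using f s'J[of f] finJ fixed[of f] by (auto simp: \<kappa>'_def W'_def)
      qed
      show "\<kappa>' f = (\<lambda>x y. ennreal (mehler (a' f) x y))" if f: "f \<in> J" "s' f \<noteq> f" for f
        using \<kappa>[of f] f s'J[of f] finJ by (auto simp: \<kappa>'_def a'_def)
      show "0 \<le> a' f" if f: "f \<in> J" "s' f \<noteq> f" for f
        using a(1)[of f] f s'J[of f] finJ ape by (auto simp: a'_def)
      show "a' f \<le> r" if f: "f \<in> J" "s' f \<noteq> f" for f
        using a(2)[of f] f s'J[of f] finJ ape by (auto simp: a'_def)
      show "1 / (1 - a' f * a' (s' f)) \<le> W' f * W' (s' f)"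
        if f: "f \<in> J" "s' f \<noteq> f" "s' (s' f) = f" for f
      proof -
        \<comment> \<open>A two-cycle through \<open>p\<close> after merging was a three-cycle
          before. Its parameters multiply to at most \<open>r ^ 3\<close>, for which a single weight
          already pays.\<close>
        have three: "1 / (1 - a p * a e * a q) \<le> W p * W e * W q"
          if q: "q = s e" "q \<noteq> p" "s q = p" "q \<in> J" for q
        proof -
          have ne: "s (s e) \<noteq> e" "s (s p) \<noteq> p" "s (s q) \<noteq> q"
            using q p sp finJ(2) e by auto
          have qI: "q \<in> I" "s q \<noteq> q" using q finJ by auto
          have "a p * a e * a q \<le> r * r * r"
            using a[OF qI] ape r by (intro mult_mono[of "a p * a e"]) auto
          then have "1 / (1 - a p * a e * a q) \<le> 1 / (1 - r ^ 3)"
            using r3 by (intro divide_left_mono mult_pos_pos) (auto simp: power3_eq_cube)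
          also have "\<dots> \<le> W p * 1 * 1" using more[OF p(1) ne(2)] by simp
          also have "\<dots> \<le> W p * W e * W q"
            using W W1 p e qI ne by (intro mult_mono mult_nonneg_nonneg) auto
          finally show ?thesis .
        qed
        consider "f = p" | "s' f = p" "f \<noteq> p" | "f \<noteq> p" "s' f \<noteq> p" by auto
        then show ?thesis
        proof cases
          case 1
          let ?q = "s e"
          have "?q \<noteq> p" using f 1 s'p by auto
          moreover have "s ?q = p" using f 1 s'p s'o[of ?q] e \<open>?q \<noteq> p\<close> by auto
          ultimately show ?thesis using three[of ?q] pJ 1 s'p by (simp add: a'_def W'_def)
        next
          case 2
          have "f = s e" using 2 f s'p by auto
          moreover have "s f = p" using 2 s'J[of f] f by auto
          ultimately show ?thesis using three[of f] 2 f by (simp add: a'_def W'_def mult.commute)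
        next
          case 3
          have ne: "f \<noteq> e" "s' f \<noteq> e" using f(1) finJ(2) permutes_in_image[OF s', of f] by auto
          then have "s' f = s f" "s' (s' f) = s (s' f)" using 3 s'o by auto
          then show ?thesis using two[of f] f 3 finJ ne by (simp add: a'_def W'_def)
        qed
      qed
      \<comment> \<open>Merging never lengthens an orbit, so an orbit that is still long was long
        before.\<close>
      show "1 / (1 - r ^ 3) \<le> W' f" if f: "f \<in> J" "s' (s' f) \<noteq> f" for f
      proof (cases "f = p")
        case True
        have "s e \<noteq> p" using f True s'p by auto
        then have ne: "s (s p) \<noteq> p" using sp by simp
        have ne2: "s (s e) \<noteq> e" using \<open>s e \<noteq> p\<close> inj[of "s e" p] sp by auto
        have "1 / (1 - r ^ 3) \<le> W p * 1" using more[OF p(1) ne] by simp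
        also have "\<dots> \<le> W p * W e" using W p W1[OF e(1) ne2] by (intro mult_left_mono) auto
        finally show ?thesis using True by (simp add: W'_def)
      next
        case False
        have fe: "f \<noteq> e" "f \<in> I" using f finJ by auto
        have "s (s f) \<noteq> f"
        proof
          assume h: "s (s f) = f"
          show False
          proof (cases "s f = p")
            case True
            then have "f = e" using h sp by simp
            then show False using fe by simp
          next
            case F: False
            have "s f \<noteq> e" using fe False inj[of f p] sp by auto
            then show False using f h s'o[of f] s'o[of "s f"] fe False F by auto
          qed
        qed
        then show ?thesis using more[OF fe(2)] False by (simp add: W'_def)
      qed
    qed
    also have "(\<Prod>f\<in>J. W' f) = (\<Prod>f\<in>I. W f)"
    proof -
      have "(\<Prod>f\<in>J. W' f) = W p * W e * (\<Prod>f\<in>J - {p}. W f)"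
        by (subst prod.remove[OF finJ(1) pJ(1)]) (auto simp: W'_def intro!: arg_cong2[where f = "(*)"] prod.cong)
      also have "\<dots> = (\<Prod>f\<in>I. W f)"
        using finJ by (simp add: prod.remove[OF finJ(1) pJ(1)] mult_ac)
      finally show ?thesis .
    qed
    finally show ?thesis unfolding integrate .
  qed
qed

section \<open>Likelihood ratios\<close>

lemma finite_hyperedges [simp]: "finite (hyperedges n m)"
  unfolding hyperedges_def by (rule finite_subset[of _ "Pow {1..n}"]) auto

lemma bij_betw_image_hyperedges:
  assumes "\<pi> permutes {1..n}"
  shows "bij_betw ((`) \<pi>) (hyperedges n m) (hyperedges n m)"
proof (rule bij_betwI[where g = "(`) (inv \<pi>)"])
  have "inv \<pi> permutes {1..n}" by (rule permutes_inv[OF assms])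
  then show "(`) \<pi> \<in> hyperedges n m \<rightarrow> hyperedges n m" "(`) (inv \<pi>) \<in> hyperedges n m \<rightarrow> hyperedges n m"
    using assms hyperedges_image by auto
qed (use permutes_inverses[OF assms] in \<open>auto simp: image_image\<close>)

abbreviation arrays :: "nat \<Rightarrow> nat \<Rightarrow> ((nat set \<Rightarrow> real) \<times> (nat set \<Rightarrow> real)) measure" where
  "arrays n m \<equiv> array_space n m \<Otimes>\<^sub>M array_space n m"

text \<open>The same law as \<open>H0_law\<close>, but written as a product of two array laws
  instead of a product over pairs, so that Fubini can integrate the first array with the second one
  held fixed.\<close>

definition null_law :: "nat \<Rightarrow> nat \<Rightarrow> ((nat set \<Rightarrow> real) \<times> (nat set \<Rightarrow> real)) measure" where
  "null_law n m = PiM (hyperedges n m) (\<lambda>_. std_normal) \<Otimes>\<^sub>M PiM (hyperedges n m) (\<lambda>_. std_normal)"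

lemma sets_PiM_std_normal: "sets (PiM I (\<lambda>_. std_normal)) = sets (PiM I (\<lambda>_. borel))"
  by (intro sets_PiM_cong) auto

lemma sets_null_law [simp, measurable_cong]:
  "sets (null_law n m) = sets (arrays n m)"
  unfolding null_law_def array_space_def
  by (intro sets_pair_measure_cong sets_PiM_std_normal)

lemma space_null_law: "space (null_law n m) = space (arrays n m)"
  by (rule sets_eq_imp_space_eq) simp

lemma prob_space_null_law: "prob_space (null_law n m)"
proof -
  interpret prob_space "PiM (hyperedges n m) (\<lambda>_. std_normal)"
    by (intro prob_space_PiM prob_space_std_normal)
  interpret pair_prob_space "PiM (hyperedges n m) (\<lambda>_. std_normal)" "PiM (hyperedges n m) (\<lambda>_. std_normal)" ..
  show ?thesis unfolding null_law_def by unfold_locales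
qed

lemma measurable_array_components:
  assumes "e \<in> hyperedges n m"
  shows "(\<lambda>w. fst w e) \<in> borel_measurable (arrays n m)"
    and "(\<lambda>w. snd w e) \<in> borel_measurable (arrays n m)"
  using measurable_compose[OF measurable_fst measurable_component_singleton[OF assms]]
    measurable_compose[OF measurable_snd measurable_component_singleton[OF assms]]
  unfolding array_space_def by auto

lemma borel_measurable_overlap:
  assumes "\<pi> permutes {1..n}" "J \<subseteq> hyperedges n m"
  shows "(\<lambda>w. \<Sum>e\<in>J. fst w e * snd w (\<pi> ` e)) \<in> borel_measurable (arrays n m)"
  using assms(2)
  by (intro borel_measurable_sum borel_measurable_times measurable_array_components)
    (auto intro: hyperedges_image[OF assms(1)])

text \<open>Given the second array, the entries of the first one are independent and each factor
  uses only one of them. The factors may depend on the whole second array, because two permutations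
  read it at different places.\<close>

lemma nn_integral_null_law_prod:
  fixes g :: "nat set \<Rightarrow> real \<Rightarrow> (nat set \<Rightarrow> real) \<Rightarrow> ennreal"
  assumes g: "\<And>e. e \<in> hyperedges n m \<Longrightarrow> case_prod (g e) \<in> borel_measurable (borel \<Otimes>\<^sub>M array_space n m)"
  shows "(\<integral>\<^sup>+w. (\<Prod>e\<in>hyperedges n m. g e (fst w e) (snd w)) \<partial>null_law n m) =
    (\<integral>\<^sup>+y. (\<Prod>e\<in>hyperedges n m. \<integral>\<^sup>+t. g e t y \<partial>std_normal) \<partial>PiM (hyperedges n m) (\<lambda>_. std_normal))"
proof -
  let ?E = "hyperedges n m"
  let ?X = "PiM ?E (\<lambda>_. std_normal)"
  interpret N: prob_space std_normal by (rule prob_space_std_normal)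
  interpret X: prob_space ?X by (intro prob_space_PiM prob_space_std_normal)
  interpret XX: pair_prob_space ?X ?X ..
  interpret product_sigma_finite "\<lambda>_::nat set. std_normal"
    by (simp add: product_sigma_finite_def N.sigma_finite_measure_axioms)
  have sX: "sets ?X = sets (array_space n m)" by (simp add: array_space_def sets_PiM_std_normal)
  have m: "(\<lambda>w. \<Prod>e\<in>?E. g e (fst w e) (snd w)) \<in> borel_measurable (?X \<Otimes>\<^sub>M ?X)"
  proof (rule borel_measurable_prod_ennreal)
    fix e assume e: "e \<in> ?E"
    have "(\<lambda>w. (fst w e, snd w)) \<in> arrays n m \<rightarrow>\<^sub>M borel \<Otimes>\<^sub>M array_space n m"
      by (intro measurable_Pair measurable_array_components[OF e] measurable_snd)
    from measurable_compose[OF this g[OF e]]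
    show "(\<lambda>w. g e (fst w e) (snd w)) \<in> borel_measurable (?X \<Otimes>\<^sub>M ?X)"
      by (simp cong: measurable_cong_sets add: sets_pair_measure_cong[OF sX sX])
  qed
  have "(\<integral>\<^sup>+w. (\<Prod>e\<in>?E. g e (fst w e) (snd w)) \<partial>null_law n m) =
    (\<integral>\<^sup>+y. \<integral>\<^sup>+x. (\<Prod>e\<in>?E. g e (x e) y) \<partial>?X \<partial>?X)"
    unfolding null_law_def using XX.nn_integral_snd[OF m] by simp
  also have "\<dots> = (\<integral>\<^sup>+y. (\<Prod>e\<in>?E. \<integral>\<^sup>+t. g e t y \<partial>std_normal) \<partial>?X)"
  proof (rule nn_integral_cong)
    fix y assume y: "y \<in> space ?X"
    have "(\<lambda>t. g e t y) \<in> borel_measurable std_normal" if e: "e \<in> ?E" for e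
    proof -
      have "(\<lambda>t. (t, y)) \<in> borel \<rightarrow>\<^sub>M borel \<Otimes>\<^sub>M array_space n m"
        using y sets_eq_imp_space_eq[OF sX] by auto
      from measurable_compose[OF this g[OF e]] show ?thesis by simp
    qed
    then show "(\<integral>\<^sup>+x. (\<Prod>e\<in>?E. g e (x e) y) \<partial>?X) = (\<Prod>e\<in>?E. \<integral>\<^sup>+t. g e t y \<partial>std_normal)"
      by (intro product_nn_integral_prod) auto
  qed
  finally show ?thesis .
qed

definition likelihood_ratio ::
  "nat \<Rightarrow> nat \<Rightarrow> real \<Rightarrow> (nat \<Rightarrow> nat) \<Rightarrow> (nat set \<Rightarrow> real) \<times> (nat set \<Rightarrow> real) \<Rightarrow> real" where
  "likelihood_ratio n m \<rho> \<pi> w = (\<Prod>e\<in>hyperedges n m. mehler \<rho> (fst w e) (snd w (\<pi> ` e)))"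

lemma borel_measurable_likelihood_ratio:
  assumes "\<pi> permutes {1..n}"
  shows "likelihood_ratio n m \<rho> \<pi> \<in> borel_measurable (arrays n m)"
  unfolding likelihood_ratio_def
  by (intro borel_measurable_prod borel_measurable_mehler_comp measurable_array_components
      hyperedges_image[OF assms])

lemma likelihood_ratio_nonneg: "\<bar>\<rho>\<bar> < 1 \<Longrightarrow> 0 \<le> likelihood_ratio n m \<rho> \<pi> w"
  unfolding likelihood_ratio_def by (intro prod_nonneg) (simp add: mehler_nonneg)

text \<open>The map \<open>?zip\<close> carries the density to the space of pairs, where it has to
  be a product measure and can be identified on boxes. There
  \<open>emeasure_bivariate_normal\<close> gives each factor, and \<open>?unzip\<close> transports
  the identity back.\<close>

lemma H1_cond_law_eq_density:
  assumes \<pi>: "\<pi> permutes {1..n}" and \<rho>: "0 \<le> \<rho>" "\<rho> < 1"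
  shows "H1_cond_law n m \<rho> \<pi> = density (null_law n m) (\<lambda>w. ennreal (likelihood_ratio n m \<rho> \<pi> w))"
    (is "_ = ?D")
proof -
  let ?E = "hyperedges n m"
  let ?A = "arrays n m"
  let ?M = "PiM ?E (\<lambda>_. bivariate_normal \<rho>)"
  let ?B = "PiM ?E (\<lambda>_. borel \<Otimes>\<^sub>M borel :: (real \<times> real) measure)"
  let ?zip = "\<lambda>(A\<^sub>1, A\<^sub>2). \<lambda>e\<in>?E. (A\<^sub>1 e, A\<^sub>2 (\<pi> ` e) :: real) :: real \<times> real"
  let ?unzip = "\<lambda>w. (\<lambda>e\<in>?E. fst (w e), \<lambda>e\<in>?E. snd (w (inv \<pi> ` e)))"
  interpret N: prob_space std_normal by (rule prob_space_std_normal)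
  interpret NN: pair_prob_space std_normal std_normal ..
  interpret product_sigma_finite "\<lambda>_::nat set. std_normal"
    by (simp add: product_sigma_finite_def N.sigma_finite_measure_axioms)
  interpret B: prob_space "bivariate_normal \<rho>" by (rule prob_space_bivariate_normal)
  interpret BB: product_sigma_finite "\<lambda>_::nat set. bivariate_normal \<rho>"
    by (simp add: product_sigma_finite_def B.sigma_finite_measure_axioms)
  have im: "\<pi> ` e \<in> ?E" if "e \<in> ?E" for e using hyperedges_image[OF \<pi> that] .
  have im': "inv \<pi> ` e \<in> ?E" if "e \<in> ?E" for e
    using hyperedges_image[OF permutes_inv[OF \<pi>] that] .
  have zip: "?zip \<in> ?A \<rightarrow>\<^sub>M ?B"
    unfolding case_prod_beta
    by (intro measurable_restrict measurable_Pair measurable_array_components im)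
  have setsM: "sets ?B = sets ?M" by (intro sets_PiM_cong) simp_all
  have unzip: "?unzip \<in> ?B \<rightarrow>\<^sub>M ?A"
    using measurable_arrays[of n m \<pi> \<rho>] by (simp cong: measurable_cong_sets add: setsM)
  have L [measurable]: "(\<lambda>w. ennreal (likelihood_ratio n m \<rho> \<pi> w)) \<in> borel_measurable (null_law n m)"
    using borel_measurable_likelihood_ratio[OF \<pi>, of m \<rho>] by (simp cong: measurable_cong_sets)
  have zipD: "?zip \<in> ?D \<rightarrow>\<^sub>M ?B" using zip by (simp cong: measurable_cong_sets)
  have "distr ?D ?B ?zip = ?M"
  proof (rule BB.PiM_eqI)
    show "finite ?E" by simp
    show "sets (distr ?D ?B ?zip) = sets ?M" by (simp add: setsM)
    fix A :: "nat set \<Rightarrow> (real \<times> real) set"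
    assume "\<And>i. i \<in> ?E \<Longrightarrow> A i \<in> sets (bivariate_normal \<rho>)"
    then have A: "A i \<in> sets (borel \<Otimes>\<^sub>M borel)" if "i \<in> ?E" for i using that by auto
    define g where "g e t y = ennreal (mehler \<rho> t (y (\<pi> ` e))) * indicator (A e) (t, y (\<pi> ` e))"
      for e t and y :: "nat set \<Rightarrow> real"
    define h where "h e u = (\<integral>\<^sup>+t. ennreal (mehler \<rho> t u) * indicator (A e) (t, u) \<partial>std_normal)" for e u
    have mg: "case_prod (g e) \<in> borel_measurable (borel \<Otimes>\<^sub>M array_space n m)" if e: "e \<in> ?E" for e
    proof -
      have 1: "(\<lambda>p. (fst p, snd p (\<pi> ` e))) \<in> borel \<Otimes>\<^sub>M array_space n m \<rightarrow>\<^sub>M borel \<Otimes>\<^sub>M borel"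
        using measurable_compose[OF measurable_snd measurable_component_singleton[OF im[OF e]]]
        unfolding array_space_def by (intro measurable_Pair measurable_fst)
      have 2: "(\<lambda>p. ennreal (mehler \<rho> (fst p) (snd p)) * indicator (A e) p) \<in> borel_measurable (borel \<Otimes>\<^sub>M borel)"
        using A[OF e] by measurable
      show ?thesis using measurable_compose[OF 1 2] by (simp add: g_def case_prod_beta')
    qed
    have mh: "h e \<in> borel_measurable borel" if e: "e \<in> ?E" for e
    proof -
      note [measurable] = A[OF e]
      show ?thesis unfolding h_def by measurable
    qed
    have PA: "PiE ?E A \<in> sets ?B" using A by (intro sets_PiM_I_finite) auto
    have "emeasure (distr ?D ?B ?zip) (PiE ?E A) = (\<integral>\<^sup>+b. indicator (PiE ?E A) b \<partial>distr ?D ?B ?zip)"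
      using PA by simp
    also have "\<dots> = (\<integral>\<^sup>+w. indicator (PiE ?E A) (?zip w) \<partial>?D)"
      using PA by (intro nn_integral_distr zipD) auto
    also have "\<dots> = (\<integral>\<^sup>+w. ennreal (likelihood_ratio n m \<rho> \<pi> w) * indicator (PiE ?E A) (?zip w) \<partial>null_law n m)"
    proof (rule nn_integral_density[OF L])
      have "(\<lambda>w. indicator (PiE ?E A) (?zip w) :: ennreal) \<in> borel_measurable ?A"
        by (rule measurable_compose[OF zip borel_measurable_indicator[OF PA]])
      then show "(\<lambda>w. indicator (PiE ?E A) (?zip w) :: ennreal) \<in> borel_measurable (null_law n m)"
        by (simp cong: measurable_cong_sets)
    qed
    also have "\<dots> = (\<integral>\<^sup>+w. (\<Prod>e\<in>?E. g e (fst w e) (snd w)) \<partial>null_law n m)"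
    proof (rule nn_integral_cong)
      fix w :: "(nat set \<Rightarrow> real) \<times> (nat set \<Rightarrow> real)"
      have "indicator (PiE ?E A) (?zip w) = (\<Prod>e\<in>?E. indicator (A e) (fst w e, snd w (\<pi> ` e)) :: ennreal)"
      proof (cases "\<forall>e\<in>?E. (fst w e, snd w (\<pi> ` e)) \<in> A e")
        case True
        then have "?zip w \<in> PiE ?E A" by (auto simp: case_prod_beta)
        with True show ?thesis by simp
      next
        case False
        then obtain e where e: "e \<in> ?E" "(fst w e, snd w (\<pi> ` e)) \<notin> A e" by auto
        then have "?zip w \<notin> PiE ?E A" by (auto simp: case_prod_beta PiE_iff)
        moreover have "(\<Prod>e\<in>?E. indicator (A e) (fst w e, snd w (\<pi> ` e)) :: ennreal) = 0"
          using e by (intro prod_zero bexI[of _ e]) auto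
        ultimately show ?thesis by simp
      qed
      moreover have "ennreal (likelihood_ratio n m \<rho> \<pi> w) = (\<Prod>e\<in>?E. ennreal (mehler \<rho> (fst w e) (snd w (\<pi> ` e))))"
        unfolding likelihood_ratio_def using \<rho> by (intro prod_ennreal[symmetric]) (simp add: mehler_nonneg)
      ultimately show "ennreal (likelihood_ratio n m \<rho> \<pi> w) * indicator (PiE ?E A) (?zip w) =
          (\<Prod>e\<in>?E. g e (fst w e) (snd w))"
        by (simp only: g_def prod.distrib)
    qed
    also have "\<dots> = (\<integral>\<^sup>+y. (\<Prod>e\<in>?E. h e (y (\<pi> ` e))) \<partial>PiM ?E (\<lambda>_. std_normal))"
      by (subst nn_integral_null_law_prod[OF mg]) (simp_all add: g_def h_def)
    \<comment> \<open>After reindexing by the image map each factor depends on one coordinate of the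
      second array alone, so this integral factorises as well.\<close>
    also have "\<dots> = (\<integral>\<^sup>+y. (\<Prod>f\<in>?E. h (inv \<pi> ` f) (y f)) \<partial>PiM ?E (\<lambda>_. std_normal))"
    proof (rule nn_integral_cong)
      fix y :: "nat set \<Rightarrow> real"
      show "(\<Prod>e\<in>?E. h e (y (\<pi> ` e))) = (\<Prod>f\<in>?E. h (inv \<pi> ` f) (y f))"
        using prod.reindex_bij_betw[OF bij_betw_image_hyperedges[OF \<pi>, of m], of "\<lambda>f. h (inv \<pi> ` f) (y f)"]
        by (simp add: image_image permutes_inverses[OF \<pi>])
    qed
    also have "\<dots> = (\<Prod>f\<in>?E. \<integral>\<^sup>+u. h (inv \<pi> ` f) u \<partial>std_normal)"
      using mh im' by (intro product_nn_integral_prod) auto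
    also have "\<dots> = (\<Prod>e\<in>?E. \<integral>\<^sup>+u. h e u \<partial>std_normal)"
      by (rule prod.reindex_bij_betw[OF bij_betw_image_hyperedges[OF permutes_inv[OF \<pi>], of m]])
    also have "\<dots> = (\<Prod>e\<in>?E. emeasure (bivariate_normal \<rho>) (A e))"
    proof (rule prod.cong[OF refl])
      fix e assume "e \<in> ?E"
      note [measurable] = A[OF this]
      show "(\<integral>\<^sup>+u. h e u \<partial>std_normal) = emeasure (bivariate_normal \<rho>) (A e)"
        unfolding h_def emeasure_bivariate_normal[OF \<rho> A[OF \<open>e \<in> ?E\<close>]]
        by (rule NN.Fubini'[symmetric]) measurable
    qed
    finally show "emeasure (distr ?D ?B ?zip) (PiE ?E A) = (\<Prod>e\<in>?E. emeasure (bivariate_normal \<rho>) (A e))" .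
  qed
  then have "H1_cond_law n m \<rho> \<pi> = distr (distr ?D ?B ?zip) ?A ?unzip"
    unfolding H1_cond_law_def by simp
  also have "\<dots> = distr ?D ?A (?unzip \<circ> ?zip)"
    by (rule distr_distr[OF unzip zipD])
  also have "\<dots> = distr ?D ?A (\<lambda>w. w)"
  proof (rule distr_cong[OF refl refl])
    \<comment> \<open>\<open>?unzip\<close> inverts \<open>?zip\<close> here because arrays in the
      product space are \<open>undefined\<close> off the hyperedges.\<close>
    fix w assume "w \<in> space ?D"
    then have "fst w \<in> extensional ?E" "snd w \<in> extensional ?E"
      by (auto simp: space_null_law space_pair_measure array_space_def space_PiM PiE_def)
    then have "fst ((?unzip \<circ> ?zip) w) = fst w" "snd ((?unzip \<circ> ?zip) w) = snd w"
      by (auto simp: fun_eq_iff case_prod_beta extensional_def im' image_image permutes_inverses[OF \<pi>])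
    then show "(?unzip \<circ> ?zip) w = w" by (rule prod_eqI)
  qed
  also have "\<dots> = ?D" by (rule distr_id2) simp
  finally show ?thesis .
qed

lemma H1_cond_law_0: "\<pi> permutes {1..n} \<Longrightarrow> H1_cond_law n m 0 \<pi> = null_law n m"
  by (simp add: H1_cond_law_eq_density likelihood_ratio_def density_1)

lemma H0_law_eq: "H0_law n m = null_law n m"
  using H1_cond_law_0[of id n m] by (simp add: H0_law_def H1_cond_law_def permutes_id)

text \<open>Each hyperedge is charged what its whole orbit contributes, and orbits of length at
  least three are charged as if of length three. In the application \<open>r\<close> is
  \<open>\<rho>\<^sup>2\<close>, \<open>F\<close> collects the hyperedges that carry an exponential
  tilt, and \<open>w\<close> is the value of the tilted integral.\<close>

definition orbit_weight :: "('a \<Rightarrow> 'a) \<Rightarrow> 'a set set \<Rightarrow> real \<Rightarrow> real \<Rightarrow> 'a set \<Rightarrow> real" where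
  "orbit_weight \<sigma> F w r f = (if f \<in> F then w else if \<sigma> ` f = f then 1 / (1 - r)
     else if \<sigma> ` \<sigma> ` f = f then 1 / (1 - r * r) else 1 / (1 - r ^ 3))"

text \<open>Each entry of the first array occurs once in either likelihood ratio, next to the
  second-array entries at the images of \<open>e\<close> under \<open>\<pi>\<close> and
  \<open>\<pi>'\<close>. Integrating it out composes the two kernels into one with parameter
  \<open>\<rho>\<^sup>2\<close>, which links \<open>f\<close> to its image under
  \<open>\<pi>' \<circ> inv \<pi>\<close>; what is left is a product along orbits. On
  \<open>F\<close> the two second-array entries coincide, so the tilt only changes a one-variable
  integral.\<close>

lemma nn_integral_likelihood_ratio_mult_le:
  assumes \<pi>: "\<pi> permutes {1..n}" and \<pi>': "\<pi>' permutes {1..n}" and \<rho>: "0 \<le> \<rho>" "\<rho> < 1"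
    and F: "\<And>f. f \<in> F \<Longrightarrow> f \<in> hyperedges n m \<and> (\<pi>' \<circ> inv \<pi>) ` f = f"
  defines "W \<equiv> orbit_weight (\<pi>' \<circ> inv \<pi>) F (1 / sqrt (1 + \<rho>\<^sup>2 + \<rho>\<^sup>2 * \<rho>\<^sup>2)) (\<rho>\<^sup>2)"
  shows "(\<integral>\<^sup>+w. ennreal (likelihood_ratio n m \<rho> \<pi> w) * ennreal (likelihood_ratio n m \<rho> \<pi>' w) *
      ennreal (exp (- (\<rho> / (1 - \<rho>\<^sup>2)) * (\<Sum>e | e \<in> hyperedges n m \<and> \<pi> ` e \<in> F. fst w e * snd w (\<pi> ` e))))
      \<partial>null_law n m) \<le> ennreal (\<Prod>f\<in>hyperedges n m. W f)"
proof -
  let ?E = "hyperedges n m"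
  let ?X = "PiM ?E (\<lambda>_. std_normal)"
  interpret N: prob_space std_normal by (rule prob_space_std_normal)
  define c where "c = - (\<rho> / (1 - \<rho>\<^sup>2))"
  define r where "r = \<rho>\<^sup>2"
  have r: "0 \<le> r" "r < 1" "\<rho> * \<rho> = r"
    using \<rho> by (auto simp: r_def abs_square_less_1 simp flip: power2_eq_square)
  define \<sigma> where "\<sigma> = \<pi>' \<circ> inv \<pi>"
  have \<sigma>: "\<sigma> permutes {1..n}" unfolding \<sigma>_def by (rule permutes_compose[OF permutes_inv[OF \<pi>] \<pi>'])
  \<comment> \<open>The image map is made the identity off the hyperedges, as
    \<open>permutes\<close> requires.\<close>
  define s where "s f = (if f \<in> ?E then \<sigma> ` f else f)" for f
  have sE: "s f \<in> ?E" if "f \<in> ?E" for f using that hyperedges_image[OF \<sigma>] by (auto simp: s_def)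
  have s: "s permutes ?E"
  proof (rule bij_imp_permutes)
    show "bij_betw s ?E ?E"
      using bij_betw_image_hyperedges[OF \<sigma>, of m] by (subst bij_betw_cong[of _ _ "(`) \<sigma>"]) (auto simp: s_def)
  qed (simp add: s_def)
  have s\<pi>: "\<pi>' ` e = s (\<pi> ` e)" if "e \<in> ?E" for e
    using hyperedges_image[OF \<pi> that] by (simp add: s_def \<sigma>_def image_image permutes_inverses[OF \<pi>])
  have Fs: "f \<in> ?E" "s f = f" if "f \<in> F" for f using F[OF that] by (auto simp: s_def \<sigma>_def)
  define G where "G f t y = ennreal (mehler \<rho> t (y f)) * ennreal (mehler \<rho> t (y (s f))) *
     (if f \<in> F then ennreal (exp (c * (t * y f))) else 1)" for f t and y :: "nat set \<Rightarrow> real"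
  define H where "H u = (\<integral>\<^sup>+t. ennreal (mehler \<rho> t u) * ennreal (mehler \<rho> t u) * ennreal (exp (c * (t * u))) \<partial>std_normal)" for u
  have [measurable]: "H \<in> borel_measurable borel" unfolding H_def by measurable
  \<comment> \<open>For a tilted \<open>f\<close> both arguments are \<open>y f\<close>, since
    \<open>s f = f\<close>, so the kernel may ignore the second one.\<close>
  define \<kappa> where "\<kappa> f = (if f \<in> F then (\<lambda>u v. H u) else (\<lambda>u v. ennreal (mehler r u v)))" for f
  have mG: "case_prod (G (\<pi> ` e)) \<in> borel_measurable (borel \<Otimes>\<^sub>M array_space n m)" if e: "e \<in> ?E" for e
  proof -
    have f: "\<pi> ` e \<in> ?E" by (rule hyperedges_image[OF \<pi> e])
    have [measurable]: "(\<lambda>p. snd p g) \<in> borel_measurable (borel \<Otimes>\<^sub>M array_space n m)" if "g \<in> ?E" for g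
      using measurable_compose[OF measurable_snd measurable_component_singleton[OF that]]
      unfolding array_space_def .
    note [measurable] = this[OF f] this[OF sE[OF f]]
    show ?thesis unfolding G_def case_prod_beta' by measurable
  qed
  have pt: "ennreal (likelihood_ratio n m \<rho> \<pi> w) * ennreal (likelihood_ratio n m \<rho> \<pi>' w) *
      ennreal (exp (c * (\<Sum>e | e \<in> ?E \<and> \<pi> ` e \<in> F. fst w e * snd w (\<pi> ` e)))) =
      (\<Prod>e\<in>?E. G (\<pi> ` e) (fst w e) (snd w))" for w
  proof -
    have "ennreal (likelihood_ratio n m \<rho> \<pi> w) = (\<Prod>e\<in>?E. ennreal (mehler \<rho> (fst w e) (snd w (\<pi> ` e))))"
      unfolding likelihood_ratio_def using \<rho> by (intro prod_ennreal[symmetric]) (simp add: mehler_nonneg)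
    moreover have "ennreal (likelihood_ratio n m \<rho> \<pi>' w) = (\<Prod>e\<in>?E. ennreal (mehler \<rho> (fst w e) (snd w (s (\<pi> ` e)))))"
      unfolding likelihood_ratio_def using \<rho>
      by (subst prod_ennreal[symmetric]) (auto simp: mehler_nonneg s\<pi>)
    moreover have "ennreal (exp (c * (\<Sum>e | e \<in> ?E \<and> \<pi> ` e \<in> F. fst w e * snd w (\<pi> ` e)))) =
       (\<Prod>e\<in>?E. if \<pi> ` e \<in> F then ennreal (exp (c * (fst w e * snd w (\<pi> ` e)))) else 1)"
    proof -
      have "exp (c * (\<Sum>e | e \<in> ?E \<and> \<pi> ` e \<in> F. fst w e * snd w (\<pi> ` e))) =
         (\<Prod>e | e \<in> ?E \<and> \<pi> ` e \<in> F. exp (c * (fst w e * snd w (\<pi> ` e))))"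
        by (simp add: sum_distrib_left exp_sum)
      also have "ennreal \<dots> = (\<Prod>e | e \<in> ?E \<and> \<pi> ` e \<in> F. ennreal (exp (c * (fst w e * snd w (\<pi> ` e)))))"
        by (intro prod_ennreal[symmetric]) simp
      also have "\<dots> = (\<Prod>e\<in>?E. if \<pi> ` e \<in> F then ennreal (exp (c * (fst w e * snd w (\<pi> ` e)))) else 1)"
        by (subst prod.inter_filter) auto
      finally show ?thesis .
    qed
    ultimately show ?thesis by (simp only: G_def prod.distrib)
  qed
  have "(\<integral>\<^sup>+w. ennreal (likelihood_ratio n m \<rho> \<pi> w) * ennreal (likelihood_ratio n m \<rho> \<pi>' w) *
      ennreal (exp (c * (\<Sum>e | e \<in> ?E \<and> \<pi> ` e \<in> F. fst w e * snd w (\<pi> ` e)))) \<partial>null_law n m) =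
      (\<integral>\<^sup>+y. (\<Prod>e\<in>?E. \<integral>\<^sup>+t. G (\<pi> ` e) t y \<partial>std_normal) \<partial>?X)"
    unfolding pt by (rule nn_integral_null_law_prod[OF mG])
  also have "\<dots> = (\<integral>\<^sup>+y. (\<Prod>f\<in>?E. \<kappa> f (y f) (y (s f))) \<partial>?X)"
  proof (rule nn_integral_cong)
    fix y :: "nat set \<Rightarrow> real"
    have "(\<Prod>e\<in>?E. \<integral>\<^sup>+t. G (\<pi> ` e) t y \<partial>std_normal) = (\<Prod>f\<in>?E. \<integral>\<^sup>+t. G f t y \<partial>std_normal)"
      by (rule prod.reindex_bij_betw[OF bij_betw_image_hyperedges[OF \<pi>]])
    also have "\<dots> = (\<Prod>f\<in>?E. \<kappa> f (y f) (y (s f)))"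
    proof (rule prod.cong[OF refl])
      fix f
      show "(\<integral>\<^sup>+t. G f t y \<partial>std_normal) = \<kappa> f (y f) (y (s f))"
        using nn_integral_mehler_mult[OF \<rho> \<rho>, of "y f" "y (s f)"] Fs[of f] r(3)
        by (simp add: G_def \<kappa>_def H_def mehler_commute[of \<rho> "y f"])
    qed
    finally show "(\<Prod>e\<in>?E. \<integral>\<^sup>+t. G (\<pi> ` e) t y \<partial>std_normal) = (\<Prod>f\<in>?E. \<kappa> f (y f) (y (s f)))" .
  qed
  also have "\<dots> \<le> ennreal (\<Prod>f\<in>?E. W f)"
  proof (rule nn_integral_cyclic_kernel_le[where r = r and a = "\<lambda>_. r"])
    have r2: "r * r < 1" "r ^ 3 < 1" using r power_strict_mono[of r 1 3] power_strict_mono[of r 1 2]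
      by (auto simp: power2_eq_square)
    have ge1: "1 \<le> 1 / (1 - r * r)" using r r2 by (simp add: divide_simps)
    have eqs: "(\<pi>' \<circ> inv \<pi>) ` f = s f" "(\<pi>' \<circ> inv \<pi>) ` (\<pi>' \<circ> inv \<pi>) ` f = s (s f)" if "f \<in> ?E" for f
      using that sE[of f] by (simp_all add: s_def \<sigma>_def)
    show "finite ?E" by simp
    show "s permutes ?E" by (rule s)
    show "0 \<le> r" "r < 1" by (rule r)+
    show "case_prod (\<kappa> f) \<in> borel_measurable (borel \<Otimes>\<^sub>M borel)" for f
      by (simp add: \<kappa>_def case_prod_beta)
    show "0 \<le> W f" if "f \<in> ?E" for f
      using r r2 unfolding W_def orbit_weight_def r_def[symmetric] by auto
    show "(\<integral>\<^sup>+y. \<kappa> f y y \<partial>std_normal) \<le> ennreal (W f)" if f: "f \<in> ?E" "s f = f" for f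
    proof (cases "f \<in> F")
      case True
      then show ?thesis
        using nn_integral_mehler_tilted[OF \<rho>] by (simp add: \<kappa>_def H_def W_def orbit_weight_def c_def)
    next
      case False
      then show ?thesis using nn_integral_mehler_trace[OF r(1,2)] f eqs(1)[OF f(1)]
        by (simp add: \<kappa>_def W_def orbit_weight_def r_def)
    qed
    show "\<kappa> f = (\<lambda>x y. ennreal (mehler r x y))" if "f \<in> ?E" "s f \<noteq> f" for f
      using that Fs by (auto simp: \<kappa>_def)
    show "1 / (1 - r * r) \<le> W f * W (s f)" if f: "f \<in> ?E" "s f \<noteq> f" "s (s f) = f" for f
    proof -
      have "W f = 1 / (1 - r * r)" "W (s f) = 1 / (1 - r * r)"
        using f eqs[of f] eqs[of "s f"] sE[of f] Fs[of f] Fs[of "s f"]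
        unfolding W_def orbit_weight_def r_def[symmetric] by auto
      moreover have "x \<le> x * x" if "1 \<le> x" for x :: real
        using mult_left_mono[OF that, of x] that by simp
      ultimately show ?thesis using ge1 by metis
    qed
    show "1 / (1 - r ^ 3) \<le> W f" if f: "f \<in> ?E" "s (s f) \<noteq> f" for f
      using f eqs[of f] Fs[of f] unfolding W_def orbit_weight_def r_def[symmetric] by auto
  qed (use r in auto)
  finally show ?thesis by (simp add: c_def)
qed

text \<open>In terms of the i.i.d. pairs behind the conditional law this is a moment of a sum of
  independent products, for every permutation. Going through the pairs instead of a density keeps
  \<open>\<rho> = 1\<close> included.\<close>

lemma nn_integral_H1_cond_law_exp:
  assumes \<pi>: "\<pi> permutes {1..n}" and \<rho>: "0 \<le> \<rho>" "\<rho> \<le> 1" and J: "J \<subseteq> hyperedges n m"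
    and pos: "0 < 1 - 2 * \<rho> * \<theta> - \<theta>\<^sup>2 * (1 - \<rho>\<^sup>2)"
  shows "(\<integral>\<^sup>+w. ennreal (exp (\<theta> * (\<Sum>e\<in>J. fst w e * snd w (\<pi> ` e)))) \<partial>H1_cond_law n m \<rho> \<pi>) =
    ennreal ((1 / sqrt (1 - 2 * \<rho> * \<theta> - \<theta>\<^sup>2 * (1 - \<rho>\<^sup>2))) ^ card J)"
proof -
  let ?E = "hyperedges n m"
  let ?M = "PiM ?E (\<lambda>_. bivariate_normal \<rho>)"
  interpret B: prob_space "bivariate_normal \<rho>" by (rule prob_space_bivariate_normal)
  interpret BB: product_sigma_finite "\<lambda>_::nat set. bivariate_normal \<rho>"
    by (simp add: product_sigma_finite_def B.sigma_finite_measure_axioms)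
  have finJ: "finite J" by (rule finite_subset[OF J]) simp
  have im: "\<pi> ` e \<in> ?E" if "e \<in> ?E" for e using hyperedges_image[OF \<pi> that] .
  have prodJ: "(\<Prod>e\<in>?E. if e \<in> J then f e else 1) = (\<Prod>e\<in>J. f e)" for f :: "nat set \<Rightarrow> ennreal"
    using prod.inter_restrict[of ?E f J] J by (simp add: Int_absorb1)
  have m: "(\<lambda>w. ennreal (exp (\<theta> * (\<Sum>e\<in>J. fst w e * snd w (\<pi> ` e)))))
    \<in> borel_measurable (arrays n m)"
    using borel_measurable_overlap[OF \<pi> J] by measurable
  have "(\<integral>\<^sup>+w. ennreal (exp (\<theta> * (\<Sum>e\<in>J. fst w e * snd w (\<pi> ` e)))) \<partial>H1_cond_law n m \<rho> \<pi>) =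
    (\<integral>\<^sup>+w. ennreal (exp (\<theta> * (\<Sum>e\<in>J. fst (w e) * snd (w e)))) \<partial>?M)"
  proof -
    let ?T = "\<lambda>w :: nat set \<Rightarrow> real \<times> real. (\<lambda>e\<in>?E. fst (w e), \<lambda>e\<in>?E. snd (w (inv \<pi> ` e)))"
    let ?f = "\<lambda>w. ennreal (exp (\<theta> * (\<Sum>e\<in>J. fst w e * snd w (\<pi> ` e))))"
    have "(\<integral>\<^sup>+w. ?f w \<partial>H1_cond_law n m \<rho> \<pi>) = (\<integral>\<^sup>+w. ?f (?T w) \<partial>?M)"
      unfolding H1_cond_law_def
      by (rule nn_integral_distr[OF measurable_arrays]) (simp only: measurable_distr_eq1 m)
    also have "\<dots> = (\<integral>\<^sup>+w. ennreal (exp (\<theta> * (\<Sum>e\<in>J. fst (w e) * snd (w e)))) \<partial>?M)"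
    proof (rule nn_integral_cong)
      fix w :: "nat set \<Rightarrow> real \<times> real"
      have "(\<Sum>e\<in>J. (\<lambda>e\<in>?E. fst (w e)) e * (\<lambda>e\<in>?E. snd (w (inv \<pi> ` e))) (\<pi> ` e)) =
        (\<Sum>e\<in>J. fst (w e) * snd (w e))"
      proof (rule sum.cong[OF refl])
        fix e assume "e \<in> J"
        then have e: "e \<in> ?E" "\<pi> ` e \<in> ?E" using J im by auto
        have "inv \<pi> ` \<pi> ` e = e" by (simp add: image_image permutes_inverses[OF \<pi>])
        with e show "(\<lambda>e\<in>?E. fst (w e)) e * (\<lambda>e\<in>?E. snd (w (inv \<pi> ` e))) (\<pi> ` e) = fst (w e) * snd (w e)"
          by simp
      qed
      then show "?f (?T w) = ennreal (exp (\<theta> * (\<Sum>e\<in>J. fst (w e) * snd (w e))))"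
        by (simp only: fst_conv snd_conv)
    qed
    finally show ?thesis .
  qed
  also have "\<dots> = (\<integral>\<^sup>+w. (\<Prod>e\<in>?E. if e \<in> J then ennreal (exp (\<theta> * (fst (w e) * snd (w e)))) else 1) \<partial>?M)"
  proof (rule nn_integral_cong)
    fix w :: "nat set \<Rightarrow> real \<times> real"
    have "exp (\<theta> * (\<Sum>e\<in>J. fst (w e) * snd (w e))) = (\<Prod>e\<in>J. exp (\<theta> * (fst (w e) * snd (w e))))"
      using finJ by (simp add: sum_distrib_left exp_sum)
    then show "ennreal (exp (\<theta> * (\<Sum>e\<in>J. fst (w e) * snd (w e)))) =
      (\<Prod>e\<in>?E. if e \<in> J then ennreal (exp (\<theta> * (fst (w e) * snd (w e)))) else 1)"
      unfolding prodJ by (simp add: prod_ennreal)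
  qed
  also have "\<dots> = (\<Prod>e\<in>?E. \<integral>\<^sup>+w. (if e \<in> J then ennreal (exp (\<theta> * (fst w * snd w))) else 1) \<partial>bivariate_normal \<rho>)"
  proof (rule BB.product_nn_integral_prod)
    fix e
    show "(\<lambda>w. if e \<in> J then ennreal (exp (\<theta> * (fst w * snd w))) else 1) \<in> borel_measurable (bivariate_normal \<rho>)"
      by measurable
  qed simp
  also have "\<dots> = (\<Prod>e\<in>?E. if e \<in> J then ennreal (1 / sqrt (1 - 2 * \<rho> * \<theta> - \<theta>\<^sup>2 * (1 - \<rho>\<^sup>2))) else 1)"
  proof (rule prod.cong[OF refl])
    fix e
    show "(\<integral>\<^sup>+w. (if e \<in> J then ennreal (exp (\<theta> * (fst w * snd w))) else 1) \<partial>bivariate_normal \<rho>) =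
      (if e \<in> J then ennreal (1 / sqrt (1 - 2 * \<rho> * \<theta> - \<theta>\<^sup>2 * (1 - \<rho>\<^sup>2))) else 1)"
      using nn_integral_bivariate_normal_exp_mult[OF \<rho> pos] B.emeasure_space_1 by (cases "e \<in> J") simp_all
  qed
  also have "\<dots> = ennreal ((1 / sqrt (1 - 2 * \<rho> * \<theta> - \<theta>\<^sup>2 * (1 - \<rho>\<^sup>2))) ^ card J)"
    unfolding prodJ using pos by (simp add: ennreal_power)
  finally show ?thesis .
qed

text \<open>Exponential Markov inequality. The sign of \<open>\<theta>\<close> is free, so it serves
  upper and lower tails alike, and \<open>\<rho> = 0\<close> covers the null law.\<close>

lemma measure_H1_cond_law_Chernoff:
  assumes \<pi>: "\<pi> permutes {1..n}" and \<rho>: "0 \<le> \<rho>" "\<rho> \<le> 1" and J: "J \<subseteq> hyperedges n m"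
    and pos: "0 < 1 - 2 * \<rho> * \<theta> - \<theta>\<^sup>2 * (1 - \<rho>\<^sup>2)"
    and A: "A \<in> sets (arrays n m)"
      "\<And>w. w \<in> A \<Longrightarrow> b \<le> \<theta> * (\<Sum>e\<in>J. fst w e * snd w (\<pi> ` e))"
  shows "measure (H1_cond_law n m \<rho> \<pi>) A \<le>
    exp (- b) * (1 / sqrt (1 - 2 * \<rho> * \<theta> - \<theta>\<^sup>2 * (1 - \<rho>\<^sup>2))) ^ card J"
proof -
  interpret prob_space "H1_cond_law n m \<rho> \<pi>" by (rule prob_space_H1_cond_law)
  let ?R = "(1 / sqrt (1 - 2 * \<rho> * \<theta> - \<theta>\<^sup>2 * (1 - \<rho>\<^sup>2))) ^ card J"
  note [measurable] = borel_measurable_overlap[OF \<pi> J]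
  have m': "(\<lambda>w. ennreal (exp (\<theta> * (\<Sum>e\<in>J. fst w e * snd w (\<pi> ` e))))) \<in> borel_measurable (H1_cond_law n m \<rho> \<pi>)"
    unfolding measurable_cong_sets[OF sets_H1_cond_law refl] by measurable
  have "ennreal (measure (H1_cond_law n m \<rho> \<pi>) A) = (\<integral>\<^sup>+w. indicator A w \<partial>H1_cond_law n m \<rho> \<pi>)"
    using A(1) by (simp add: emeasure_eq_measure)
  also have "\<dots> \<le> (\<integral>\<^sup>+w. ennreal (exp (- b)) * ennreal (exp (\<theta> * (\<Sum>e\<in>J. fst w e * snd w (\<pi> ` e)))) \<partial>H1_cond_law n m \<rho> \<pi>)"
  proof (rule nn_integral_mono)
    fix w
    show "indicator A w \<le> ennreal (exp (- b)) * ennreal (exp (\<theta> * (\<Sum>e\<in>J. fst w e * snd w (\<pi> ` e))))"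
      using A(2)[of w] by (auto simp: indicator_def ennreal_mult'[symmetric] exp_add[symmetric])
  qed
  also have "\<dots> = ennreal (exp (- b)) * ennreal ?R"
    by (subst nn_integral_cmult[OF m'], subst nn_integral_H1_cond_law_exp[OF \<pi> \<rho> J pos]) simp
  also have "\<dots> = ennreal (exp (- b) * ?R)" by (simp add: ennreal_mult'[symmetric])
  finally show ?thesis using pos by (subst (asm) ennreal_le_iff) auto
qed

section \<open>Fixed points and two-cycles of random permutations\<close>

lemma permutes_Diff_iff:
  assumes "S \<subseteq> A"
  shows "\<sigma> permutes (A - S) \<longleftrightarrow> \<sigma> permutes A \<and> (\<forall>i\<in>S. \<sigma> i = i)"
proof
  assume "\<sigma> permutes (A - S)"
  then show "\<sigma> permutes A \<and> (\<forall>i\<in>S. \<sigma> i = i)"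
    by (auto intro: permutes_subset simp: permutes_not_in)
next
  assume "\<sigma> permutes A \<and> (\<forall>i\<in>S. \<sigma> i = i)"
  then show "\<sigma> permutes (A - S)"
    by (auto intro!: permutes_superset[of \<sigma> A])
qed

text \<open>Union bound over the set of fixed points: the other points are permuted freely, and
  \<open>(n choose k) * fact (n - k) = fact n / fact k\<close>.\<close>

lemma card_permutes_fixed_points_le:
  assumes A: "finite A"
  shows "real (card {\<sigma>. \<sigma> permutes A \<and> card {i \<in> A. \<sigma> i = i} = k}) \<le> fact (card A) / fact k"
proof (cases "k \<le> card A")
  case False
  have "card {i \<in> A. \<sigma> i = i} \<le> card A" for \<sigma> :: "'a \<Rightarrow> 'a"
    using A by (intro card_mono) auto
  with False have e: "{\<sigma>. \<sigma> permutes A \<and> card {i \<in> A. \<sigma> i = i} = k} = {}" by auto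
  show ?thesis unfolding e by simp
next
  case True
  have fin: "finite {S. S \<subseteq> A \<and> card S = k}" using A by simp
  have "card {\<sigma>. \<sigma> permutes A \<and> card {i \<in> A. \<sigma> i = i} = k} \<le>
      card (\<Union>S\<in>{S. S \<subseteq> A \<and> card S = k}. {\<sigma>. \<sigma> permutes (A - S)})"
  proof (rule card_mono)
    show "finite (\<Union>S\<in>{S. S \<subseteq> A \<and> card S = k}. {\<sigma>. \<sigma> permutes (A - S)})"
      using A fin by (intro finite_UN_I finite_permutations) auto
    show "{\<sigma>. \<sigma> permutes A \<and> card {i \<in> A. \<sigma> i = i} = k} \<subseteq>
        (\<Union>S\<in>{S. S \<subseteq> A \<and> card S = k}. {\<sigma>. \<sigma> permutes (A - S)})"
    proof
      fix \<sigma> assume \<sigma>: "\<sigma> \<in> {\<sigma>. \<sigma> permutes A \<and> card {i \<in> A. \<sigma> i = i} = k}"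
      have "\<sigma> permutes (A - {i \<in> A. \<sigma> i = i})"
        using \<sigma> by (subst permutes_Diff_iff) auto
      then show "\<sigma> \<in> (\<Union>S\<in>{S. S \<subseteq> A \<and> card S = k}. {\<sigma>. \<sigma> permutes (A - S)})"
        using \<sigma> by (intro UN_I[of "{i \<in> A. \<sigma> i = i}"]) auto
    qed
  qed
  also have "\<dots> \<le> (\<Sum>S\<in>{S. S \<subseteq> A \<and> card S = k}. card {\<sigma>. \<sigma> permutes (A - S)})"
    by (rule card_UN_le[OF fin])
  also have "\<dots> = (\<Sum>S\<in>{S. S \<subseteq> A \<and> card S = k}. fact (card A - k))"
  proof (rule sum.cong[OF refl])
    fix S assume S: "S \<in> {S. S \<subseteq> A \<and> card S = k}"
    then have "card (A - S) = card A - k" using A by (auto simp: card_Diff_subset rev_finite_subset)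
    then show "card {\<sigma>. \<sigma> permutes (A - S)} = fact (card A - k)"
      using A by (intro card_permutations) auto
  qed
  also have "\<dots> = (card A choose k) * fact (card A - k)"
    using n_subsets[OF A] by simp
  finally have "real (card {\<sigma>. \<sigma> permutes A \<and> card {i \<in> A. \<sigma> i = i} = k}) \<le>
      real ((card A choose k) * fact (card A - k))"
    by (rule of_nat_mono)
  also have "\<dots> = fact (card A) / fact k"
    using binomial_fact[OF True, where 'a = real] by simp
  finally show ?thesis .
qed

definition two_cycle_points :: "('a \<Rightarrow> 'a) \<Rightarrow> 'a set" where
  "two_cycle_points \<sigma> = {i. \<sigma> i \<noteq> i \<and> \<sigma> (\<sigma> i) = i}"

lemma two_cycle_points_subset: "\<sigma> permutes A \<Longrightarrow> two_cycle_points \<sigma> \<subseteq> A"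
  by (auto simp: two_cycle_points_def permutes_def)

lemma two_cycle_points_transpose_comp:
  assumes \<tau>: "\<tau> permutes (A - {i, j})" and ij: "i \<noteq> j"
  shows "two_cycle_points (Transposition.transpose i j \<circ> \<tau>) = insert i (insert j (two_cycle_points \<tau>))"
proof -
  have t: "\<tau> i = i" "\<tau> j = j" using \<tau> by (auto simp: permutes_not_in)
  have inj: "\<tau> x = \<tau> y \<longleftrightarrow> x = y" for x y using permutes_inj[OF \<tau>] by (auto simp: inj_eq)
  have o: "(Transposition.transpose i j \<circ> \<tau>) x = \<tau> x" "\<tau> x \<noteq> i" "\<tau> x \<noteq> j" if "x \<noteq> i" "x \<noteq> j" for x
    using that inj[of x i] inj[of x j] t by (auto simp: Transposition.transpose_def)
  have "x \<in> two_cycle_points (Transposition.transpose i j \<circ> \<tau>) \<longleftrightarrow> x \<in> insert i (insert j (two_cycle_points \<tau>))" for x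
  proof (cases "x = i \<or> x = j")
    case True
    then show ?thesis using ij t by (auto simp: two_cycle_points_def Transposition.transpose_def)
  next
    case False
    then show ?thesis using o[of x] o[of "\<tau> x"] by (auto simp: two_cycle_points_def)
  qed
  then show ?thesis by blast
qed

text \<open>A permutation with \<open>i\<close> in a two-cycle is encoded by the partner
  \<open>\<sigma> i\<close> and the permutation left when that two-cycle is dissolved. Composing
  with the same transposition again undoes this.\<close>

lemma sum_permutes_two_cycle_point:
  fixes f :: "('a \<Rightarrow> 'a) \<Rightarrow> real"
  assumes A: "finite A" and i: "i \<in> A"
  shows "(\<Sum>\<sigma> | \<sigma> permutes A \<and> i \<in> two_cycle_points \<sigma>. f \<sigma>) =
    (\<Sum>j\<in>A - {i}. \<Sum>\<tau> | \<tau> permutes (A - {i, j}). f (Transposition.transpose i j \<circ> \<tau>))"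
proof -
  have fin: "finite {\<tau>. \<tau> permutes (A - {i, j})}" for j using A by (intro finite_permutations) auto
  have "(\<Sum>j\<in>A - {i}. \<Sum>\<tau> | \<tau> permutes (A - {i, j}). f (Transposition.transpose i j \<circ> \<tau>)) =
    (\<Sum>(j, \<tau>)\<in>Sigma (A - {i}) (\<lambda>j. {\<tau>. \<tau> permutes (A - {i, j})}). f (Transposition.transpose i j \<circ> \<tau>))"
    using A fin by (intro sum.Sigma) auto
  also have "\<dots> = (\<Sum>\<sigma> | \<sigma> permutes A \<and> i \<in> two_cycle_points \<sigma>. f \<sigma>)"
  proof (rule sum.reindex_bij_witness[where j = "\<lambda>(j, \<tau>). Transposition.transpose i j \<circ> \<tau>"
        and i = "\<lambda>\<sigma>. (\<sigma> i, Transposition.transpose i (\<sigma> i) \<circ> \<sigma>)"])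
    fix a assume a: "a \<in> Sigma (A - {i}) (\<lambda>j. {\<tau>. \<tau> permutes (A - {i, j})})"
    obtain j \<tau> where a': "a = (j, \<tau>)" by (cases a)
    have j: "j \<in> A" "j \<noteq> i" and \<tau>: "\<tau> permutes (A - {i, j})" using a a' by auto
    have t: "\<tau> i = i" "\<tau> j = j" using \<tau> by (auto simp: permutes_not_in)
    have "\<tau> permutes A" using \<tau> by (rule permutes_subset) auto
    then have "Transposition.transpose i j \<circ> \<tau> permutes A"
      using i j by (intro permutes_compose permutes_swap_id)
    moreover have "i \<in> two_cycle_points (Transposition.transpose i j \<circ> \<tau>)"
      using two_cycle_points_transpose_comp[OF \<tau>] j by auto
    ultimately show "(case a of (j, \<tau>) \<Rightarrow> Transposition.transpose i j \<circ> \<tau>) \<in> {\<sigma>. \<sigma> permutes A \<and> i \<in> two_cycle_points \<sigma>}"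
      by (simp add: a')
    show "((case a of (j, \<tau>) \<Rightarrow> Transposition.transpose i j \<circ> \<tau>) i,
        Transposition.transpose i ((case a of (j, \<tau>) \<Rightarrow> Transposition.transpose i j \<circ> \<tau>) i) \<circ> (case a of (j, \<tau>) \<Rightarrow> Transposition.transpose i j \<circ> \<tau>)) = a"
      by (simp add: a' t fun_eq_iff)
    show "f (case a of (j, \<tau>) \<Rightarrow> Transposition.transpose i j \<circ> \<tau>) = (case a of (j, \<tau>) \<Rightarrow> f (Transposition.transpose i j \<circ> \<tau>))"
      by (simp add: a')
  next
    fix \<sigma> assume \<sigma>: "\<sigma> \<in> {\<sigma>. \<sigma> permutes A \<and> i \<in> two_cycle_points \<sigma>}"
    then have s: "\<sigma> permutes A" "\<sigma> i \<noteq> i" "\<sigma> (\<sigma> i) = i" by (auto simp: two_cycle_points_def)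
    have iA: "\<sigma> i \<in> A" using permutes_in_image[OF s(1)] i by simp
    show "(case (\<sigma> i, Transposition.transpose i (\<sigma> i) \<circ> \<sigma>) of (j, \<tau>) \<Rightarrow> Transposition.transpose i j \<circ> \<tau>) = \<sigma>"
      by (simp add: fun_eq_iff)
    have "Transposition.transpose i (\<sigma> i) \<circ> \<sigma> permutes (A - {i, \<sigma> i})"
    proof (subst permutes_Diff_iff)
      show "{i, \<sigma> i} \<subseteq> A" using i iA by auto
      show "Transposition.transpose i (\<sigma> i) \<circ> \<sigma> permutes A \<and> (\<forall>k\<in>{i, \<sigma> i}. (Transposition.transpose i (\<sigma> i) \<circ> \<sigma>) k = k)"
        using s i iA by (auto intro: permutes_compose permutes_swap_id)
    qed
    then show "(\<sigma> i, Transposition.transpose i (\<sigma> i) \<circ> \<sigma>) \<in> Sigma (A - {i}) (\<lambda>j. {\<tau>. \<tau> permutes (A - {i, j})})"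
      using iA s by auto
  qed
  finally show ?thesis by simp
qed

text \<open>
  The derivative of the exponential moment on \<open>A\<close> is \<open>exp (2 * w)\<close> times the moment on a set with
  two elements less, because removing a two-cycle leaves an arbitrary permutation of the rest.
\<close>

lemma sum_permutes_exp_two_cycle_points_le:
  assumes A: "finite A" and w: "0 \<le> w" "w * exp (2 * w) < 1"
  shows "(\<Sum>\<sigma> | \<sigma> permutes A. exp (w * real (card (two_cycle_points \<sigma>)))) \<le>
    fact (card A) / (1 - w * exp (2 * w))"
  using A
proof (induction "card A" arbitrary: A rule: less_induct)
  case less
  note A = less.prems
  define c where "c = 1 - w * exp (2 * w)"
  have c: "c > 0" using w by (simp add: c_def)
  define q where "q \<sigma> = real (card (two_cycle_points \<sigma>))" for \<sigma> :: "'a \<Rightarrow> 'a"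
  have finP: "finite {\<sigma>. \<sigma> permutes A}" using A by (rule finite_permutations)
  \<comment> \<open>\<open>q\<close> is a sum of indicators over the points of \<open>A\<close>;
    exchanging the sums prescribes one two-cycle point \<open>i\<close> and then its partner
    \<open>j\<close>.\<close>
  have "(\<Sum>\<sigma> | \<sigma> permutes A. q \<sigma> * exp (w * q \<sigma>)) =
      (\<Sum>\<sigma> | \<sigma> permutes A. \<Sum>i\<in>A. if i \<in> two_cycle_points \<sigma> then exp (w * q \<sigma>) else 0)"
  proof (rule sum.cong[OF refl])
    fix \<sigma> assume "\<sigma> \<in> {\<sigma>. \<sigma> permutes A}"
    then have "A \<inter> two_cycle_points \<sigma> = two_cycle_points \<sigma>" using two_cycle_points_subset by auto
    then show "q \<sigma> * exp (w * q \<sigma>) = (\<Sum>i\<in>A. if i \<in> two_cycle_points \<sigma> then exp (w * q \<sigma>) else 0)"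
      using sum.inter_restrict[OF A, of "\<lambda>_. exp (w * q \<sigma>)" "two_cycle_points \<sigma>"] by (simp add: q_def)
  qed
  also have "\<dots> = (\<Sum>i\<in>A. \<Sum>\<sigma> | \<sigma> permutes A. if i \<in> two_cycle_points \<sigma> then exp (w * q \<sigma>) else 0)"
    by (rule sum.swap)
  also have "\<dots> = (\<Sum>i\<in>A. \<Sum>\<sigma> | \<sigma> permutes A \<and> i \<in> two_cycle_points \<sigma>. exp (w * q \<sigma>))"
  proof (rule sum.cong[OF refl])
    fix i
    show "(\<Sum>\<sigma> | \<sigma> permutes A. if i \<in> two_cycle_points \<sigma> then exp (w * q \<sigma>) else 0) =
        (\<Sum>\<sigma> | \<sigma> permutes A \<and> i \<in> two_cycle_points \<sigma>. exp (w * q \<sigma>))"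
      using sum.inter_filter[OF finP, of "\<lambda>\<sigma>. exp (w * q \<sigma>)" "\<lambda>\<sigma>. i \<in> two_cycle_points \<sigma>"] by simp
  qed
  also have "\<dots> = (\<Sum>i\<in>A. \<Sum>j\<in>A - {i}. \<Sum>\<tau> | \<tau> permutes (A - {i, j}). exp (w * q (Transposition.transpose i j \<circ> \<tau>)))"
    by (intro sum.cong refl sum_permutes_two_cycle_point A)
  also have "\<dots> \<le> (\<Sum>i\<in>A. \<Sum>j\<in>A - {i}. exp (2 * w) * (fact (card A - 2) / c))"
  proof (intro sum_mono)
    fix i j assume i: "i \<in> A" and j: "j \<in> A - {i}"
    then have sub: "{i, j} \<subseteq> A" and ij: "i \<noteq> j" by auto
    have card: "card (A - {i, j}) = card A - 2"
      using sub ij A by (subst card_Diff_subset) auto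
    have less: "card A - 2 < card A"
      using i A by (metis card_gt_0_iff diff_less empty_iff zero_less_numeral)
    have "(\<Sum>\<tau> | \<tau> permutes (A - {i, j}). exp (w * q (Transposition.transpose i j \<circ> \<tau>))) =
      (\<Sum>\<tau> | \<tau> permutes (A - {i, j}). exp (2 * w) * exp (w * q \<tau>))"
    proof (rule sum.cong[OF refl])
      fix \<tau> assume "\<tau> \<in> {\<tau>. \<tau> permutes (A - {i, j})}"
      then have \<tau>: "\<tau> permutes (A - {i, j})" by simp
      have sub: "two_cycle_points \<tau> \<subseteq> A - {i, j}" using two_cycle_points_subset[OF \<tau>] .
      then have "finite (two_cycle_points \<tau>)" using A by (meson finite_Diff finite_subset)
      then have "q (Transposition.transpose i j \<circ> \<tau>) = 2 + q \<tau>"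
        unfolding q_def two_cycle_points_transpose_comp[OF \<tau> ij] using sub ij by (subst card_insert_disjoint; auto)+
      then show "exp (w * q (Transposition.transpose i j \<circ> \<tau>)) = exp (2 * w) * exp (w * q \<tau>)"
        by (simp add: exp_add[symmetric] algebra_simps)
    qed
    also have "\<dots> = exp (2 * w) * (\<Sum>\<tau> | \<tau> permutes (A - {i, j}). exp (w * q \<tau>))"
      by (simp add: sum_distrib_left)
    also have "\<dots> \<le> exp (2 * w) * (fact (card A - 2) / c)"
      using less.hyps[of "A - {i, j}"] card less A by (intro mult_left_mono) (auto simp: q_def c_def)
    finally show "(\<Sum>\<tau> | \<tau> permutes (A - {i, j}). exp (w * q (Transposition.transpose i j \<circ> \<tau>))) \<le>
        exp (2 * w) * (fact (card A - 2) / c)" .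
  qed
  also have "\<dots> = real (card A) * real (card A - 1) * (exp (2 * w) * (fact (card A - 2) / c))"
    using A by simp
  also have "\<dots> \<le> exp (2 * w) * (fact (card A) / c)"
  proof -
    have "real (card A) * real (card A - 1) * fact (card A - 2) \<le> fact (card A)"
    proof (cases "card A \<ge> 2")
      case True
      then obtain k where "card A = Suc (Suc k)" by (metis add_2_eq_Suc le_Suc_ex)
      then show ?thesis by simp
    next
      case False
      then have "card A = 0 \<or> card A = 1" by linarith
      then show ?thesis by auto
    qed
    then have "exp (2 * w) / c * (real (card A) * real (card A - 1) * fact (card A - 2)) \<le>
        exp (2 * w) / c * fact (card A)"
      using c by (intro mult_left_mono) auto
    then show ?thesis by (simp add: field_simps)
  qed
  finally have main: "(\<Sum>\<sigma> | \<sigma> permutes A. q \<sigma> * exp (w * q \<sigma>)) \<le> exp (2 * w) * (fact (card A) / c)" .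
  \<comment> \<open>The inequality \<open>exp x \<le> 1 + x * exp x\<close> takes the place of
    integrating the derivative over \<open>w\<close>. The claimed bound reproduces itself because
    \<open>c + w * exp (2 * w) = 1\<close>.\<close>
  have "(\<Sum>\<sigma> | \<sigma> permutes A. exp (w * q \<sigma>)) \<le> (\<Sum>\<sigma> | \<sigma> permutes A. 1 + w * (q \<sigma> * exp (w * q \<sigma>)))"
  proof (rule sum_mono)
    fix \<sigma>
    have "1 + - (w * q \<sigma>) \<le> exp (- (w * q \<sigma>))" by (rule exp_ge_add_one_self)
    then have "(1 - w * q \<sigma>) * exp (w * q \<sigma>) \<le> exp (- (w * q \<sigma>)) * exp (w * q \<sigma>)"
      by (intro mult_right_mono) auto
    then show "exp (w * q \<sigma>) \<le> 1 + w * (q \<sigma> * exp (w * q \<sigma>))"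
      by (simp add: exp_add[symmetric] algebra_simps)
  qed
  also have "\<dots> = fact (card A) + w * (\<Sum>\<sigma> | \<sigma> permutes A. q \<sigma> * exp (w * q \<sigma>))"
    using card_permutations[OF refl A] by (simp add: sum.distrib sum_distrib_left)
  also have "\<dots> \<le> fact (card A) + w * (exp (2 * w) * (fact (card A) / c))"
    using main w by (intro add_left_mono mult_left_mono) auto
  also have "\<dots> = fact (card A) / c"
  proof -
    have "fact (card A) = fact (card A) * c / c" using c by simp
    then have "fact (card A) + w * (exp (2 * w) * (fact (card A) / c)) =
        (fact (card A) * c + w * exp (2 * w) * fact (card A)) / c"
      using c by (simp add: add_divide_distrib)
    also have "fact (card A) * c + w * exp (2 * w) * fact (card A) = fact (card A)"
      by (simp add: c_def algebra_simps)
    finally show ?thesis .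
  qed
  finally show ?case by (simp add: q_def c_def)
qed

section \<open>Counting hyperedges in short orbits and bounding their weights\<close>

lemma card_hyperedges: "card (hyperedges n m) = n choose m"
  unfolding hyperedges_def using n_subsets[of "{1..n}" m] by simp

lemma card_hyperedges_subset:
  assumes "V \<subseteq> {1..n}"
  shows "card {f \<in> hyperedges n m. f \<subseteq> V} = card V choose m"
proof -
  have "{f \<in> hyperedges n m. f \<subseteq> V} = {f. f \<subseteq> V \<and> card f = m}"
    using assms by (auto simp: hyperedges_def)
  then show ?thesis using n_subsets[of V m] finite_subset[OF assms] by simp
qed

text \<open>Deleting \<open>T\<close> is injective, and each prescribed vertex saves a factor
  \<open>n\<close>. The quotient form also makes sense when \<open>T\<close> has more than
  \<open>m\<close> elements, where no hyperedge qualifies.\<close>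

lemma card_hyperedges_superset_le:
  assumes T: "T \<subseteq> {1..n}" and n: "1 \<le> n"
  shows "real (card {f \<in> hyperedges n m. T \<subseteq> f}) \<le> real n ^ m / real n ^ card T"
proof (cases "card T \<le> m")
  case False
  have e: "{f \<in> hyperedges n m. T \<subseteq> f} = {}"
  proof (rule ccontr)
    assume "{f \<in> hyperedges n m. T \<subseteq> f} \<noteq> {}"
    then obtain f where f: "f \<subseteq> {1..n}" "card f = m" "T \<subseteq> f" by (auto simp: hyperedges_def)
    then have "finite f" by (meson finite_atLeastAtMost finite_subset)
    then show False using card_mono[OF _ f(3)] f(2) False by simp
  qed
  show ?thesis unfolding e by simp
next
  case True
  have finT: "finite T" using T by (rule finite_subset) simp
  have "card {f \<in> hyperedges n m. T \<subseteq> f} \<le> card {g. g \<subseteq> {1..n} \<and> card g = m - card T}"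
  proof (rule card_inj_on_le)
    show "inj_on (\<lambda>f. f - T) {f \<in> hyperedges n m. T \<subseteq> f}"
      by (rule inj_onI) blast
    show "(\<lambda>f. f - T) ` {f \<in> hyperedges n m. T \<subseteq> f} \<subseteq> {g. g \<subseteq> {1..n} \<and> card g = m - card T}"
      using finT by (auto simp: hyperedges_def card_Diff_subset)
  qed simp
  also have "\<dots> = n choose (m - card T)" using n_subsets[of "{1..n}"] by simp
  also have "\<dots> \<le> n ^ (m - card T)"
  proof (cases "m - card T \<le> n")
    case True
    then show ?thesis by (rule binomial_le_pow)
  qed (simp add: binomial_eq_0)
  finally have "real (card {f \<in> hyperedges n m. T \<subseteq> f}) \<le> real (n ^ (m - card T))" by (rule of_nat_mono)
  also have "\<dots> = real n ^ m / real n ^ card T" using power_diff[of "real n" "card T" m] True n by simp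
  finally show ?thesis .
qed

text \<open>Points of \<open>D\<close> force \<open>t\<close> vertices into the hyperedge, points of
  \<open>M\<close> force one more. There are at most \<open>n\<close> points in \<open>M\<close>,
  and the extra vertex saves a factor \<open>n\<close>, so all of them together cost only the
  \<open>+ 1\<close>.\<close>

lemma card_hyperedges_cover_le:
  assumes n: "1 \<le> n" and D: "D \<subseteq> {1..n}" and M: "M \<subseteq> {1..n}"
    and T: "\<And>i. i \<in> D \<Longrightarrow> T i \<subseteq> {1..n} \<and> card (T i) = t"
    and U: "\<And>i. i \<in> M \<Longrightarrow> U i \<subseteq> {1..n} \<and> card (U i) = Suc t"
    and S: "S \<subseteq> hyperedges n m" "\<And>f. f \<in> S \<Longrightarrow> (\<exists>i\<in>D. T i \<subseteq> f) \<or> (\<exists>i\<in>M. U i \<subseteq> f)"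
  shows "real (card S) \<le> (real (card D) + 1) * real n ^ m / real n ^ t"
proof -
  let ?H = "\<lambda>T. {f \<in> hyperedges n m. T \<subseteq> f}"
  have fin: "finite D" "finite M" using D M by (auto intro: finite_subset[OF _ finite_atLeastAtMost])
  have "card M \<le> card {1..n}" using M by (intro card_mono) auto
  then have cardM: "card M \<le> n" by simp
  have "card S \<le> card ((\<Union>i\<in>D. ?H (T i)) \<union> (\<Union>i\<in>M. ?H (U i)))"
  proof (rule card_mono)
    show "finite ((\<Union>i\<in>D. ?H (T i)) \<union> (\<Union>i\<in>M. ?H (U i)))" using fin by simp
    show "S \<subseteq> (\<Union>i\<in>D. ?H (T i)) \<union> (\<Union>i\<in>M. ?H (U i))"
    proof
      fix f assume "f \<in> S"
      then show "f \<in> (\<Union>i\<in>D. ?H (T i)) \<union> (\<Union>i\<in>M. ?H (U i))" using S(1) S(2)[of f] by blast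
    qed
  qed
  also have "\<dots> \<le> card (\<Union>i\<in>D. ?H (T i)) + card (\<Union>i\<in>M. ?H (U i))"
    by (rule card_Un_le)
  also have "\<dots> \<le> (\<Sum>i\<in>D. card (?H (T i))) + (\<Sum>i\<in>M. card (?H (U i)))"
    using fin by (intro add_mono card_UN_le) auto
  finally have "real (card S) \<le> real ((\<Sum>i\<in>D. card (?H (T i))) + (\<Sum>i\<in>M. card (?H (U i))))"
    by (rule of_nat_mono)
  also have "\<dots> = (\<Sum>i\<in>D. real (card (?H (T i)))) + (\<Sum>i\<in>M. real (card (?H (U i))))"
    by simp
  also have "\<dots> \<le> (\<Sum>i\<in>D. real n ^ m / real n ^ t) + (\<Sum>i\<in>M. real n ^ m / real n ^ Suc t)"
  proof (intro add_mono sum_mono)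
    show "real (card (?H (T i))) \<le> real n ^ m / real n ^ t" if "i \<in> D" for i
      using card_hyperedges_superset_le[of "T i" n m] n T[OF that] by simp
    show "real (card (?H (U i))) \<le> real n ^ m / real n ^ Suc t" if "i \<in> M" for i
      using card_hyperedges_superset_le[of "U i" n m] n U[OF that] by simp
  qed
  also have "\<dots> = real (card D) * (real n ^ m / real n ^ t) + real (card M) * (real n ^ m / real n ^ Suc t)"
    by simp
  also have "real (card M) * (real n ^ m / real n ^ Suc t) \<le> real n * (real n ^ m / real n ^ Suc t)"
    using cardM by (intro mult_right_mono) auto
  also have "real n * (real n ^ m / real n ^ Suc t) = real n ^ m / real n ^ t"
    using n by simp
  finally show ?thesis by (simp add: add_divide_distrib distrib_right)
qed

text \<open>An invariant hyperedge with a moved vertex \<open>i\<close> contains the whole cycle of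
  \<open>i\<close>: two vertices if \<open>i\<close> lies in a two-cycle, at least three
  otherwise.\<close>

lemma card_fixed_hyperedges_le:
  assumes \<sigma>: "\<sigma> permutes {1..n}" and n: "1 \<le> n"
  shows "real (card {f \<in> hyperedges n m. \<sigma> ` f = f \<and> \<not> f \<subseteq> {i. \<sigma> i = i}}) \<le>
    (real (card (two_cycle_points \<sigma>)) + 1) * real n ^ m / real n ^ 2"
proof (rule card_hyperedges_cover_le[where T = "\<lambda>i. {i, \<sigma> i}" and U = "\<lambda>i. {i, \<sigma> i, \<sigma> (\<sigma> i)}"
      and M = "{i \<in> {1..n}. \<sigma> (\<sigma> i) \<noteq> i}"])
  have inj: "\<sigma> x = \<sigma> y \<longleftrightarrow> x = y" for x y using permutes_inj[OF \<sigma>] by (auto simp: inj_eq)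
  have im: "\<sigma> i \<in> {1..n}" if "i \<in> {1..n}" for i using permutes_in_image[OF \<sigma>] that by blast
  show D: "two_cycle_points \<sigma> \<subseteq> {1..n}" by (rule two_cycle_points_subset[OF \<sigma>])
  show "{i, \<sigma> i} \<subseteq> {1..n} \<and> card {i, \<sigma> i} = 2" if "i \<in> two_cycle_points \<sigma>" for i
  proof -
    have "i \<in> {1..n}" "\<sigma> i \<noteq> i" using that D by (auto simp: two_cycle_points_def)
    then show ?thesis using im by simp
  qed
  show "{i, \<sigma> i, \<sigma> (\<sigma> i)} \<subseteq> {1..n} \<and> card {i, \<sigma> i, \<sigma> (\<sigma> i)} = Suc 2" if "i \<in> {i \<in> {1..n}. \<sigma> (\<sigma> i) \<noteq> i}" for i
  proof -
    have i: "i \<in> {1..n}" "\<sigma> i \<noteq> i" "\<sigma> (\<sigma> i) \<noteq> \<sigma> i" "\<sigma> (\<sigma> i) \<noteq> i" using that inj by auto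
    then have "card {i, \<sigma> i, \<sigma> (\<sigma> i)} = Suc 2" by auto
    then show ?thesis using i(1) im by blast
  qed
  fix f assume f: "f \<in> {f \<in> hyperedges n m. \<sigma> ` f = f \<and> \<not> f \<subseteq> {i. \<sigma> i = i}}"
  then obtain i where i: "i \<in> f" "\<sigma> i \<noteq> i" by auto
  have "\<sigma> i \<in> f" "\<sigma> (\<sigma> i) \<in> f" using f i by auto
  moreover have "i \<in> {1..n}" using f i by (auto simp: hyperedges_def)
  ultimately show "(\<exists>i\<in>two_cycle_points \<sigma>. {i, \<sigma> i} \<subseteq> f) \<or> (\<exists>i\<in>{i \<in> {1..n}. \<sigma> (\<sigma> i) \<noteq> i}. {i, \<sigma> i, \<sigma> (\<sigma> i)} \<subseteq> f)"
    using i by (cases "\<sigma> (\<sigma> i) = i") (auto simp: two_cycle_points_def)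
qed (use n in auto)

text \<open>Such a hyperedge has a moved vertex \<open>i\<close>, for otherwise it would be fixed,
  and with \<open>i\<close> it contains \<open>\<sigma> (\<sigma> i)\<close>. That is a second
  vertex unless \<open>i\<close> lies in a two-cycle.\<close>

lemma card_involuted_hyperedges_le:
  assumes \<sigma>: "\<sigma> permutes {1..n}" and n: "1 \<le> n"
  shows "real (card {f \<in> hyperedges n m. \<sigma> ` f \<noteq> f \<and> \<sigma> ` \<sigma> ` f = f}) \<le>
    (real (card (two_cycle_points \<sigma>)) + 1) * real n ^ m / real n ^ 1"
proof (rule card_hyperedges_cover_le[where T = "\<lambda>i. {i}" and U = "\<lambda>i. {i, \<sigma> (\<sigma> i)}"
      and M = "{i \<in> {1..n}. \<sigma> (\<sigma> i) \<noteq> i}"])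
  have im: "\<sigma> i \<in> {1..n}" if "i \<in> {1..n}" for i using permutes_in_image[OF \<sigma>] that by blast
  show D: "two_cycle_points \<sigma> \<subseteq> {1..n}" by (rule two_cycle_points_subset[OF \<sigma>])
  then show "{i} \<subseteq> {1..n} \<and> card {i} = 1" if "i \<in> two_cycle_points \<sigma>" for i
    using that by auto
  show "{i, \<sigma> (\<sigma> i)} \<subseteq> {1..n} \<and> card {i, \<sigma> (\<sigma> i)} = Suc 1" if "i \<in> {i \<in> {1..n}. \<sigma> (\<sigma> i) \<noteq> i}" for i
  proof -
    have "i \<in> {1..n}" "\<sigma> (\<sigma> i) \<noteq> i" using that by auto
    then show ?thesis using im by simp
  qed
  fix f assume f: "f \<in> {f \<in> hyperedges n m. \<sigma> ` f \<noteq> f \<and> \<sigma> ` \<sigma> ` f = f}"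
  have "\<exists>i\<in>f. \<sigma> i \<noteq> i"
  proof (rule ccontr)
    assume "\<not> (\<exists>i\<in>f. \<sigma> i \<noteq> i)"
    then have "\<sigma> ` f = f" by auto
    then show False using f by simp
  qed
  then obtain i where i: "i \<in> f" "\<sigma> i \<noteq> i" by auto
  have "\<sigma> (\<sigma> i) \<in> \<sigma> ` \<sigma> ` f" using i by blast
  then have "\<sigma> (\<sigma> i) \<in> f" using f by simp
  moreover have "i \<in> {1..n}" using f i by (auto simp: hyperedges_def)
  ultimately show "(\<exists>i\<in>two_cycle_points \<sigma>. {i} \<subseteq> f) \<or> (\<exists>i\<in>{i \<in> {1..n}. \<sigma> (\<sigma> i) \<noteq> i}. {i, \<sigma> (\<sigma> i)} \<subseteq> f)"
    using i by (cases "\<sigma> (\<sigma> i) = i") (auto simp: two_cycle_points_def)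
qed (use n in auto)

text \<open>Factor by factor, \<open>(p - i) / (n - i) \<le> p / n\<close>.\<close>

lemma binomial_le_binomial_mult_power:
  assumes "p \<le> n" "m \<le> n" "0 < n"
  shows "real (p choose m) \<le> real (n choose m) * (real p / real n) ^ m"
proof (cases "m \<le> p")
  case True
  have "real (p choose m) = (\<Prod>i<m. real (p - i) / real (m - i))"
    using True by (simp add: binomial_altdef_of_nat atLeast0LessThan)
  also have "\<dots> \<le> (\<Prod>i<m. (real (n - i) / real (m - i)) * (real p / real n))"
  proof (rule prod_mono)
    fix i assume "i \<in> {..<m}"
    then have i: "i < m" by simp
    have "real (p - i) * real n \<le> real (n - i) * real p"
      using i True assms by (simp add: of_nat_diff algebra_simps mult_left_mono)
    then have "real (p - i) \<le> real (n - i) * (real p / real n)" using assms by (simp add: field_simps)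
    then have "real (p - i) / real (m - i) \<le> real (n - i) * (real p / real n) / real (m - i)"
      by (rule divide_right_mono) simp
    then show "0 \<le> real (p - i) / real (m - i) \<and>
        real (p - i) / real (m - i) \<le> (real (n - i) / real (m - i)) * (real p / real n)"
      by (simp add: mult.commute[of "real n"])
  qed
  also have "\<dots> = real (n choose m) * (real p / real n) ^ m"
    by (simp only: prod.distrib prod_constant card_lessThan binomial_altdef_of_nat[OF assms(2)] atLeast0LessThan)
  finally show ?thesis .
qed (simp add: binomial_eq_0)

lemma inverse_one_minus_le_exp:
  fixes x :: real
  assumes "0 \<le> x" "x \<le> 1 / 2"
  shows "1 / (1 - x) \<le> exp (2 * x)"
proof -
  have "1 / (1 - x) \<le> 1 + 2 * x" using assms mult_mono[of x "1/2" x x] by (simp add: field_simps)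
  also have "\<dots> \<le> exp (2 * x)" by (rule exp_ge_add_one_self)
  finally show ?thesis .
qed

lemma prod_orbit_weight_le:
  assumes \<sigma>: "\<sigma> permutes {1..n}" and r: "0 \<le> r" "r \<le> 1 / 2" and w0: "0 \<le> w0"
    and F: "F \<subseteq> {f \<in> hyperedges n m. \<sigma> ` f = f}"
  defines "W \<equiv> orbit_weight \<sigma> F w0 r"
  shows "(\<Prod>f\<in>hyperedges n m. W f) \<le> w0 ^ card F *
    exp (2 * r * real (card {f \<in> hyperedges n m. \<sigma> ` f = f \<and> f \<notin> F}) +
      2 * r\<^sup>2 * real (card {f \<in> hyperedges n m. \<sigma> ` f \<noteq> f \<and> \<sigma> ` \<sigma> ` f = f}) + 2 * r ^ 3 * real (n choose m))"
proof -
  let ?E = "hyperedges n m"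
  let ?A = "{f \<in> ?E. \<sigma> ` f = f \<and> f \<notin> F}"
  let ?B = "{f \<in> ?E. \<sigma> ` f \<noteq> f \<and> \<sigma> ` \<sigma> ` f = f}"
  have finF: "finite F" using F by (rule finite_subset) simp
  have r2: "r\<^sup>2 \<le> 1 / 2" "r ^ 3 \<le> 1 / 2"
    using r power_mono[of r "1/2" 2] power_mono[of r "1/2" 3] by (auto simp: power_divide)
  define W1 where "W1 f = (if f \<in> F then w0 else 1)" for f
  define W2 where "W2 f = (if f \<in> ?A then exp (2 * r) else 1)" for f
  define W3 where "W3 f = (if f \<in> ?B then exp (2 * r\<^sup>2) else 1)" for f
  \<comment> \<open>The factor \<open>exp (2 * r ^ 3)\<close> of the long orbits is charged to every
    hyperedge. It is at least one, and it is so close to one that long orbits can go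
    uncounted.\<close>
  have "(\<Prod>f\<in>?E. W f) \<le> (\<Prod>f\<in>?E. W1 f * W2 f * W3 f * exp (2 * r ^ 3))"
  proof (rule prod_mono)
    fix f assume f: "f \<in> ?E"
    have b: "1 / (1 - r) \<le> exp (2 * r)" "1 / (1 - r * r) \<le> exp (2 * r\<^sup>2)" "1 / (1 - r ^ 3) \<le> exp (2 * r ^ 3)"
      using inverse_one_minus_le_exp[of r] inverse_one_minus_le_exp[of "r\<^sup>2"] inverse_one_minus_le_exp[of "r ^ 3"] r r2
      by (auto simp: power2_eq_square)
    have p: "0 < 1 - r" "0 < 1 - r * r" "0 < 1 - r ^ 3" using r r2 by (auto simp: power2_eq_square)
    have le1: "1 \<le> exp (2 * r ^ 3)" using r by simp
    have "W f \<le> W1 f * W2 f * W3 f \<or> W f \<le> exp (2 * r ^ 3) \<and> W1 f * W2 f * W3 f = 1"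
    proof -
      consider "f \<in> F" | "f \<notin> F" "\<sigma> ` f = f" | "\<sigma> ` f \<noteq> f" "\<sigma> ` \<sigma> ` f = f" | "\<sigma> ` f \<noteq> f" "\<sigma> ` \<sigma> ` f \<noteq> f"
        by blast
      then show ?thesis
      proof cases
        case 1
        then have "\<sigma> ` f = f" using F by auto
        with 1 show ?thesis by (simp add: W_def orbit_weight_def W1_def W2_def W3_def)
      next
        case 2
        then show ?thesis using f b by (simp add: W_def orbit_weight_def W1_def W2_def W3_def)
      next
        case 3
        then have "f \<notin> F" using F by auto
        with 3 show ?thesis using f b by (simp add: W_def orbit_weight_def W1_def W2_def W3_def)
      next
        case 4
        then have "f \<notin> F" using F by auto
        with 4 show ?thesis using f b by (simp add: W_def orbit_weight_def W1_def W2_def W3_def)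
      qed
    qed
    moreover have "0 \<le> W1 f * W2 f * W3 f" using w0 by (simp add: W1_def W2_def W3_def)
    then have "W1 f * W2 f * W3 f \<le> W1 f * W2 f * W3 f * exp (2 * r ^ 3)"
      using mult_left_mono[OF le1] by fastforce
    ultimately have "W f \<le> W1 f * W2 f * W3 f * exp (2 * r ^ 3)" by auto
    moreover have "0 \<le> W f" using p w0 by (auto simp: W_def orbit_weight_def)
    ultimately show "0 \<le> W f \<and> W f \<le> W1 f * W2 f * W3 f * exp (2 * r ^ 3)" by simp
  qed
  also have "\<dots> = (\<Prod>f\<in>?E. W1 f) * (\<Prod>f\<in>?E. W2 f) * (\<Prod>f\<in>?E. W3 f) * exp (2 * r ^ 3) ^ card ?E"
    by (simp add: prod.distrib)
  also have "(\<Prod>f\<in>?E. W1 f) = w0 ^ card F"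
    unfolding W1_def using prod.inter_restrict[of ?E "\<lambda>_. w0" F] F by (simp add: Int_absorb1 subset_iff)
  also have "(\<Prod>f\<in>?E. W2 f) = exp (2 * r) ^ card ?A"
    unfolding W2_def using prod.inter_restrict[of ?E "\<lambda>_. exp (2 * r)" ?A] by (simp add: Int_absorb1 subset_iff)
  also have "(\<Prod>f\<in>?E. W3 f) = exp (2 * r\<^sup>2) ^ card ?B"
    unfolding W3_def using prod.inter_restrict[of ?E "\<lambda>_. exp (2 * r\<^sup>2)" ?B] by (simp add: Int_absorb1 subset_iff)
  also have "w0 ^ card F * exp (2 * r) ^ card ?A * exp (2 * r\<^sup>2) ^ card ?B * exp (2 * r ^ 3) ^ card ?E =
     w0 ^ card F * exp (2 * r * real (card ?A) + 2 * r\<^sup>2 * real (card ?B) + 2 * r ^ 3 * real (n choose m))"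
    by (simp add: exp_of_nat_mult[symmetric] exp_add card_hyperedges mult_ac)
  finally show ?thesis .
qed

section \<open>Averaging the overlap weight over permutations\<close>

text \<open>\<open>k ^ k / fact k\<close> is one term of the exponential series at
  \<open>k\<close>.\<close>

lemma inverse_fact_le_exp:
  assumes "1 \<le> k"
  shows "1 / fact k \<le> exp (real k - real k * ln (real k))"
proof -
  have "(\<Sum>i\<in>{k}. real k ^ i / fact i) \<le> (\<Sum>i. real k ^ i / fact i)"
    using summable_exp[of "real k"] by (intro sum_le_suminf) (auto simp: field_simps)
  then have "real k ^ k / fact k \<le> exp (real k)"
    by (simp add: exp_def field_simps)
  moreover have "real k ^ k = exp (real k * ln (real k))"
    using assms by (simp add: exp_of_nat_mult)
  ultimately show ?thesis by (simp add: exp_diff field_simps)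
qed

text \<open>Permutations are split at \<open>n powr (1/4)\<close> fixed points. Below, the weight
  has a uniform bound near one and the exponential moment of the two-cycle points controls the rest.
  Above, \<open>1 / fact k\<close> beats the weight, and the two-cycle points are simply bounded by
  \<open>n\<close>.\<close>

lemma sum_permutes_overlap_weight_le:
  fixes n :: nat and c \<omega> :: real
  defines "\<alpha> \<equiv> \<lambda>p. if real p \<le> real n / 32 then exp (4 * real p ^ 2 * ln (real n) / real n)
    else exp ((1 - c) * real p * ln (real n))"
  assumes n: "16 \<le> ln (real n)" and c: "7 \<le> c * ln (real n)"
    and \<omega>: "0 \<le> \<omega>" "\<omega> * exp (2 * \<omega>) < 1"
  shows "(\<Sum>\<sigma> | \<sigma> permutes {1..n}. \<alpha> (card {i \<in> {1..n}. \<sigma> i = i}) *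
      exp ((real (card (two_cycle_points \<sigma>)) + 2) * \<omega>)) / fact n \<le>
    exp (4 * ln (real n) / sqrt (real n) + 2 * \<omega>) / (1 - \<omega> * exp (2 * \<omega>)) +
    (real n + 1) * exp (- (real n powr (1/4)) / 32 + (real n + 2) * \<omega>)"
proof -
  define L where "L = ln (real n)"
  \<comment> \<open>The power 1/4 meets two demands: \<open>a\<^sup>2 * L / n\<close> has to vanish,
    and \<open>a\<close> has to dominate \<open>n * \<omega>\<close>, which is polylogarithmic in
    the application.\<close>
  define a where "a = real n powr (1/4)"
  define p where "p \<sigma> = card {i \<in> {1..n}. \<sigma> i = i}" for \<sigma> :: "nat \<Rightarrow> nat"
  define q where "q \<sigma> = real (card (two_cycle_points \<sigma>))" for \<sigma> :: "nat \<Rightarrow> nat"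
  let ?P = "{\<sigma>. \<sigma> permutes {1..n}}"
  have finP: "finite ?P" by (rule finite_permutations) simp
  have n0: "0 < real n" using n by (metis ln_0 not_numeral_le_zero of_nat_0_less_iff of_nat_0 gr0I)
  have aL: "a = exp (L / 4)" using n0 by (simp add: a_def L_def powr_def)
  have nL: "real n = exp L" using n0 by (simp add: L_def)
  have a0: "a > 0" by (simp add: aL)
  \<comment> \<open>Since \<open>n / a = exp (3 * L / 4)\<close> and \<open>16 \<le> L\<close>, the
    bound \<open>32 \<le> exp 12\<close> yields \<open>a \<le> n / 32\<close>.\<close>
  have "exp (12::real) = exp 6 * exp 6" by (simp add: exp_add[symmetric])
  moreover have "7 \<le> exp (6::real)" using exp_ge_add_one_self[of "6::real"] by simp
  ultimately have e12: "(32::real) \<le> exp 12" using mult_mono[of 7 "exp (6::real)" 7 "exp 6"] by simp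
  have a32: "a \<le> real n / 32"
  proof -
    have "a * 32 \<le> exp (L / 4) * exp 12" using e12 by (simp add: aL)
    also have "\<dots> \<le> exp L" using n by (simp add: exp_add[symmetric] L_def)
    finally show ?thesis by (simp add: nL)
  qed
  have sq: "a ^ 2 = sqrt (real n)"
  proof -
    have "a ^ 2 = real n powr (1/2)" unfolding a_def power2_eq_square powr_add[symmetric] by simp
    then show ?thesis using n0 by (simp add: powr_half_sqrt)
  qed
  have ln32: "ln (32::real) \<le> 5"
  proof -
    have "ln (32::real) = 5 * ln 2" using ln_realpow[of "2::real" 5] by simp
    then show ?thesis using ln_le_minus_one[of "2::real"] by simp
  qed
  have \<alpha>0: "0 \<le> \<alpha> k" for k by (simp add: \<alpha>_def)
  have small: "\<alpha> k \<le> exp (4 * L / sqrt (real n))" if "real k < a" for k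
  proof -
    have "real k ^ 2 \<le> sqrt (real n)" using that power_mono[of "real k" a 2] by (simp add: sq)
    then have "4 * real k ^ 2 * L / real n \<le> 4 * sqrt (real n) * L / real n"
      using n n0 by (intro divide_right_mono mult_right_mono) (auto simp: L_def)
    also have "\<dots> = 4 * L / sqrt (real n)"
      using n0 by (simp add: field_simps)
    finally show ?thesis using that a32 by (simp add: \<alpha>_def L_def)
  qed
  have large: "\<alpha> k / fact k \<le> exp (- a / 32)" if k: "a \<le> real k" for k
  proof -
    have k1: "1 \<le> k" "0 < real k" using k a0 by (auto intro: Suc_leI)
    have "ln a \<le> ln (real k)" using k a0 by simp
    then have lnk: "L / 4 \<le> ln (real k)" by (simp add: aL)
    have "\<alpha> k * exp (real k - real k * ln (real k)) \<le> exp (- real k)"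
    proof (cases "real k \<le> real n / 32")
      case True
      \<comment> \<open>Here \<open>k / n \<le> 1 / 32\<close> brings the weight exponent down to
        \<open>k * L / 8\<close>, half of the \<open>k * L / 4\<close> supplied by
        \<open>k * ln k\<close>; \<open>16 \<le> L\<close> then leaves \<open>- k\<close>.\<close>
      have "4 * real k ^ 2 * L / real n = real k * L * (4 * (real k / real n))"
        by (simp add: power2_eq_square)
      also have "\<dots> \<le> real k * L * (1 / 8)"
        using True n n0 by (intro mult_left_mono) (auto simp: field_simps L_def)
      finally have "4 * real k ^ 2 * L / real n + (real k - real k * ln (real k)) \<le> real k * (L / 8 + 1 - ln (real k))"
        by (simp add: algebra_simps)
      also have "\<dots> \<le> real k * (-1)"
        using lnk n by (intro mult_left_mono) (auto simp: L_def)
      finally show ?thesis using True by (simp add: \<alpha>_def L_def exp_add[symmetric])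
    next
      case False
      \<comment> \<open>Now \<open>L - 5 \<le> ln k\<close>, so the exponent per fixed point is at
        most \<open>6 - c * L\<close>, and \<open>7 \<le> c * L\<close> makes it at most
        \<open>-1\<close>.\<close>
      have "ln (real n / 32) \<le> ln (real k)" using False n0 k1 by simp
      then have "L - 5 \<le> ln (real k)" using n0 ln32 by (simp add: ln_div L_def)
      then have "(1 - c) * L + 1 - ln (real k) \<le> -1" using c by (simp add: L_def algebra_simps)
      then have "real k * ((1 - c) * L + 1 - ln (real k)) \<le> real k * (-1)"
        by (rule mult_left_mono) simp
      then show ?thesis using False by (simp add: \<alpha>_def L_def exp_add[symmetric] algebra_simps)
    qed
    moreover have "\<alpha> k / fact k \<le> \<alpha> k * exp (real k - real k * ln (real k))"
      using mult_left_mono[OF inverse_fact_le_exp[OF k1(1)] \<alpha>0[of k]] by simp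
    moreover have "exp (- real k) \<le> exp (- a / 32)" using k a0 by simp
    ultimately show ?thesis by linarith
  qed
  have qn: "q \<sigma> \<le> real n" if "\<sigma> \<in> ?P" for \<sigma>
  proof -
    have "card (two_cycle_points \<sigma>) \<le> card {1..n}"
      using that by (intro card_mono two_cycle_points_subset) auto
    then show ?thesis by (simp add: q_def)
  qed
  have pn: "p \<sigma> \<le> n" for \<sigma>
  proof -
    have "card {i \<in> {1..n}. \<sigma> i = i} \<le> card {1..n}" by (intro card_mono) auto
    then show ?thesis by (simp add: p_def)
  qed
  \<comment> \<open>The charge for permutations with many fixed points. It vanishes below
    \<open>a\<close>, so it can be summed over all \<open>k\<close>.\<close>
  define b where "b k = (if a \<le> real k then \<alpha> k * exp ((real n + 2) * \<omega>) else 0)" for k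
  have b0: "0 \<le> b k" for k using \<alpha>0 by (simp add: b_def)
  have summand: "\<alpha> (p \<sigma>) * exp ((q \<sigma> + 2) * \<omega>) \<le>
      exp (4 * L / sqrt (real n) + 2 * \<omega>) * exp (\<omega> * q \<sigma>) + (\<Sum>k\<le>n. if p \<sigma> = k then b k else 0)"
    if \<sigma>: "\<sigma> \<in> ?P" for \<sigma>
  proof -
    have s: "(\<Sum>k\<le>n. if p \<sigma> = k then b k else 0) = b (p \<sigma>)"
      using pn[of \<sigma>] by simp
    show ?thesis
    proof (cases "a \<le> real (p \<sigma>)")
      case True
      have "(q \<sigma> + 2) * \<omega> \<le> (real n + 2) * \<omega>" using qn[OF \<sigma>] \<omega> by (intro mult_right_mono) auto
      then have "\<alpha> (p \<sigma>) * exp ((q \<sigma> + 2) * \<omega>) \<le> b (p \<sigma>)"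
        using True \<alpha>0 by (simp add: b_def mult_left_mono)
      then show ?thesis unfolding s by (simp add: add_increasing)
    next
      case False
      then have "\<alpha> (p \<sigma>) * exp ((q \<sigma> + 2) * \<omega>) \<le> exp (4 * L / sqrt (real n)) * exp ((q \<sigma> + 2) * \<omega>)"
        using small by (intro mult_right_mono) auto
      also have "\<dots> = exp (4 * L / sqrt (real n) + 2 * \<omega>) * exp (\<omega> * q \<sigma>)"
        by (simp add: exp_add[symmetric] algebra_simps)
      finally show ?thesis unfolding s using b0[of "p \<sigma>"] by linarith
    qed
  qed
  have "(\<Sum>\<sigma>\<in>?P. \<Sum>k\<le>n. if p \<sigma> = k then b k else 0) = (\<Sum>k\<le>n. \<Sum>\<sigma>\<in>?P. if p \<sigma> = k then b k else 0)"
    by (rule sum.swap)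
  also have "\<dots> = (\<Sum>k\<le>n. real (card {\<sigma>. \<sigma> permutes {1..n} \<and> p \<sigma> = k}) * b k)"
  proof (rule sum.cong[OF refl])
    fix k
    show "(\<Sum>\<sigma>\<in>?P. if p \<sigma> = k then b k else 0) = real (card {\<sigma>. \<sigma> permutes {1..n} \<and> p \<sigma> = k}) * b k"
      using sum.inter_filter[OF finP, of "\<lambda>_. b k" "\<lambda>\<sigma>. p \<sigma> = k"] by simp
  qed
  also have "\<dots> \<le> (\<Sum>k\<le>n. fact n * (exp (- a / 32) * exp ((real n + 2) * \<omega>)))"
  proof (rule sum_mono)
    fix k
    have "real (card {\<sigma>. \<sigma> permutes {1..n} \<and> p \<sigma> = k}) * b k \<le> fact n / fact k * b k"
      using card_permutes_fixed_points_le[of "{1..n}" k] b0 by (intro mult_right_mono) (auto simp: p_def)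
    also have "\<dots> = fact n * (b k / fact k)" by simp
    also have "\<dots> \<le> fact n * (exp (- a / 32) * exp ((real n + 2) * \<omega>))"
    proof (rule mult_left_mono)
      show "b k / fact k \<le> exp (- a / 32) * exp ((real n + 2) * \<omega>)"
      proof (cases "a \<le> real k")
        case True
        then show ?thesis
          using mult_right_mono[OF large[OF True], of "exp ((real n + 2) * \<omega>)"] by (simp add: b_def)
      qed (simp add: b_def)
    qed simp
    finally show "real (card {\<sigma>. \<sigma> permutes {1..n} \<and> p \<sigma> = k}) * b k \<le>
        fact n * (exp (- a / 32) * exp ((real n + 2) * \<omega>))" .
  qed
  also have "\<dots> = fact n * ((real n + 1) * exp (- a / 32 + (real n + 2) * \<omega>))"
    by (simp only: exp_add[symmetric] sum_constant card_atMost) (simp add: mult_ac)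
  finally have second: "(\<Sum>\<sigma>\<in>?P. \<Sum>k\<le>n. if p \<sigma> = k then b k else 0) \<le> \<dots>" .
  have first: "(\<Sum>\<sigma>\<in>?P. exp (\<omega> * q \<sigma>)) \<le> fact n / (1 - \<omega> * exp (2 * \<omega>))"
    using sum_permutes_exp_two_cycle_points_le[of "{1..n}" \<omega>] \<omega> by (simp add: q_def)
  have "(\<Sum>\<sigma>\<in>?P. \<alpha> (p \<sigma>) * exp ((q \<sigma> + 2) * \<omega>)) \<le>
    (\<Sum>\<sigma>\<in>?P. exp (4 * L / sqrt (real n) + 2 * \<omega>) * exp (\<omega> * q \<sigma>) + (\<Sum>k\<le>n. if p \<sigma> = k then b k else 0))"
    by (intro sum_mono summand)
  also have "\<dots> = exp (4 * L / sqrt (real n) + 2 * \<omega>) * (\<Sum>\<sigma>\<in>?P. exp (\<omega> * q \<sigma>)) +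
      (\<Sum>\<sigma>\<in>?P. \<Sum>k\<le>n. if p \<sigma> = k then b k else 0)"
    by (simp add: sum.distrib sum_distrib_left)
  also have "\<dots> \<le> exp (4 * L / sqrt (real n) + 2 * \<omega>) * (fact n / (1 - \<omega> * exp (2 * \<omega>))) +
      fact n * ((real n + 1) * exp (- a / 32 + (real n + 2) * \<omega>))"
    using first second by (intro add_mono mult_left_mono) auto
  finally have "(\<Sum>\<sigma>\<in>?P. \<alpha> (p \<sigma>) * exp ((q \<sigma> + 2) * \<omega>)) / fact n \<le>
      (exp (4 * L / sqrt (real n) + 2 * \<omega>) * (fact n / (1 - \<omega> * exp (2 * \<omega>))) +
      fact n * ((real n + 1) * exp (- a / 32 + (real n + 2) * \<omega>))) / fact n"
    by (rule divide_right_mono) simp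
  also have "\<dots> = exp (4 * L / sqrt (real n) + 2 * \<omega>) / (1 - \<omega> * exp (2 * \<omega>)) +
      (real n + 1) * exp (- a / 32 + (real n + 2) * \<omega>)"
    by (simp add: add_divide_distrib)
  finally show ?thesis by (simp add: L_def a_def p_def q_def)
qed

section \<open>Total variation from a truncated second moment\<close>

text \<open>
  The \<open>L\<^sup>1\<close> norm of the truncated likelihood ratio minus one is bounded via
  \<open>\<bar>t\<bar> \<le> s / 2 + t\<^sup>2 / (2 * s)\<close> instead of the Cauchy-Schwarz inequality.
\<close>

lemma total_variation_mixture_le:
  fixes P Q :: "'a measure" and R :: "'b \<Rightarrow> 'a measure" and L :: "'b \<Rightarrow> 'a \<Rightarrow> real"
  assumes P: "prob_space P" and I: "finite I" "I \<noteq> {}"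
    and L [measurable]: "\<And>i. i \<in> I \<Longrightarrow> L i \<in> borel_measurable P" and L0: "\<And>i w. i \<in> I \<Longrightarrow> 0 \<le> L i w"
    and R: "\<And>i. i \<in> I \<Longrightarrow> prob_space (R i)" "\<And>i. i \<in> I \<Longrightarrow> R i = density P (\<lambda>w. ennreal (L i w))"
    and Q: "\<And>E. E \<in> sets P \<Longrightarrow> measure Q E = (\<Sum>i\<in>I. measure (R i) E) / real (card I)"
    and G [measurable]: "\<And>i. i \<in> I \<Longrightarrow> G i \<in> sets P"
    and \<eta>: "\<And>i. i \<in> I \<Longrightarrow> measure (R i) (space P - G i) \<le> \<eta>"
    and B: "\<And>i j. i \<in> I \<Longrightarrow> j \<in> I \<Longrightarrow>
      (\<integral>\<^sup>+w. ennreal (L i w) * ennreal (L j w) * indicator (G i) w * indicator (G j) w \<partial>P) \<le> ennreal (B i j)"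
      "\<And>i j. 0 \<le> B i j"
    and \<kappa>: "(\<Sum>i\<in>I. \<Sum>j\<in>I. B i j) / (real (card I))\<^sup>2 \<le> 1 + \<kappa>"
    and s: "0 < s"
  shows "total_variation P Q \<le> \<eta> + s / 2 + (\<kappa> + 2 * \<eta>) / (2 * s)"
proof -
  interpret prob_space P by (rule P)
  define N where "N = real (card I)"
  have N: "N > 0" using I by (simp add: N_def card_gt_0_iff)
  define Lt where "Lt i w = L i w * indicator (G i) w" for i w
  have Lt_meas [measurable]: "Lt i \<in> borel_measurable P" if "i \<in> I" for i
    using L[OF that] G[OF that] unfolding Lt_def by measurable
  have Lt0: "0 \<le> Lt i w" if "i \<in> I" for i w using L0[OF that] by (simp add: Lt_def)
  define T where "T w = (\<Sum>i\<in>I. Lt i w) / N" for w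
  have T [measurable]: "T \<in> borel_measurable P"
    unfolding T_def by (intro borel_measurable_divide borel_measurable_sum Lt_meas) auto
  have T0: "0 \<le> T w" for w unfolding T_def using N Lt0 by (intro divide_nonneg_pos sum_nonneg) auto
  have intL: "integrable P (L i)" "(\<integral>w. L i w \<partial>P) = 1" if i: "i \<in> I" for i
  proof -
    have "(\<integral>\<^sup>+w. ennreal (L i w) \<partial>P) = emeasure (R i) (space P)"
      using L[OF i] by (simp add: R(2)[OF i] emeasure_density cong: nn_integral_cong)
    also have "\<dots> = 1" using prob_space.emeasure_space_1[OF R(1)[OF i]] R(2)[OF i] by simp
    finally have *: "(\<integral>\<^sup>+w. ennreal (L i w) \<partial>P) = ennreal 1" by simp
    show "integrable P (L i)"
      by (rule integrableI_nonneg) (use L[OF i] L0[OF i] * in auto)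
    show "(\<integral>w. L i w \<partial>P) = 1"
      using * L[OF i] L0[OF i] by (subst integral_eq_nn_integral) auto
  qed
  have dens: "measure (R i) A = (\<integral>w. L i w * indicator A w \<partial>P)"
    if i: "i \<in> I" and A: "A \<in> sets P" for i A
  proof -
    have "integrable P (\<lambda>w. L i w * indicator A w)"
      using intL(1)[OF i] A by (rule integrable_real_mult_indicator[rotated])
    then have "(\<integral>\<^sup>+w. ennreal (L i w * indicator A w) \<partial>P) = ennreal (\<integral>w. L i w * indicator A w \<partial>P)"
      using L0[OF i] by (intro nn_integral_eq_integral) auto
    moreover have "emeasure (R i) A = (\<integral>\<^sup>+w. ennreal (L i w * indicator A w) \<partial>P)"
      unfolding R(2)[OF i] using L[OF i] A by (subst emeasure_density) (auto intro!: nn_integral_cong simp: indicator_def)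
    ultimately show ?thesis
      using L0[OF i] by (simp add: measure_def)
  qed
  have intLA: "integrable P (\<lambda>w. L i w * indicator A w)" if "i \<in> I" "A \<in> sets P" for i A
    using intL(1)[OF that(1)] that(2) by (rule integrable_real_mult_indicator[rotated])
  have intLt: "integrable P (Lt i)" if "i \<in> I" for i
    unfolding Lt_def using intLA[OF that G[OF that]] .
  have intT: "integrable P T"
    unfolding T_def using intLt by (intro integrable_divide integrable_sum) auto
  have Lteta: "1 - \<eta> \<le> (\<integral>w. Lt i w \<partial>P)" if i: "i \<in> I" for i
  proof -
    have "(\<integral>w. L i w * indicator (space P - G i) w \<partial>P) \<le> \<eta>"
      using \<eta>[OF i] dens[OF i, of "space P - G i"] G[OF i] by auto
    moreover have "(\<integral>w. Lt i w \<partial>P) + (\<integral>w. L i w * indicator (space P - G i) w \<partial>P) = (\<integral>w. L i w \<partial>P)"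
      using intLt[OF i] intLA[OF i, of "space P - G i"] G[OF i]
      by (subst Bochner_Integration.integral_add[symmetric])
        (auto simp: Lt_def indicator_def intro!: Bochner_Integration.integral_cong)
    ultimately show ?thesis using intL(2)[OF i] by simp
  qed
  have ET: "1 - \<eta> \<le> (\<integral>w. T w \<partial>P)"
  proof -
    have "N * (1 - \<eta>) = (\<Sum>i\<in>I. 1 - \<eta>)" by (simp add: N_def)
    also have "\<dots> \<le> (\<Sum>i\<in>I. \<integral>w. Lt i w \<partial>P)" by (intro sum_mono Lteta)
    also have "\<dots> = N * (\<integral>w. T w \<partial>P)"
      unfolding T_def using N intLt by (simp add: Bochner_Integration.integral_sum)
    finally show ?thesis using N by simp
  qed
  \<comment> \<open>Integrability of \<open>T\<^sup>2\<close> is not known in advance, so the bound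
    is first obtained for the nonnegative integral, from which integrability follows.\<close>
  have nnT2: "(\<integral>\<^sup>+w. ennreal ((T w)\<^sup>2) \<partial>P) \<le> ennreal (1 + \<kappa>)"
  proof -
    have T2: "ennreal ((T w)\<^sup>2) =
        (\<Sum>i\<in>I. \<Sum>j\<in>I. ennreal (Lt i w) * ennreal (Lt j w)) * ennreal (1 / N\<^sup>2)" for w
    proof -
      have "(\<Sum>i\<in>I. \<Sum>j\<in>I. ennreal (Lt i w) * ennreal (Lt j w)) =
          (\<Sum>i\<in>I. \<Sum>j\<in>I. ennreal (Lt i w * Lt j w))"
        using Lt0 by (intro sum.cong refl) (simp add: ennreal_mult)
      also have "\<dots> = (\<Sum>i\<in>I. ennreal (\<Sum>j\<in>I. Lt i w * Lt j w))"
        using Lt0 by (intro sum.cong refl sum_ennreal mult_nonneg_nonneg)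
      also have "\<dots> = ennreal (\<Sum>i\<in>I. \<Sum>j\<in>I. Lt i w * Lt j w)"
        using Lt0 by (intro sum_ennreal sum_nonneg mult_nonneg_nonneg)
      finally have "(\<Sum>i\<in>I. \<Sum>j\<in>I. ennreal (Lt i w) * ennreal (Lt j w)) * ennreal (1 / N\<^sup>2) =
          ennreal ((\<Sum>i\<in>I. \<Sum>j\<in>I. Lt i w * Lt j w) * (1 / N\<^sup>2))"
        by (subst ennreal_mult'') simp_all
      also have "(\<Sum>i\<in>I. \<Sum>j\<in>I. Lt i w * Lt j w) * (1 / N\<^sup>2) = (T w)\<^sup>2"
        unfolding T_def by (simp add: power2_eq_square sum_product)
      finally show ?thesis by simp
    qed
    have "(\<integral>\<^sup>+w. ennreal ((T w)\<^sup>2) \<partial>P) =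
        (\<integral>\<^sup>+w. (\<Sum>i\<in>I. \<Sum>j\<in>I. ennreal (Lt i w) * ennreal (Lt j w)) * ennreal (1 / N\<^sup>2) \<partial>P)"
      by (simp only: T2)
    also have "\<dots> = (\<Sum>i\<in>I. \<Sum>j\<in>I. \<integral>\<^sup>+w. ennreal (Lt i w) * ennreal (Lt j w) \<partial>P) * ennreal (1 / N\<^sup>2)"
    proof (subst nn_integral_multc)
      show "(\<lambda>w. \<Sum>i\<in>I. \<Sum>j\<in>I. ennreal (Lt i w) * ennreal (Lt j w)) \<in> borel_measurable P"
        by measurable
      have "(\<integral>\<^sup>+w. (\<Sum>i\<in>I. \<Sum>j\<in>I. ennreal (Lt i w) * ennreal (Lt j w)) \<partial>P) =
         (\<Sum>i\<in>I. \<integral>\<^sup>+w. (\<Sum>j\<in>I. ennreal (Lt i w) * ennreal (Lt j w)) \<partial>P)"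
        by (rule nn_integral_sum) measurable
      also have "\<dots> = (\<Sum>i\<in>I. \<Sum>j\<in>I. \<integral>\<^sup>+w. ennreal (Lt i w) * ennreal (Lt j w) \<partial>P)"
        by (intro sum.cong refl nn_integral_sum) measurable
      finally show "(\<integral>\<^sup>+w. (\<Sum>i\<in>I. \<Sum>j\<in>I. ennreal (Lt i w) * ennreal (Lt j w)) \<partial>P) * ennreal (1 / N\<^sup>2) =
        (\<Sum>i\<in>I. \<Sum>j\<in>I. \<integral>\<^sup>+w. ennreal (Lt i w) * ennreal (Lt j w) \<partial>P) * ennreal (1 / N\<^sup>2)" by simp
    qed
    also have "\<dots> \<le> (\<Sum>i\<in>I. \<Sum>j\<in>I. ennreal (B i j)) * ennreal (1 / N\<^sup>2)"
    proof (intro mult_right_mono sum_mono)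
      fix i j assume i: "i \<in> I" "j \<in> I"
      have "(\<integral>\<^sup>+w. ennreal (Lt i w) * ennreal (Lt j w) \<partial>P) =
        (\<integral>\<^sup>+w. ennreal (L i w) * ennreal (L j w) * indicator (G i) w * indicator (G j) w \<partial>P)"
        by (intro nn_integral_cong) (auto simp: Lt_def indicator_def)
      also have "\<dots> \<le> ennreal (B i j)" by (rule B(1)[OF i])
      finally show "(\<integral>\<^sup>+w. ennreal (Lt i w) * ennreal (Lt j w) \<partial>P) \<le> ennreal (B i j)" .
    qed simp
    also have "\<dots> = ennreal ((\<Sum>i\<in>I. \<Sum>j\<in>I. B i j) * (1 / N\<^sup>2))"
    proof -
      have "(\<Sum>i\<in>I. \<Sum>j\<in>I. ennreal (B i j)) = (\<Sum>i\<in>I. ennreal (\<Sum>j\<in>I. B i j))"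
        using B(2) by (intro sum.cong refl sum_ennreal)
      also have "\<dots> = ennreal (\<Sum>i\<in>I. \<Sum>j\<in>I. B i j)"
        using B(2) by (intro sum_ennreal sum_nonneg)
      finally show ?thesis by (subst ennreal_mult'') simp_all
    qed
    also have "\<dots> \<le> ennreal (1 + \<kappa>)"
      using \<kappa> by (intro ennreal_leI) (simp add: N_def)
    finally show ?thesis .
  qed
  have intT2: "integrable P (\<lambda>w. (T w)\<^sup>2)"
    by (rule integrableI_nonneg) (use nnT2 in \<open>auto intro: le_less_trans\<close>)
  have \<kappa>0: "0 \<le> 1 + \<kappa>"
    using \<kappa> B(2) by (meson divide_nonneg_nonneg order_trans sum_nonneg zero_le_power2)
  have ET2: "(\<integral>w. (T w)\<^sup>2 \<partial>P) \<le> 1 + \<kappa>"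
    using nnT2 \<kappa>0 nn_integral_eq_integral[OF intT2] by simp
  \<comment> \<open>Expanding the square costs \<open>2 * \<eta>\<close>, because the truncated mean
    is only known to be at least \<open>1 - \<eta>\<close>.\<close>
  have sqint: "integrable P (\<lambda>w. (T w - 1)\<^sup>2)" "(\<integral>w. (T w - 1)\<^sup>2 \<partial>P) \<le> \<kappa> + 2 * \<eta>"
  proof -
    have e: "(T w - 1)\<^sup>2 = (T w)\<^sup>2 - 2 * T w + 1" for w by (simp add: power2_eq_square algebra_simps)
    show "integrable P (\<lambda>w. (T w - 1)\<^sup>2)" unfolding e using intT intT2 by auto
    have "(\<integral>w. (T w - 1)\<^sup>2 \<partial>P) = (\<integral>w. (T w)\<^sup>2 \<partial>P) - 2 * (\<integral>w. T w \<partial>P) + 1"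
      unfolding e using intT intT2 by (simp add: prob_space)
    then show "(\<integral>w. (T w - 1)\<^sup>2 \<partial>P) \<le> \<kappa> + 2 * \<eta>" using ET ET2 by simp
  qed
  have L1norm: "(\<integral>w. \<bar>T w - 1\<bar> \<partial>P) \<le> s / 2 + (\<kappa> + 2 * \<eta>) / (2 * s)"
  proof -
    have pt: "\<bar>t\<bar> \<le> s / 2 + t\<^sup>2 / (2 * s)" for t :: real
    proof -
      have "0 \<le> (s - \<bar>t\<bar>)\<^sup>2" by simp
      then have "2 * s * \<bar>t\<bar> \<le> s * s + t\<^sup>2" by (simp add: power2_eq_square algebra_simps)
      then show ?thesis using s by (simp add: field_simps power2_eq_square)
    qed
    have "(\<integral>w. \<bar>T w - 1\<bar> \<partial>P) \<le> (\<integral>w. s / 2 + (T w - 1)\<^sup>2 / (2 * s) \<partial>P)"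
      using pt intT sqint(1) by (intro integral_mono) auto
    also have "\<dots> = s / 2 + (\<integral>w. (T w - 1)\<^sup>2 \<partial>P) / (2 * s)"
      using sqint(1) by (simp add: prob_space)
    also have "\<dots> \<le> s / 2 + (\<kappa> + 2 * \<eta>) / (2 * s)"
      using sqint(2) s by (simp add: divide_right_mono)
    finally show ?thesis .
  qed
  have "\<bar>measure P E - measure Q E\<bar> \<le> \<eta> + s / 2 + (\<kappa> + 2 * \<eta>) / (2 * s)" if E: "E \<in> sets P" for E
  proof -
    \<comment> \<open>\<open>D i\<close> is the mass that truncation removes from \<open>E\<close>.
      It lies between zero and \<open>\<eta>\<close> and is kept apart from the integral of
      \<open>\<bar>T - 1\<bar>\<close>.\<close>
    define D where "D i = (\<integral>w. L i w * indicator (E - G i) w \<partial>P)" for i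
    have D: "0 \<le> D i" "D i \<le> \<eta>" if i: "i \<in> I" for i
    proof -
      show "0 \<le> D i" unfolding D_def using L0[OF i] by (intro integral_nonneg_AE) auto
      have "D i = measure (R i) (E - G i)"
        unfolding D_def using E G[OF i] i by (subst dens) auto
      also have "\<dots> \<le> measure (R i) (space P - G i)"
      proof -
        interpret D: prob_space "R i" by (rule R(1)[OF i])
        show ?thesis using E G[OF i] sets.sets_into_space[OF E]
          by (intro D.finite_measure_mono) (auto simp: R(2)[OF i])
      qed
      finally show "D i \<le> \<eta>" using \<eta>[OF i] by simp
    qed
    have intTE: "integrable P (\<lambda>w. T w * indicator E w)"
      using intT E by (rule integrable_real_mult_indicator[rotated])
    have split: "(\<integral>w. L i w * indicator E w \<partial>P) = (\<integral>w. Lt i w * indicator E w \<partial>P) + D i" if i: "i \<in> I" for i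
    proof -
      have int: "integrable P (\<lambda>w. Lt i w * indicator E w)" "integrable P (\<lambda>w. L i w * indicator (E - G i) w)"
        using integrable_real_mult_indicator[OF E intLt[OF i]] intLA[OF i, of "E - G i"] E G[OF i] by auto
      have "(\<integral>w. L i w * indicator E w \<partial>P) = (\<integral>w. Lt i w * indicator E w + L i w * indicator (E - G i) w \<partial>P)"
        by (intro Bochner_Integration.integral_cong) (auto simp: Lt_def indicator_def)
      then show ?thesis using Bochner_Integration.integral_add[OF int] by (simp add: D_def)
    qed
    have "measure Q E = (\<Sum>i\<in>I. \<integral>w. L i w * indicator E w \<partial>P) / N"
      using Q[OF E] dens[OF _ E] by (simp add: N_def)
    also have "\<dots> = (\<Sum>i\<in>I. \<integral>w. Lt i w * indicator E w \<partial>P) / N + (\<Sum>i\<in>I. D i) / N"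
      using split by (simp add: sum.distrib add_divide_distrib)
    also have "(\<Sum>i\<in>I. \<integral>w. Lt i w * indicator E w \<partial>P) / N = (\<integral>w. T w * indicator E w \<partial>P)"
    proof -
      have "(\<integral>w. T w * indicator E w \<partial>P) = (\<integral>w. (\<Sum>i\<in>I. Lt i w * indicator E w) / N \<partial>P)"
        unfolding T_def by (simp add: sum_distrib_right)
      also have "\<dots> = (\<Sum>i\<in>I. \<integral>w. Lt i w * indicator E w \<partial>P) / N"
        using integrable_real_mult_indicator[OF E intLt] by (simp add: Bochner_Integration.integral_sum)
      finally show ?thesis by simp
    qed
    finally have QE: "measure Q E = (\<integral>w. T w * indicator E w \<partial>P) + (\<Sum>i\<in>I. D i) / N" .
    have intE: "integrable P (indicator E :: 'a \<Rightarrow> real)"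
      using E by (intro integrable_real_indicator) (auto simp: less_top[symmetric])
    have "measure P E = (\<integral>w. indicator E w \<partial>P)" using E by simp
    then have "measure Q E - measure P E = (\<integral>w. (T w - 1) * indicator E w \<partial>P) + (\<Sum>i\<in>I. D i) / N"
      using Bochner_Integration.integral_diff[OF intTE intE] unfolding QE by (simp add: left_diff_distrib)
    moreover have "\<bar>\<integral>w. (T w - 1) * indicator E w \<partial>P\<bar> \<le> (\<integral>w. \<bar>T w - 1\<bar> \<partial>P)"
    proof -
      have "\<bar>\<integral>w. (T w - 1) * indicator E w \<partial>P\<bar> \<le> (\<integral>w. \<bar>(T w - 1) * indicator E w\<bar> \<partial>P)"
        by (rule integral_abs_bound)
      also have "\<dots> \<le> (\<integral>w. \<bar>T w - 1\<bar> \<partial>P)"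
        using intT E by (intro integral_mono integrable_abs integrable_real_mult_indicator)
          (auto simp: indicator_def)
      finally show ?thesis .
    qed
    moreover have "0 \<le> (\<Sum>i\<in>I. D i) / N" using D(1) N by (intro divide_nonneg_pos sum_nonneg) auto
    moreover have "(\<Sum>i\<in>I. D i) / N \<le> \<eta>"
    proof -
      have "(\<Sum>i\<in>I. D i) \<le> (\<Sum>i\<in>I. \<eta>)" by (intro sum_mono D(2))
      then show ?thesis using N by (simp add: N_def field_simps)
    qed
    ultimately show ?thesis using L1norm by linarith
  qed
  then show ?thesis
    unfolding total_variation_def by (intro cSUP_least) auto
qed

section \<open>Indistinguishability at finite size\<close>

lemma inverse_sqrt_one_minus_le_exp:
  fixes v :: real
  assumes "0 \<le> v" "v \<le> 1 / 2"
  shows "1 / sqrt (1 - v) \<le> exp ((v + 2 * v\<^sup>2) / 2)"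
proof -
  have "- (v + 2 * v\<^sup>2) \<le> ln (1 - v)" using ln_one_minus_pos_lower_bound[OF assms] by simp
  then have "exp (- (v + 2 * v\<^sup>2)) \<le> 1 - v" using assms by (subst (asm) ln_ge_iff) auto
  then have "sqrt (exp (- (v + 2 * v\<^sup>2))) \<le> sqrt (1 - v)" by (rule real_sqrt_le_mono)
  also have "sqrt (exp (- (v + 2 * v\<^sup>2))) = exp (- ((v + 2 * v\<^sup>2) / 2))"
    by (rule real_sqrt_unique) (simp_all add: exp_of_nat_mult[symmetric] field_simps)
  finally have "1 / sqrt (1 - v) \<le> 1 / exp (- ((v + 2 * v\<^sup>2) / 2))"
    using assms by (intro divide_left_mono) auto
  then show ?thesis by (simp add: exp_minus field_simps)
qed

lemma inverse_sqrt_one_plus_le_exp: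
  fixes v :: real
  assumes "0 \<le> v" "v \<le> 1"
  shows "1 / sqrt (1 + v) \<le> exp (- (v - v\<^sup>2) / 2)"
proof -
  have "v - v\<^sup>2 \<le> ln (1 + v)" using ln_one_plus_pos_lower_bound[OF assms] by simp
  then have "exp (v - v\<^sup>2) \<le> 1 + v" using assms by (subst (asm) ln_ge_iff) auto
  then have "sqrt (exp (v - v\<^sup>2)) \<le> sqrt (1 + v)" by (rule real_sqrt_le_mono)
  also have "sqrt (exp (v - v\<^sup>2)) = exp ((v - v\<^sup>2) / 2)"
    by (rule real_sqrt_unique) (simp_all add: exp_of_nat_mult[symmetric] field_simps)
  finally have "1 / sqrt (1 + v) \<le> 1 / exp ((v - v\<^sup>2) / 2)"
    using assms by (intro divide_left_mono) auto
  also have "\<dots> = exp (- ((v - v\<^sup>2) / 2))" by (simp add: exp_minus field_simps)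
  finally show ?thesis by (simp add: minus_divide_left)
qed

text \<open>The mean per summand is \<open>\<rho> \<le> \<rho>\<^sub>1\<close>. The tilt
  \<open>\<delta> * \<rho>\<^sub>1\<close> is the excess per summand, the optimal choice for a
  Gaussian of variance one, with exponent
  \<open>\<delta>\<^sup>2 * \<rho>\<^sub>1\<^sup>2 / 2\<close>; half of this absorbs the
  second-order terms.\<close>

lemma measure_H1_cond_law_upper_tail:
  assumes \<pi>: "\<pi> permutes {1..n}" and \<rho>: "0 \<le> \<rho>" "\<rho> \<le> \<rho>\<^sub>1" "\<rho>\<^sub>1\<^sup>2 \<le> 1 / 36" and \<delta>: "0 \<le> \<delta>" "\<delta> \<le> 1"
    and J: "J \<subseteq> hyperedges n m"
    and A: "A \<in> sets (arrays n m)"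
      "\<And>w. w \<in> A \<Longrightarrow> (1 + \<delta>) * \<rho>\<^sub>1 * real (card J) \<le> (\<Sum>e\<in>J. fst w e * snd w (\<pi> ` e))"
  shows "measure (H1_cond_law n m \<rho> \<pi>) A \<le> exp (- (\<delta>\<^sup>2 * \<rho>\<^sub>1\<^sup>2 / 4 * real (card J)))"
proof -
  define r where "r = \<rho>\<^sub>1\<^sup>2"
  define \<theta> where "\<theta> = \<delta> * \<rho>\<^sub>1"
  define v where "v = 2 * \<delta> * r + \<delta>\<^sup>2 * r"
  have \<rho>1: "0 \<le> \<rho>\<^sub>1" using \<rho> by simp
  have r: "0 \<le> r" "r \<le> 1 / 36" using \<rho> by (auto simp: r_def)
  have \<rho>le1: "\<rho> \<le> 1"
  proof -
    have "\<rho>\<^sub>1\<^sup>2 \<le> 1\<^sup>2" using \<rho> by simp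
    then have "\<rho>\<^sub>1 \<le> 1" by (rule power2_le_imp_le) simp
    then show ?thesis using \<rho> by simp
  qed
  have "\<delta>\<^sup>2 \<le> \<delta>" using \<delta> by (simp add: power2_eq_square mult_left_le)
  then have v3: "v \<le> 3 * \<delta> * r" unfolding v_def using r mult_right_mono[of "\<delta>\<^sup>2" \<delta> r] by simp
  have v0: "0 \<le> v" using r \<delta> by (simp add: v_def)
  have v1: "v \<le> 1 / 2"
  proof -
    have "3 * \<delta> * r \<le> 3 * 1 * (1 / 36)" using \<delta> r by (intro mult_mono) auto
    then show ?thesis using v3 by simp
  qed
  \<comment> \<open>The bound 1/36 fits here: \<open>v \<le> 3 * \<delta> * r\<close> gives
    \<open>9 * \<delta>\<^sup>2 * r\<^sup>2\<close>, which must not exceed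
    \<open>\<delta>\<^sup>2 * r / 4\<close>.\<close>
  have v2: "v\<^sup>2 \<le> \<delta>\<^sup>2 * r / 4"
  proof -
    have "v\<^sup>2 \<le> (3 * \<delta> * r)\<^sup>2" using v0 v3 by (intro power_mono) auto
    also have "\<dots> = 9 * \<delta>\<^sup>2 * r * r" by (simp add: power2_eq_square)
    also have "\<dots> \<le> 9 * \<delta>\<^sup>2 * r * (1 / 36)" using r by (intro mult_left_mono) auto
    finally show ?thesis by (simp add: mult.commute)
  qed
  have \<theta>0: "0 \<le> \<theta>" using \<delta> \<rho>1 by (simp add: \<theta>_def)
  have v': "2 * \<rho> * \<theta> + \<theta>\<^sup>2 * (1 - \<rho>\<^sup>2) \<le> v"
  proof -
    have "\<rho> * \<theta> \<le> \<rho>\<^sub>1 * \<theta>" using \<rho> \<theta>0 by (intro mult_right_mono) auto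
    moreover have "\<theta>\<^sup>2 * (1 - \<rho>\<^sup>2) \<le> \<theta>\<^sup>2" by (simp add: mult_left_le)
    moreover have "\<rho>\<^sub>1 * \<theta> = \<delta> * r" "\<theta>\<^sup>2 = \<delta>\<^sup>2 * r" by (simp_all add: \<theta>_def r_def power2_eq_square)
    ultimately show ?thesis by (simp add: v_def)
  qed
  have pos: "1 - v \<le> 1 - 2 * \<rho> * \<theta> - \<theta>\<^sup>2 * (1 - \<rho>\<^sup>2)" using v' by simp
  have "measure (H1_cond_law n m \<rho> \<pi>) A \<le>
      exp (- (\<theta> * ((1 + \<delta>) * \<rho>\<^sub>1 * real (card J)))) *
      (1 / sqrt (1 - 2 * \<rho> * \<theta> - \<theta>\<^sup>2 * (1 - \<rho>\<^sup>2))) ^ card J"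
    using pos v1 A \<theta>0 by (intro measure_H1_cond_law_Chernoff[OF \<pi> \<rho>(1) \<rho>le1 J]) (auto intro: mult_left_mono)
  also have "\<dots> \<le> exp (- (\<theta> * ((1 + \<delta>) * \<rho>\<^sub>1 * real (card J)))) * exp ((v + 2 * v\<^sup>2) / 2) ^ card J"
  proof (intro mult_left_mono power_mono)
    have "1 / sqrt (1 - 2 * \<rho> * \<theta> - \<theta>\<^sup>2 * (1 - \<rho>\<^sup>2)) \<le> 1 / sqrt (1 - v)"
      using pos v1 by (intro divide_left_mono real_sqrt_le_mono) auto
    also have "\<dots> \<le> exp ((v + 2 * v\<^sup>2) / 2)" by (rule inverse_sqrt_one_minus_le_exp[OF v0 v1])
    finally show "1 / sqrt (1 - 2 * \<rho> * \<theta> - \<theta>\<^sup>2 * (1 - \<rho>\<^sup>2)) \<le> exp ((v + 2 * v\<^sup>2) / 2)" .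
  qed (use pos v1 in auto)
  also have "\<dots> = exp (real (card J) * ((v + 2 * v\<^sup>2) / 2 - \<theta> * (1 + \<delta>) * \<rho>\<^sub>1))"
    by (simp add: exp_of_nat_mult[symmetric] exp_add[symmetric] algebra_simps)
  also have "\<dots> \<le> exp (real (card J) * (- (\<delta>\<^sup>2 * r / 4)))"
  proof -
    have "\<theta> * (1 + \<delta>) * \<rho>\<^sub>1 = \<delta> * r + \<delta>\<^sup>2 * r" by (simp add: \<theta>_def r_def power2_eq_square algebra_simps)
    moreover have "(v + 2 * v\<^sup>2) / 2 = \<delta> * r + \<delta>\<^sup>2 * r / 2 + v\<^sup>2" by (simp add: v_def field_simps)
    ultimately have "(v + 2 * v\<^sup>2) / 2 - \<theta> * (1 + \<delta>) * \<rho>\<^sub>1 \<le> - (\<delta>\<^sup>2 * r / 4)"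
      using v2 by linarith
    then show ?thesis by (intro iffD2[OF exp_le_cancel_iff] mult_left_mono) auto
  qed
  finally show ?thesis by (simp add: r_def algebra_simps)
qed

lemma card_hyperedges_image_subset:
  assumes \<pi>: "\<pi> permutes {1..n}" and V: "V \<subseteq> {1..n}"
  shows "card {e \<in> hyperedges n m. \<pi> ` e \<subseteq> V} = card V choose m"
proof -
  note b = bij_betw_image_hyperedges[OF \<pi>, of m]
  have "(`) \<pi> ` {e \<in> hyperedges n m. \<pi> ` e \<subseteq> V} = {f \<in> hyperedges n m. f \<subseteq> V}"
  proof (intro equalityI subsetI)
    fix f assume f: "f \<in> {f \<in> hyperedges n m. f \<subseteq> V}"
    then have "f \<in> (`) \<pi> ` hyperedges n m" using b by (simp add: bij_betw_def)
    then obtain e where "e \<in> hyperedges n m" "f = \<pi> ` e" by blast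
    then show "f \<in> (`) \<pi> ` {e \<in> hyperedges n m. \<pi> ` e \<subseteq> V}" using f by blast
  next
    fix f assume "f \<in> (`) \<pi> ` {e \<in> hyperedges n m. \<pi> ` e \<subseteq> V}"
    then obtain e where "e \<in> hyperedges n m" "\<pi> ` e \<subseteq> V" "f = \<pi> ` e" by blast
    then show "f \<in> {f \<in> hyperedges n m. f \<subseteq> V}" using hyperedges_image[OF \<pi>, of e m] by simp
  qed
  moreover have "inj_on ((`) \<pi>) {e \<in> hyperedges n m. \<pi> ` e \<subseteq> V}"
    using bij_betw_imp_inj_on[OF b] by (rule inj_on_subset) auto
  ultimately have "card {e \<in> hyperedges n m. \<pi> ` e \<subseteq> V} = card {f \<in> hyperedges n m. f \<subseteq> V}"
    using card_image by fastforce
  then show ?thesis using card_hyperedges_subset[OF V] by simp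
qed

text \<open>With \<open>y = K * L\<close> the hypothesis reads
  \<open>r * n ^ m \<le> 2 * y * n\<close>, and \<open>n\<^sup>2 \<le> n ^ m\<close> turns each
  further factor \<open>r\<close> into about \<open>y / n\<close>. Apart from the factor
  \<open>q + 1\<close>, the three terms are of order \<open>y / n\<close>,
  \<open>y\<^sup>2 / n\<close> and \<open>y ^ 3 / n\<close>, and the last absorbs them all.\<close>

lemma short_orbit_exponent_le:
  fixes r K L q N :: real and n m :: nat
  assumes m: "2 \<le> m" and n: "1 \<le> n" and K: "1 \<le> K" "1 \<le> L" and r: "0 \<le> r" "r * real n ^ m \<le> 2 * K * L * real n"
    and N: "0 \<le> N" "N \<le> real n ^ m" and q: "0 \<le> q"
  shows "2 * r * ((q + 1) * real n ^ m / real n ^ 2) + 2 * r\<^sup>2 * ((q + 1) * real n ^ m / real n) + 2 * r ^ 3 * N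
    \<le> (q + 2) * (32 * (K * L) ^ 3 / real n)"
proof -
  define M where "M = real n ^ m"
  define y where "y = K * L"
  define k where "k = real n"
  have k: "k \<ge> 1" using n by (simp add: k_def)
  have y: "1 \<le> y" using mult_mono[of 1 K 1 L] K by (simp add: y_def)
  have y3: "y \<le> y ^ 3" "y ^ 2 \<le> y ^ 3" using power_increasing[of 1 3 y] power_increasing[of 2 3 y] y by auto
  have M: "k ^ 2 \<le> M" unfolding M_def k_def using m n by (intro power_increasing) auto
  then have M0: "M > 0" using k by (smt (verit) zero_less_power)
  have rM: "r * M \<le> 2 * y * k" using r by (simp add: M_def y_def k_def mult_ac)
  have rM0: "0 \<le> r * M" using r M0 by simp
  have 1: "r * M / k ^ 2 \<le> 2 * y / k"
  proof -
    have "r * M / k ^ 2 \<le> 2 * y * k / k ^ 2" using rM by (intro divide_right_mono) auto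
    then show ?thesis using k by (simp add: power2_eq_square)
  qed
  have 2: "r\<^sup>2 * M \<le> 4 * y ^ 2"
  proof -
    have "r\<^sup>2 * M = (r * M)\<^sup>2 / M" using M0 by (simp add: power2_eq_square)
    also have "\<dots> \<le> (2 * y * k)\<^sup>2 / k\<^sup>2"
      using rM rM0 M k y by (intro frac_le power_mono) auto
    also have "\<dots> = 4 * y ^ 2" using k by (simp add: power_mult_distrib)
    finally show ?thesis .
  qed
  have 3: "r ^ 3 * M \<le> 8 * y ^ 3 / k"
  proof -
    have "r ^ 3 * M = (r * M) ^ 3 / M\<^sup>2" using M0 by (simp add: power2_eq_square power3_eq_cube)
    also have "\<dots> \<le> (2 * y * k) ^ 3 / (k\<^sup>2)\<^sup>2"
      using rM rM0 M k y by (intro frac_le power_mono) auto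
    also have "\<dots> = 8 * y ^ 3 / k" using k by (simp add: power_mult_distrib power2_eq_square power3_eq_cube)
    finally show ?thesis .
  qed
  have "2 * r * ((q + 1) * M / k ^ 2) = 2 * (q + 1) * (r * M / k ^ 2)" by simp
  also have "\<dots> \<le> 2 * (q + 1) * (2 * y / k)" using 1 q by (intro mult_left_mono) auto
  also have "\<dots> = 4 * (q + 1) * (y / k)" by simp
  also have "\<dots> \<le> 4 * (q + 1) * (y ^ 3 / k)"
    using y3 k q by (intro mult_left_mono divide_right_mono) auto
  finally have A: "2 * r * ((q + 1) * M / k ^ 2) \<le> 4 * (q + 1) * (y ^ 3 / k)" .
  have "2 * r\<^sup>2 * ((q + 1) * M / k) = 2 * (q + 1) * (r\<^sup>2 * M / k)" by simp
  also have "\<dots> \<le> 2 * (q + 1) * (4 * y ^ 2 / k)" using 2 q k by (intro mult_left_mono divide_right_mono) auto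
  also have "\<dots> = 8 * (q + 1) * (y ^ 2 / k)" by simp
  also have "\<dots> \<le> 8 * (q + 1) * (y ^ 3 / k)"
    using y3 k q by (intro mult_left_mono divide_right_mono) auto
  finally have B: "2 * r\<^sup>2 * ((q + 1) * M / k) \<le> 8 * (q + 1) * (y ^ 3 / k)" .
  have "2 * r ^ 3 * N \<le> 2 * r ^ 3 * M" using N r by (intro mult_left_mono) (auto simp: M_def)
  also have "\<dots> \<le> 16 * (y ^ 3 / k)" using 3 by simp
  finally have C: "2 * r ^ 3 * N \<le> 16 * (y ^ 3 / k)" .
  \<comment> \<open>The three contributions add up to \<open>12 * q + 28\<close>, rounded up to
    \<open>32 * (q + 2)\<close>.\<close>
  have "4 * (q + 1) * (y ^ 3 / k) + 8 * (q + 1) * (y ^ 3 / k) + 16 * (y ^ 3 / k) = (12 * q + 28) * (y ^ 3 / k)"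
    by (simp add: algebra_simps)
  also have "\<dots> \<le> (32 * (q + 2)) * (y ^ 3 / k)" using q y k by (intro mult_right_mono) auto
  also have "\<dots> = (q + 2) * (32 * y ^ 3 / k)" by simp
  finally have "2 * r * ((q + 1) * M / k ^ 2) + 2 * r\<^sup>2 * ((q + 1) * M / k) + 2 * r ^ 3 * N \<le> (q + 2) * (32 * y ^ 3 / k)"
    using A B C by linarith
  then show ?thesis unfolding M_def k_def y_def .
qed

text \<open>This is the weight of one fixed hyperedge after truncation. To leading order its
  exponent is \<open>\<rho> * \<rho>\<^sub>1 - \<rho>\<^sup>2 / 2\<close>, at most
  \<open>\<rho>\<^sub>1\<^sup>2 / 2\<close> because \<open>(\<rho>\<^sub>1 - \<rho>)\<^sup>2\<close>
  is nonnegative; at \<open>\<rho> = \<rho>\<^sub>1\<close> this is half of the untruncated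
  exponent. With \<open>\<delta> = \<epsilon> / 6\<close> the errors add up to
  \<open>5 / 2 * \<delta> * \<rho>\<^sub>1\<^sup>2\<close>, which stays below
  \<open>\<epsilon> / 2 * \<rho>\<^sub>1\<^sup>2\<close>.\<close>

lemma truncated_weight_exponent_le:
  fixes \<rho> \<rho>\<^sub>1 \<epsilon> :: real
  assumes \<rho>: "0 \<le> \<rho>" "\<rho> \<le> \<rho>\<^sub>1" and \<epsilon>: "0 < \<epsilon>" "\<epsilon> < 1" and r1: "\<rho>\<^sub>1\<^sup>2 \<le> \<epsilon> / 36"
  shows "exp (\<rho> / (1 - \<rho>\<^sup>2) * ((1 + \<epsilon> / 6) * \<rho>\<^sub>1)) * (1 / sqrt (1 + \<rho>\<^sup>2 + \<rho>\<^sup>2 * \<rho>\<^sup>2)) \<le>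
    exp (\<rho>\<^sub>1\<^sup>2 * (1 + \<epsilon>) / 2)"
proof -
  define \<delta> where "\<delta> = \<epsilon> / 6"
  define r where "r = \<rho>\<^sup>2"
  define s where "s = \<rho>\<^sub>1\<^sup>2"
  have rs: "0 \<le> r" "r \<le> s" "s \<le> \<delta> / 6" "\<delta> \<le> 1 / 6" "0 < \<delta>"
    using \<rho> \<epsilon> r1 by (auto simp: r_def s_def \<delta>_def power_mono)
  have w: "1 / sqrt (1 + r + r * r) \<le> exp (- (r - r\<^sup>2) / 2)"
  proof -
    have "1 / sqrt (1 + r + r * r) \<le> 1 / sqrt (1 + r)"
      using rs by (intro divide_left_mono real_sqrt_le_mono mult_pos_pos) (auto intro: add_pos_nonneg)
    also have "\<dots> \<le> exp (- (r - r\<^sup>2) / 2)" using rs by (intro inverse_sqrt_one_plus_le_exp) auto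
    finally show ?thesis .
  qed
  have frac: "(1 + \<delta>) / (1 - r) \<le> 1 + 2 * \<delta>"
  proof -
    have "r * (1 + 2 * \<delta>) \<le> \<delta> / 6 * 2" using rs by (intro mult_mono) auto
    then have "1 + \<delta> \<le> (1 + 2 * \<delta>) * (1 - r)" using rs by (simp add: algebra_simps)
    then show ?thesis using rs by (simp add: pos_divide_le_eq)
  qed
  have ps: "\<rho> * \<rho>\<^sub>1 \<le> s" using \<rho> by (simp add: s_def power2_eq_square mult_right_mono)
  have "0 \<le> (\<rho>\<^sub>1 - \<rho>)\<^sup>2" by simp
  then have quad: "\<rho> * \<rho>\<^sub>1 - r / 2 \<le> s / 2" by (simp add: r_def s_def power2_eq_square algebra_simps)
  have "\<rho> / (1 - r) * ((1 + \<delta>) * \<rho>\<^sub>1) = (\<rho> * \<rho>\<^sub>1) * ((1 + \<delta>) / (1 - r))" by simp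
  also have "\<dots> \<le> (\<rho> * \<rho>\<^sub>1) * (1 + 2 * \<delta>)"
    using frac \<rho> by (intro mult_left_mono) auto
  also have "\<dots> = \<rho> * \<rho>\<^sub>1 + 2 * (\<rho> * \<rho>\<^sub>1 * \<delta>)" by (simp add: algebra_simps)
  also have "\<dots> \<le> \<rho> * \<rho>\<^sub>1 + 2 * (s * \<delta>)" using ps rs by simp
  finally have lin: "\<rho> / (1 - r) * ((1 + \<delta>) * \<rho>\<^sub>1) \<le> \<rho> * \<rho>\<^sub>1 + 2 * (s * \<delta>)" .
  have "r * r \<le> s * \<delta>" using rs by (intro mult_mono) auto
  then have "- (r - r\<^sup>2) / 2 \<le> - r / 2 + s * \<delta> / 2" by (simp add: power2_eq_square)
  then have e: "\<rho> / (1 - r) * ((1 + \<delta>) * \<rho>\<^sub>1) + - (r - r\<^sup>2) / 2 \<le> s / 2 + 2 * (s * \<delta>) + s * \<delta> / 2"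
    using lin quad by linarith
  also have "\<dots> \<le> s * (1 + \<epsilon>) / 2" using rs by (simp add: \<delta>_def algebra_simps)
  finally have e': "\<rho> / (1 - r) * ((1 + \<delta>) * \<rho>\<^sub>1) + - (r - r\<^sup>2) / 2 \<le> s * (1 + \<epsilon>) / 2" .
  have "exp (\<rho> / (1 - r) * ((1 + \<delta>) * \<rho>\<^sub>1)) * (1 / sqrt (1 + r + r * r)) \<le>
      exp (\<rho> / (1 - r) * ((1 + \<delta>) * \<rho>\<^sub>1)) * exp (- (r - r\<^sup>2) / 2)"
    using w by (intro mult_left_mono) auto
  also have "\<dots> \<le> exp (s * (1 + \<epsilon>) / 2)" using e' by (simp add: exp_add[symmetric])
  finally show ?thesis by (simp add: r_def s_def \<delta>_def)
qed

section \<open>Truncation and the second moment of a pair\<close>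

text \<open>
  Overlaps with at most \<open>n / 32\<close> fixed points need no truncation: there \<open>1 / fact p\<close> beats the full
  second moment.
\<close>

definition typical_event ::
  "nat \<Rightarrow> nat \<Rightarrow> real \<Rightarrow> real \<Rightarrow> (nat \<Rightarrow> nat) \<Rightarrow> ((nat set \<Rightarrow> real) \<times> (nat set \<Rightarrow> real)) set" where
  "typical_event m n \<epsilon> \<rho>\<^sub>1 \<pi> = {w \<in> space (null_law n m). \<forall>V\<in>Pow {1..n}. real n / 32 < real (card V) \<longrightarrow>
     (\<Sum>e | e \<in> hyperedges n m \<and> \<pi> ` e \<subseteq> V. fst w e * snd w (\<pi> ` e)) \<le>
       (1 + \<epsilon> / 6) * \<rho>\<^sub>1 * real (card V choose m)}"

text \<open>The factor \<open>2 ^ n\<close> counts vertex sets. The exponent is the upper-tail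
  exponent \<open>(\<epsilon> / 6)\<^sup>2 * \<rho>\<^sub>1\<^sup>2 / 4\<close> per hyperedge, with
  \<open>\<rho>\<^sub>1\<^sup>2\<close> at the threshold and at least
  \<open>(n choose m) / (32 * m) ^ m\<close> hyperedges in a large vertex set.\<close>

definition truncation_error :: "nat \<Rightarrow> nat \<Rightarrow> real \<Rightarrow> real" where
  "truncation_error m n \<epsilon> =
     2 ^ n * exp (- (\<epsilon>\<^sup>2 * (1 - \<epsilon>) / (72 * (32 * real m) ^ m) * (real n * ln (real n))))"

text \<open>The first branch is the plain second moment for \<open>p\<close> fixed points, the
  second the truncated one. In both, \<open>p choose m\<close> is replaced by its bound
  \<open>(n choose m) * (p / n)\<^sup>2\<close>. The coefficient
  \<open>1 - \<epsilon>\<^sup>2\<close> is \<open>(1 + \<epsilon>) * (1 - \<epsilon>)\<close>: loss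
  in the truncated exponent times distance to the threshold.\<close>

definition overlap_weight :: "nat \<Rightarrow> real \<Rightarrow> nat \<Rightarrow> real" where
  "overlap_weight n \<epsilon> p = (if real p \<le> real n / 32 then exp (4 * real p ^ 2 * ln (real n) / real n)
    else exp ((1 - \<epsilon>\<^sup>2) * real p * ln (real n)))"

text \<open>Only \<open>\<rho>\<^sub>1\<close> is tied to the threshold; \<open>\<rho>\<close> may
  lie anywhere below it, even at zero. By \<open>32 * m \<le> n\<close> every vertex set with more
  than \<open>n / 32\<close> points has at least \<open>m\<close> points. \<open>\<omega>\<close> is
  the price of short orbits per two-cycle point.\<close>

context
  fixes m n :: nat and \<rho> \<epsilon> \<rho>\<^sub>1 \<omega> :: real
  assumes m: "2 \<le> m" and n: "32 * m \<le> n" and \<epsilon>: "0 < \<epsilon>" "\<epsilon> < 1"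
    and \<rho>: "0 \<le> \<rho>" "\<rho> \<le> \<rho>\<^sub>1"
    and \<rho>1: "\<rho>\<^sub>1\<^sup>2 = (1 - \<epsilon>) * 2 * real n * ln (real n) / real (n choose m)" "\<rho>\<^sub>1\<^sup>2 \<le> \<epsilon> / 36"
    and L: "16 \<le> ln (real n)" "7 \<le> \<epsilon>\<^sup>2 * ln (real n)"
    and \<omega>: "\<omega> = 32 * (real m ^ m * ln (real n)) ^ 3 / real n" "\<omega> * exp (2 * \<omega>) < 1"
begin

lemma regime_bounds:
  shows "1 \<le> n" "m \<le> n" "0 < real (n choose m)" "real (n choose m) \<le> real n ^ m"
    "real n ^ m \<le> real m ^ m * real (n choose m)" "0 \<le> \<rho>\<^sub>1" "\<rho>\<^sup>2 \<le> \<rho>\<^sub>1\<^sup>2" "\<rho>\<^sub>1\<^sup>2 \<le> 1 / 36" "\<rho> < 1"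
    "1 \<le> real m ^ m" "0 \<le> \<omega>"
proof -
  show n1: "1 \<le> n" "m \<le> n" using m n by auto
  then show N: "0 < real (n choose m)" by simp
  show "real (n choose m) \<le> real n ^ m" using binomial_le_pow[OF n1(2)] by (simp flip: of_nat_power)
  have "(real n / real m) ^ m \<le> real (n choose m)" by (rule binomial_ge_n_over_k_pow_k[OF n1(2)])
  then show "real n ^ m \<le> real m ^ m * real (n choose m)" using m by (simp add: power_divide pos_divide_le_eq mult.commute)
  show "0 \<le> \<rho>\<^sub>1" using \<rho> by simp
  show r: "\<rho>\<^sup>2 \<le> \<rho>\<^sub>1\<^sup>2" using \<rho> by (simp add: power_mono)
  show r1: "\<rho>\<^sub>1\<^sup>2 \<le> 1 / 36" using \<rho>1 \<epsilon> by simp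
  have "\<rho>\<^sup>2 < 1\<^sup>2" using r r1 by simp
  then show "\<rho> < 1" by (rule power2_less_imp_less) simp
  show "1 \<le> real m ^ m" using m by (intro one_le_power) auto
  show "0 \<le> \<omega>" using \<omega>(1) L by simp
qed

lemma sets_typical_event:
  assumes \<pi>: "\<pi> permutes {1..n}"
  shows "typical_event m n \<epsilon> \<rho>\<^sub>1 \<pi> \<in> sets (arrays n m)"
proof -
  have [measurable]: "(\<lambda>w. \<Sum>e | e \<in> hyperedges n m \<and> \<pi> ` e \<subseteq> V. fst w e * snd w (\<pi> ` e))
     \<in> borel_measurable (arrays n m)" for V
    by (rule borel_measurable_overlap[OF \<pi>]) auto
  show ?thesis unfolding typical_event_def space_null_law by measurable
qed

text \<open>Union bound over the large vertex sets with the upper tail at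
  \<open>\<delta> = \<epsilon> / 6\<close>. A set of more than \<open>n / 32\<close> vertices still
  spans a constant fraction of all hyperedges, so each exponent has the full order
  \<open>n * ln n\<close>.\<close>

lemma measure_typical_event_compl:
  assumes \<pi>: "\<pi> permutes {1..n}"
  shows "measure (H1_cond_law n m \<rho> \<pi>) (space (null_law n m) - typical_event m n \<epsilon> \<rho>\<^sub>1 \<pi>) \<le> truncation_error m n \<epsilon>"
proof -
  interpret prob_space "H1_cond_law n m \<rho> \<pi>" by (rule prob_space_H1_cond_law)
  let ?err = "exp (- (\<epsilon>\<^sup>2 * (1 - \<epsilon>) / (72 * (32 * real m) ^ m) * (real n * ln (real n))))"
  let ?A = "arrays n m"
  define J where "J V = {e \<in> hyperedges n m. \<pi> ` e \<subseteq> V}" for V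
  define S where "S = {V \<in> Pow {1..n}. real n / 32 < real (card V)}"
  define X where "X V w = (\<Sum>e\<in>J V. fst w e * snd w (\<pi> ` e))" for V and w :: "(nat set \<Rightarrow> real) \<times> (nat set \<Rightarrow> real)"
  define A where "A V = {w \<in> space ?A. (1 + \<epsilon> / 6) * \<rho>\<^sub>1 * real (card V choose m) < X V w}" for V
  have X [measurable]: "X V \<in> borel_measurable ?A" for V
    unfolding X_def J_def
    by (rule borel_measurable_overlap[OF \<pi>]) auto
  have A [measurable]: "A V \<in> sets ?A" for V unfolding A_def by measurable
  have finS: "finite S" by (simp add: S_def)
  have cJ: "card (J V) = card V choose m" if "V \<in> S" for V
    unfolding J_def using that by (intro card_hyperedges_image_subset[OF \<pi>]) (auto simp: S_def)
  have "space (null_law n m) - typical_event m n \<epsilon> \<rho>\<^sub>1 \<pi> = (\<Union>V\<in>S. A V)"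
    unfolding typical_event_def space_null_law S_def A_def X_def J_def by (auto simp: not_le)
  also have "measure (H1_cond_law n m \<rho> \<pi>) \<dots> \<le> (\<Sum>V\<in>S. measure (H1_cond_law n m \<rho> \<pi>) (A V))"
    using finS A by (intro measure_UNION_le) auto
  also have "\<dots> \<le> (\<Sum>V\<in>S. ?err)"
  proof (rule sum_mono)
    fix V assume V: "V \<in> S"
    have "measure (H1_cond_law n m \<rho> \<pi>) (A V) \<le> exp (- ((\<epsilon> / 6)\<^sup>2 * \<rho>\<^sub>1\<^sup>2 / 4 * real (card (J V))))"
    proof (rule measure_H1_cond_law_upper_tail[OF \<pi> \<rho> regime_bounds(8)])
      show "0 \<le> \<epsilon> / 6" "\<epsilon> / 6 \<le> 1" using \<epsilon> by simp_all
      show "J V \<subseteq> hyperedges n m" unfolding J_def by blast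
      show "A V \<in> sets ?A" by (rule A)
      show "(1 + \<epsilon> / 6) * \<rho>\<^sub>1 * real (card (J V)) \<le> (\<Sum>e\<in>J V. fst w e * snd w (\<pi> ` e))" if "w \<in> A V" for w
        using that unfolding A_def X_def cJ[OF V] by simp
    qed
    also have "\<dots> \<le> ?err"
    proof -
      define p where "p = card V"
      have p: "real n / 32 < real p" using V by (simp add: p_def S_def)
      have "m \<le> p" using p n by linarith
      have "(real n / (32 * real m)) ^ m \<le> (real p / real m) ^ m"
      proof (rule power_mono)
        have "real n / 32 / real m \<le> real p / real m" using p by (intro divide_right_mono) auto
        then show "real n / (32 * real m) \<le> real p / real m" by simp
      qed simp
      also have "\<dots> \<le> real (p choose m)" by (rule binomial_ge_n_over_k_pow_k[OF \<open>m \<le> p\<close>])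
      finally have "real n ^ m / (32 * real m) ^ m \<le> real (p choose m)" by (simp add: power_divide)
      moreover have "real (n choose m) / (32 * real m) ^ m \<le> real n ^ m / (32 * real m) ^ m"
        using regime_bounds(4) by (intro divide_right_mono) auto
      ultimately have c: "real (n choose m) / (32 * real m) ^ m \<le> real (p choose m)" by simp
      have "\<epsilon>\<^sup>2 * (1 - \<epsilon>) / (72 * (32 * real m) ^ m) * (real n * ln (real n)) =
        \<epsilon>\<^sup>2 / 144 * \<rho>\<^sub>1\<^sup>2 * (real (n choose m) / (32 * real m) ^ m)"
      proof -
        have "a * b / (72 * C) * (x * y) = a / 144 * (b * 2 * x * y / M) * (M / C)" if "C \<noteq> 0" "M \<noteq> 0" for a b C M x y :: real
          using that by (simp add: field_simps)
        moreover have "(32 * real m) ^ m \<noteq> 0" "real (n choose m) \<noteq> 0" using m regime_bounds(3) by auto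
        ultimately show ?thesis unfolding \<rho>1(1) by blast
      qed
      also have "\<dots> \<le> \<epsilon>\<^sup>2 / 144 * \<rho>\<^sub>1\<^sup>2 * real (p choose m)" using c by (intro mult_left_mono) auto
      finally show ?thesis by (simp add: cJ[OF V] p_def power_divide)
    qed
    finally show "measure (H1_cond_law n m \<rho> \<pi>) (A V) \<le>
      ?err" .
  qed
  also have "\<dots> = real (card S) * ?err"
    by simp
  also have "\<dots> \<le> truncation_error m n \<epsilon>"
    unfolding truncation_error_def
  proof (rule mult_right_mono)
    have "card S \<le> card (Pow {1..n})" unfolding S_def by (intro card_mono) auto
    then show "real (card S) \<le> 2 ^ n" by (simp add: card_Pow)
  qed simp
  finally show ?thesis .
qed

text \<open>If \<open>\<pi>\<close> maps a hyperedge into the fixed-point set \<open>V\<close> of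
  \<open>\<sigma>\<close>, both likelihood ratios read the same pair of entries there; these
  hyperedges are what makes the second moment large. For small \<open>V\<close> they are left alone.
  For large \<open>V\<close> the typical event of \<open>\<pi>\<close> at this \<open>V\<close>
  bounds their sum, which is exploited through a tilt.\<close>

lemma truncated_second_moment_pair:
  assumes \<pi>: "\<pi> permutes {1..n}" and \<pi>': "\<pi>' permutes {1..n}"
  defines "\<sigma> \<equiv> \<pi>' \<circ> inv \<pi>"
  shows "(\<integral>\<^sup>+w. ennreal (likelihood_ratio n m \<rho> \<pi> w) * ennreal (likelihood_ratio n m \<rho> \<pi>' w) *
      indicator (typical_event m n \<epsilon> \<rho>\<^sub>1 \<pi>) w * indicator (typical_event m n \<epsilon> \<rho>\<^sub>1 \<pi>') w \<partial>null_law n m) \<le>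
    ennreal (overlap_weight n \<epsilon> (card {i \<in> {1..n}. \<sigma> i = i}) * exp ((real (card (two_cycle_points \<sigma>)) + 2) * \<omega>))"
proof -
  let ?E = "hyperedges n m"
  let ?LL = "\<lambda>w. ennreal (likelihood_ratio n m \<rho> \<pi> w) * ennreal (likelihood_ratio n m \<rho> \<pi>' w)"
  let ?w = "1 / sqrt (1 + \<rho>\<^sup>2 + \<rho>\<^sup>2 * \<rho>\<^sup>2)"
  define r where "r = \<rho>\<^sup>2"
  define V where "V = {i \<in> {1..n}. \<sigma> i = i}"
  define q where "q = real (card (two_cycle_points \<sigma>))"
  define N where "N = real (n choose m)"
  have \<sigma>: "\<sigma> permutes {1..n}" unfolding \<sigma>_def by (rule permutes_compose[OF permutes_inv[OF \<pi>] \<pi>'])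
  have rr: "0 \<le> r" "r \<le> \<rho>\<^sub>1\<^sup>2" "r \<le> 1 / 2" using regime_bounds by (auto simp: r_def)
  have VE: "f \<subseteq> V \<longleftrightarrow> f \<subseteq> {i. \<sigma> i = i}" if "f \<in> ?E" for f using that by (auto simp: V_def hyperedges_def)
  have V: "V \<subseteq> {1..n}" by (auto simp: V_def)
  have pn: "card V \<le> n" using card_mono[OF _ V] by simp
  have n0: "0 < real n" using regime_bounds(1) by simp
  define a where "a = real (card {f \<in> ?E. \<sigma> ` f = f \<and> \<not> f \<subseteq> {i. \<sigma> i = i}})"
  define b where "b = real (card {f \<in> ?E. \<sigma> ` f \<noteq> f \<and> \<sigma> ` \<sigma> ` f = f})"
  let ?X = "\<lambda>F. exp (2 * r * real (card {f \<in> ?E. \<sigma> ` f = f \<and> f \<notin> F}) + 2 * r\<^sup>2 * b + 2 * r ^ 3 * N)"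
  have extra: "2 * r * a + 2 * r\<^sup>2 * b + 2 * r ^ 3 * N \<le> (q + 2) * \<omega>"
  proof -
    have "a \<le> (q + 1) * real n ^ m / real n ^ 2" unfolding a_def q_def
      by (rule card_fixed_hyperedges_le[OF \<sigma> regime_bounds(1)])
    moreover have "b \<le> (q + 1) * real n ^ m / real n" unfolding b_def q_def
      using card_involuted_hyperedges_le[OF \<sigma> regime_bounds(1)] by simp
    ultimately have "2 * r * a + 2 * r\<^sup>2 * b + 2 * r ^ 3 * N \<le>
      2 * r * ((q + 1) * real n ^ m / real n ^ 2) + 2 * r\<^sup>2 * ((q + 1) * real n ^ m / real n) + 2 * r ^ 3 * N"
      using rr by (intro add_mono mult_left_mono) auto
    also have "\<dots> \<le> (q + 2) * (32 * (real m ^ m * ln (real n)) ^ 3 / real n)"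
    proof (rule short_orbit_exponent_le[OF m regime_bounds(1,10)])
      show "1 \<le> ln (real n)" using L by simp
      have "r * real n ^ m \<le> \<rho>\<^sub>1\<^sup>2 * (real m ^ m * N)"
        using rr regime_bounds by (intro mult_mono) (auto simp: N_def)
      also have "\<dots> = (1 - \<epsilon>) * (2 * (real m ^ m) * ln (real n) * real n)"
        unfolding \<rho>1(1) N_def using regime_bounds(3) by (simp add: field_simps)
      also have "\<dots> \<le> 1 * (2 * (real m ^ m) * ln (real n) * real n)"
        using \<epsilon> L by (intro mult_right_mono) auto
      finally show "r * real n ^ m \<le> 2 * (real m ^ m) * ln (real n) * real n" by simp
      show "N \<le> real n ^ m" "0 \<le> N" using regime_bounds by (auto simp: N_def)
    qed (use rr in \<open>auto simp: q_def\<close>)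
    finally show ?thesis by (simp add: \<omega>(1))
  qed
  \<comment> \<open>Since \<open>p / n \<le> 1\<close>, the power \<open>m\<close> may be lowered to
    two, and one bound serves all \<open>m \<ge> 2\<close>.\<close>
  have ratio: "real (card V choose m) \<le> N * (real (card V) / real n)\<^sup>2"
  proof -
    have "real (card V choose m) \<le> N * (real (card V) / real n) ^ m"
      unfolding N_def using pn regime_bounds by (intro binomial_le_binomial_mult_power) auto
    also have "\<dots> \<le> N * (real (card V) / real n) ^ 2"
      using pn m n0 by (intro mult_left_mono power_decreasing) (auto simp: N_def)
    finally show ?thesis .
  qed
  have r1N: "\<rho>\<^sub>1\<^sup>2 * N = (1 - \<epsilon>) * 2 * real n * ln (real n)"
    unfolding \<rho>1(1) N_def using regime_bounds(3) by simp
  have r1C: "\<rho>\<^sub>1\<^sup>2 * real (card V choose m) \<le> (1 - \<epsilon>) * 2 * (real (card V))\<^sup>2 * ln (real n) / real n"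
  proof -
    have "\<rho>\<^sub>1\<^sup>2 * real (card V choose m) \<le> \<rho>\<^sub>1\<^sup>2 * (N * (real (card V) / real n)\<^sup>2)"
      using ratio by (intro mult_left_mono) auto
    also have "\<dots> = (\<rho>\<^sub>1\<^sup>2 * N) * (real (card V) / real n)\<^sup>2" by simp
    also have "\<dots> = (1 - \<epsilon>) * 2 * (real (card V))\<^sup>2 * ln (real n) / real n"
      unfolding r1N using n0 by (simp add: power_divide power2_eq_square)
    finally show ?thesis .
  qed
  show ?thesis
  proof (cases "real (card V) \<le> real n / 32")
    case True
    \<comment> \<open>Both indicators are dropped; with no tilted hyperedges the exponential factor
      is one.\<close>
    have "(\<integral>\<^sup>+w. ?LL w * indicator (typical_event m n \<epsilon> \<rho>\<^sub>1 \<pi>) w * indicator (typical_event m n \<epsilon> \<rho>\<^sub>1 \<pi>') w \<partial>null_law n m) \<le>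
      (\<integral>\<^sup>+w. ?LL w * ennreal (exp (- (\<rho> / (1 - \<rho>\<^sup>2)) *
        (\<Sum>e | e \<in> ?E \<and> \<pi> ` e \<in> {}. fst w e * snd w (\<pi> ` e)))) \<partial>null_law n m)"
      by (intro nn_integral_mono) (auto simp: indicator_def)
    also have "\<dots> \<le> ennreal (\<Prod>f\<in>?E. orbit_weight \<sigma> {} ?w (\<rho>\<^sup>2) f)"
      unfolding \<sigma>_def by (rule nn_integral_likelihood_ratio_mult_le[OF \<pi> \<pi>' \<rho>(1) regime_bounds(9)]) auto
    also have "\<dots> \<le> ennreal (?w ^ card ({} :: nat set set) *
      ?X {})"
      unfolding b_def N_def r_def
      using rr by (intro ennreal_leI prod_orbit_weight_le[OF \<sigma>]) (auto simp: r_def)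
    also have "\<dots> \<le> ennreal (overlap_weight n \<epsilon> (card V) * exp ((q + 2) * \<omega>))"
    proof (rule ennreal_leI)
      have "{f \<in> ?E. \<sigma> ` f = f} \<subseteq> {f \<in> ?E. f \<subseteq> V} \<union> {f \<in> ?E. \<sigma> ` f = f \<and> \<not> f \<subseteq> {i. \<sigma> i = i}}"
        using VE by auto
      then have "card {f \<in> ?E. \<sigma> ` f = f} \<le> card ({f \<in> ?E. f \<subseteq> V} \<union> {f \<in> ?E. \<sigma> ` f = f \<and> \<not> f \<subseteq> {i. \<sigma> i = i}})"
        by (intro card_mono) auto
      also have "\<dots> \<le> card {f \<in> ?E. f \<subseteq> V} + card {f \<in> ?E. \<sigma> ` f = f \<and> \<not> f \<subseteq> {i. \<sigma> i = i}}"
        by (rule card_Un_le)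
      finally have "real (card {f \<in> ?E. \<sigma> ` f = f}) \<le> real (card V choose m) + a"
        unfolding a_def card_hyperedges_subset[OF V] by linarith
      then have "2 * r * real (card {f \<in> ?E. \<sigma> ` f = f}) \<le> 2 * r * (real (card V choose m) + a)"
        using rr by (intro mult_left_mono) auto
      moreover have "2 * r * real (card V choose m) \<le> 4 * (real (card V))\<^sup>2 * ln (real n) / real n"
      proof -
        have "r * real (card V choose m) \<le> \<rho>\<^sub>1\<^sup>2 * real (card V choose m)"
          using rr by (intro mult_right_mono) auto
        also note r1C
        also have "(1 - \<epsilon>) * 2 * (real (card V))\<^sup>2 * ln (real n) / real n \<le> 1 * 2 * (real (card V))\<^sup>2 * ln (real n) / real n"
          using \<epsilon> L n0 by (intro divide_right_mono mult_right_mono) auto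
        finally show ?thesis by simp
      qed
      ultimately have "2 * r * real (card {f \<in> ?E. \<sigma> ` f = f}) + 2 * r\<^sup>2 * b + 2 * r ^ 3 * N \<le>
        4 * (real (card V))\<^sup>2 * ln (real n) / real n + (q + 2) * \<omega>"
        using extra by (simp add: algebra_simps)
      then show "?w ^ card ({} :: nat set set) *
          ?X {} \<le>
          overlap_weight n \<epsilon> (card V) * exp ((q + 2) * \<omega>)"
        using True by (simp add: overlap_weight_def exp_add[symmetric])
    qed
    finally show ?thesis by (simp add: V_def q_def)
  next
    case False
    define F where "F = {f \<in> ?E. f \<subseteq> V}"
    define \<theta> where "\<theta> = \<rho> / (1 - \<rho>\<^sup>2)"
    have \<theta>: "0 \<le> \<theta>" using \<rho> rr by (simp add: \<theta>_def r_def)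
    define t where "t = (1 + \<epsilon> / 6) * \<rho>\<^sub>1"
    have cF: "card F = card V choose m" unfolding F_def by (rule card_hyperedges_subset[OF V])
    have fixF: "\<sigma> ` f = f" if "f \<in> F" for f
    proof -
      have "f \<subseteq> V" using that by (simp add: F_def)
      then have "\<sigma> ` f = (\<lambda>x. x) ` f" by (intro image_cong) (auto simp: V_def)
      then show ?thesis by simp
    qed
    have setF: "{e. e \<in> ?E \<and> \<pi> ` e \<in> F} = {e. e \<in> ?E \<and> \<pi> ` e \<subseteq> V}"
      using hyperedges_image[OF \<pi>] by (auto simp: F_def)
    let ?S = "\<lambda>w. \<Sum>e | e \<in> ?E \<and> \<pi> ` e \<in> F. fst w e * snd w (\<pi> ` e)"
    have LLm: "(\<lambda>w. ?LL w * ennreal (exp (- \<theta> * ?S w))) \<in> borel_measurable (null_law n m)"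
    proof -
      have "?S \<in> borel_measurable (arrays n m)"
        by (rule borel_measurable_overlap[OF \<pi>]) auto
      moreover have "likelihood_ratio n m \<rho> \<pi> \<in> borel_measurable (arrays n m)"
        "likelihood_ratio n m \<rho> \<pi>' \<in> borel_measurable (arrays n m)"
        by (intro borel_measurable_likelihood_ratio \<pi> \<pi>')+
      ultimately show ?thesis unfolding measurable_cong_sets[OF sets_null_law refl] by measurable
    qed
    have "(\<integral>\<^sup>+w. ?LL w * indicator (typical_event m n \<epsilon> \<rho>\<^sub>1 \<pi>) w * indicator (typical_event m n \<epsilon> \<rho>\<^sub>1 \<pi>') w \<partial>null_law n m) \<le>
      (\<integral>\<^sup>+w. ennreal (exp (\<theta> * t) ^ card F) * (?LL w * ennreal (exp (- \<theta> * ?S w))) \<partial>null_law n m)"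
    proof (rule nn_integral_mono)
      fix w
      show "?LL w * indicator (typical_event m n \<epsilon> \<rho>\<^sub>1 \<pi>) w * indicator (typical_event m n \<epsilon> \<rho>\<^sub>1 \<pi>') w \<le>
          ennreal (exp (\<theta> * t) ^ card F) * (?LL w * ennreal (exp (- \<theta> * ?S w)))"
      \<comment> \<open>Chernoff's device: on the typical event the sum is at most
        \<open>t * card F\<close>, so the indicator is at most
        \<open>exp (\<theta> * (t * card F - ?S w))\<close>. The indicator belonging to
        \<open>\<pi>'\<close> is bounded by one.\<close>
      proof (cases "w \<in> typical_event m n \<epsilon> \<rho>\<^sub>1 \<pi>")
        case True
        then have "?S w \<le> t * real (card F)"
          using False V unfolding typical_event_def setF cF t_def by auto
        then have "0 \<le> \<theta> * (t * real (card F) - ?S w)" using \<theta> by simp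
        then have "1 \<le> exp (\<theta> * (t * real (card F) - ?S w))" by simp
        also have "\<dots> = exp (\<theta> * t) ^ card F * exp (- \<theta> * ?S w)"
          by (simp add: exp_of_nat_mult[symmetric] exp_add[symmetric] algebra_simps)
        finally have "ennreal 1 \<le> ennreal (exp (\<theta> * t) ^ card F * exp (- \<theta> * ?S w))"
          by (rule ennreal_leI)
        then have "?LL w * 1 \<le> ?LL w * (ennreal (exp (\<theta> * t) ^ card F) * ennreal (exp (- \<theta> * ?S w)))"
          by (intro mult_left_mono) (auto simp: ennreal_mult)
        moreover have "?LL w * indicator (typical_event m n \<epsilon> \<rho>\<^sub>1 \<pi>) w * indicator (typical_event m n \<epsilon> \<rho>\<^sub>1 \<pi>') w \<le> ?LL w * 1"
          by (auto simp: indicator_def)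
        ultimately show ?thesis by (simp add: mult_ac)
      qed simp
    qed
    also have "\<dots> = ennreal (exp (\<theta> * t) ^ card F) * (\<integral>\<^sup>+w. ?LL w * ennreal (exp (- \<theta> * ?S w)) \<partial>null_law n m)"
      by (rule nn_integral_cmult[OF LLm])
    also have "\<dots> \<le> ennreal (exp (\<theta> * t) ^ card F) * ennreal (\<Prod>f\<in>?E. orbit_weight \<sigma> F ?w (\<rho>\<^sup>2) f)"
      unfolding \<sigma>_def \<theta>_def
      by (intro mult_left_mono nn_integral_likelihood_ratio_mult_le[OF \<pi> \<pi>' \<rho>(1) regime_bounds(9)])
        (use fixF in \<open>auto simp: F_def \<sigma>_def\<close>)
    also have "\<dots> \<le> ennreal (exp (\<theta> * t) ^ card F) * ennreal (?w ^ card F *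
      ?X F)"
      unfolding b_def N_def r_def
      using rr fixF by (intro mult_left_mono ennreal_leI prod_orbit_weight_le[OF \<sigma>]) (auto simp: r_def F_def)
    also have "\<dots> = ennreal (exp (\<theta> * t) ^ card F * (?w ^ card F *
      ?X F))"
      by (rule ennreal_mult[symmetric]) auto
    also have "exp (\<theta> * t) ^ card F * (?w ^ card F *
      ?X F) =
      (exp (\<theta> * t) * ?w) ^ card F *
      ?X F"
      by (simp only: power_mult_distrib mult.assoc)
    also have "\<dots> \<le> ennreal (overlap_weight n \<epsilon> (card V) * exp ((q + 2) * \<omega>))"
    proof (intro ennreal_leI mult_mono)
      have "(exp (\<theta> * t) * ?w) ^ card F \<le> exp (\<rho>\<^sub>1\<^sup>2 * (1 + \<epsilon>) / 2) ^ card F"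
        unfolding \<theta>_def t_def
        by (intro power_mono truncated_weight_exponent_le[OF \<rho> \<epsilon> \<rho>1(2)]) auto
      also have "\<dots> = exp ((1 + \<epsilon>) / 2 * (\<rho>\<^sub>1\<^sup>2 * real (card F)))"
        by (simp add: exp_of_nat_mult[symmetric] mult_ac)
      also have "\<dots> \<le> exp ((1 - \<epsilon>\<^sup>2) * real (card V) * ln (real n))"
      proof -
        have "\<rho>\<^sub>1\<^sup>2 * real (card F) \<le> (1 - \<epsilon>) * 2 * (real (card V))\<^sup>2 * ln (real n) / real n"
          using r1C by (simp add: cF)
        also have "\<dots> = (1 - \<epsilon>) * 2 * real (card V) * ln (real n) * (real (card V) / real n)"
          by (simp add: power2_eq_square)
        \<comment> \<open>One factor \<open>p / n\<close> is given up, so that the exponent is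
          linear in \<open>p\<close> times \<open>ln n\<close> and can be compared with
          \<open>ln (fact p)\<close>.\<close>
        also have "\<dots> \<le> (1 - \<epsilon>) * 2 * real (card V) * ln (real n) * 1"
          using pn n0 \<epsilon> L by (intro mult_left_mono) auto
        finally have "(1 + \<epsilon>) / 2 * (\<rho>\<^sub>1\<^sup>2 * real (card F)) \<le> (1 + \<epsilon>) / 2 * ((1 - \<epsilon>) * 2 * real (card V) * ln (real n) * 1)"
          using \<epsilon> by (intro mult_left_mono) auto
        also have "\<dots> = ((1 + \<epsilon>) * (1 - \<epsilon>)) * real (card V) * ln (real n)" by simp
        also have "(1 + \<epsilon>) * (1 - \<epsilon>) = 1 - \<epsilon>\<^sup>2" by (simp add: power2_eq_square algebra_simps)
        finally show ?thesis by simp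
      qed
      finally show "(exp (\<theta> * t) * ?w) ^ card F \<le> overlap_weight n \<epsilon> (card V)"
        using False by (simp add: overlap_weight_def)
      have "{f \<in> ?E. \<sigma> ` f = f \<and> f \<notin> F} = {f \<in> ?E. \<sigma> ` f = f \<and> \<not> f \<subseteq> {i. \<sigma> i = i}}"
        using VE by (auto simp: F_def)
      then show "?X F \<le> exp ((q + 2) * \<omega>)"
        using extra by (simp add: a_def)
    qed (auto simp: overlap_weight_def)
    finally show ?thesis by (simp add: V_def q_def)
  qed
qed

lemma total_variation_H0_H1_le:
  assumes s: "0 < s"
  defines "\<kappa> \<equiv> exp (4 * ln (real n) / sqrt (real n) + 2 * \<omega>) / (1 - \<omega> * exp (2 * \<omega>)) +
    (real n + 1) * exp (- (real n powr (1/4)) / 32 + (real n + 2) * \<omega>) - 1"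
  shows "total_variation (H0_law n m) (H1_law n m \<rho>) \<le> truncation_error m n \<epsilon> + s / 2 + (\<kappa> + 2 * truncation_error m n \<epsilon>) / (2 * s)"
proof -
  let ?\<Omega> = "{\<pi>. \<pi> permutes {1..n}}"
  let ?b = "\<lambda>\<sigma>. overlap_weight n \<epsilon> (card {i \<in> {1..n}. \<sigma> i = i}) * exp ((real (card (two_cycle_points \<sigma>)) + 2) * \<omega>)"
  have card\<Omega>: "card ?\<Omega> = fact n" by (rule card_permutations) simp_all
  have "total_variation (null_law n m) (H1_law n m \<rho>) \<le> truncation_error m n \<epsilon> + s / 2 + (\<kappa> + 2 * truncation_error m n \<epsilon>) / (2 * s)"
  proof (rule total_variation_mixture_le[where I = ?\<Omega> and R = "H1_cond_law n m \<rho>" and L = "likelihood_ratio n m \<rho>"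
        and G = "typical_event m n \<epsilon> \<rho>\<^sub>1" and B = "\<lambda>\<pi> \<pi>'. ?b (\<pi>' \<circ> inv \<pi>)"])
    show "prob_space (null_law n m)" by (rule prob_space_null_law)
    show "finite ?\<Omega>" by (rule finite_permutations) simp
    show "?\<Omega> \<noteq> {}" using permutes_id by blast
    show "likelihood_ratio n m \<rho> \<pi> \<in> borel_measurable (null_law n m)" if "\<pi> \<in> ?\<Omega>" for \<pi>
      unfolding measurable_cong_sets[OF sets_null_law refl] using that by (intro borel_measurable_likelihood_ratio) simp
    show "0 \<le> likelihood_ratio n m \<rho> \<pi> w" for \<pi> w
      using \<rho>(1) regime_bounds(9) by (intro likelihood_ratio_nonneg) simp
    show "prob_space (H1_cond_law n m \<rho> \<pi>)" for \<pi> by (rule prob_space_H1_cond_law)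
    show "H1_cond_law n m \<rho> \<pi> = density (null_law n m) (\<lambda>w. ennreal (likelihood_ratio n m \<rho> \<pi> w))" if "\<pi> \<in> ?\<Omega>" for \<pi>
      using H1_cond_law_eq_density[of \<pi> n \<rho> m] that \<rho>(1) regime_bounds(9) by simp
    show "measure (H1_law n m \<rho>) E = (\<Sum>\<pi>\<in>?\<Omega>. measure (H1_cond_law n m \<rho> \<pi>) E) / real (card ?\<Omega>)"
      if "E \<in> sets (null_law n m)" for E
      using measure_H1_law[of E n m \<rho>] that card\<Omega> by simp
    show "typical_event m n \<epsilon> \<rho>\<^sub>1 \<pi> \<in> sets (null_law n m)" if "\<pi> \<in> ?\<Omega>" for \<pi>
      using sets_typical_event that by simp
    show "measure (H1_cond_law n m \<rho> \<pi>) (space (null_law n m) - typical_event m n \<epsilon> \<rho>\<^sub>1 \<pi>) \<le> truncation_error m n \<epsilon>"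
      if "\<pi> \<in> ?\<Omega>" for \<pi>
      using that by (intro measure_typical_event_compl) simp
    show "(\<integral>\<^sup>+w. ennreal (likelihood_ratio n m \<rho> \<pi> w) * ennreal (likelihood_ratio n m \<rho> \<pi>' w) *
      indicator (typical_event m n \<epsilon> \<rho>\<^sub>1 \<pi>) w * indicator (typical_event m n \<epsilon> \<rho>\<^sub>1 \<pi>') w \<partial>null_law n m) \<le> ennreal (?b (\<pi>' \<circ> inv \<pi>))"
      if "\<pi> \<in> ?\<Omega>" "\<pi>' \<in> ?\<Omega>" for \<pi> \<pi>'
      using that by (intro truncated_second_moment_pair) auto
    show "0 \<le> ?b (\<pi>' \<circ> inv \<pi>)" for \<pi> \<pi>' by (simp add: overlap_weight_def)
    \<comment> \<open>For fixed \<open>\<pi>\<close> the map from \<open>\<pi>'\<close> to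
      \<open>\<pi>' \<circ> inv \<pi>\<close> is a bijection of the permutations, so the average
      over pairs is an average over a single permutation.\<close>
    have inner: "(\<Sum>\<pi>'\<in>?\<Omega>. ?b (\<pi>' \<circ> inv \<pi>)) = (\<Sum>\<sigma>\<in>?\<Omega>. ?b \<sigma>)" if "\<pi> \<in> ?\<Omega>" for \<pi>
      using sum_permutations_compose_right[OF permutes_inv, of \<pi> "{1..n}" ?b] that by simp
    have "(\<Sum>\<pi>\<in>?\<Omega>. \<Sum>\<pi>'\<in>?\<Omega>. ?b (\<pi>' \<circ> inv \<pi>)) = (\<Sum>\<pi>\<in>?\<Omega>. \<Sum>\<sigma>\<in>?\<Omega>. ?b \<sigma>)"
      by (intro sum.cong[OF refl] inner)
    also have "\<dots> = fact n * (\<Sum>\<sigma>\<in>?\<Omega>. ?b \<sigma>)" by (simp only: sum_constant card\<Omega> of_nat_fact)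
    finally have "(\<Sum>\<pi>\<in>?\<Omega>. \<Sum>\<pi>'\<in>?\<Omega>. ?b (\<pi>' \<circ> inv \<pi>)) / (real (card ?\<Omega>))\<^sup>2 = (\<Sum>\<sigma>\<in>?\<Omega>. ?b \<sigma>) / fact n"
      unfolding card\<Omega> by (simp only: of_nat_fact power2_eq_square) (rule nonzero_mult_divide_mult_cancel_left, simp)
    also have "\<dots> \<le> 1 + \<kappa>"
      using sum_permutes_overlap_weight_le[of n "\<epsilon>\<^sup>2" \<omega>, OF L regime_bounds(11) \<omega>(2)]
      unfolding \<kappa>_def overlap_weight_def by simp
    finally show "(\<Sum>\<pi>\<in>?\<Omega>. \<Sum>\<pi>'\<in>?\<Omega>. ?b (\<pi>' \<circ> inv \<pi>)) / (real (card ?\<Omega>))\<^sup>2 \<le> 1 + \<kappa>" .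
  qed (rule s)
  then show ?thesis by (simp add: H0_law_eq)
qed

end

section \<open>Distinguishability at finite size\<close>

lemma total_variation_bounds:
  assumes "prob_space P" "prob_space Q"
  shows "0 \<le> total_variation P Q" "total_variation P Q \<le> 1"
    and "\<And>E. E \<in> sets P \<Longrightarrow> \<bar>measure P E - measure Q E\<bar> \<le> total_variation P Q"
proof -
  interpret P: prob_space P by fact
  interpret Q: prob_space Q by fact
  have le1: "\<bar>measure P E - measure Q E\<bar> \<le> 1" for E
    using P.prob_le_1[of E] Q.prob_le_1[of E] measure_nonneg[of P E] measure_nonneg[of Q E] by linarith
  then have bdd: "bdd_above ((\<lambda>E. \<bar>measure P E - measure Q E\<bar>) ` sets P)" by (intro bdd_aboveI2)
  show upper: "\<bar>measure P E - measure Q E\<bar> \<le> total_variation P Q" if "E \<in> sets P" for E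
    unfolding total_variation_def by (rule cSUP_upper[OF that bdd])
  show "0 \<le> total_variation P Q" using upper[of "{}"] by simp
  show "total_variation P Q \<le> 1" unfolding total_variation_def using le1 by (intro cSUP_least) auto
qed

text \<open>The induction step amounts to \<open>1 \<le> (n + 1) * ln ((n + 1) / n)\<close>, which
  is \<open>ln x \<le> x - 1\<close> at the reciprocal \<open>x = n / (n + 1)\<close>.\<close>

lemma fact_le_exp:
  assumes "1 \<le> n"
  shows "fact n \<le> exp ((real n + 1) * ln (real n) - real n + 1)"
  using assms
proof (induction n rule: dec_induct)
  case base
  show ?case by simp
next
  case (step n)
  have n: "0 < real n" using step by simp
  have "1 - 1 / (1 + 1 / real n) \<le> ln (1 + 1 / real n)"
  proof -
    have pos: "0 < 1 + 1 / real n" using n by (simp add: add_pos_pos)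
    then have "ln (1 / (1 + 1 / real n)) \<le> 1 / (1 + 1 / real n) - 1" by (intro ln_le_minus_one) simp
    then show ?thesis using ln_div[of 1 "1 + 1 / real n"] pos by simp
  qed
  moreover have "1 - 1 / (1 + 1 / real n) = 1 / (real n + 1)" using n by (simp add: field_simps)
  moreover have "ln (1 + 1 / real n) = ln (real n + 1) - ln (real n)"
  proof -
    have "1 + 1 / real n = (real n + 1) / real n" using n by (simp add: field_simps)
    then show ?thesis using n by (simp add: ln_div)
  qed
  ultimately have "1 / (real n + 1) \<le> ln (real n + 1) - ln (real n)" by simp
  then have "(real n + 1) * (1 / (real n + 1)) \<le> (real n + 1) * (ln (real n + 1) - ln (real n))"
    using n by (intro mult_left_mono) auto
  then have key: "1 \<le> (real n + 1) * ln (real n + 1) - (real n + 1) * ln (real n)"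
    using n by (simp add: algebra_simps)
  have "fact (Suc n) = (real n + 1) * fact n" by simp
  also have "\<dots> \<le> (real n + 1) * exp ((real n + 1) * ln (real n) - real n + 1)"
    using step.IH by (intro mult_left_mono) auto
  also have "\<dots> = exp (ln (real n + 1) + ((real n + 1) * ln (real n) - real n + 1))"
    using n by (simp add: exp_add[of "ln (real n + 1)"])
  also have "\<dots> \<le> exp ((real (Suc n) + 1) * ln (real (Suc n)) - real (Suc n) + 1)"
    using key by (simp add: algebra_simps)
  finally show ?case .
qed

text \<open>At the threshold correlation \<open>\<rho>\<^sub>0 = sqrt (D / N)\<close> the true
  overlap has mean \<open>sqrt N * sqrt D\<close> and fluctuations of order \<open>sqrt N\<close>.
  The level \<open>t\<close> lies \<open>a\<close> such units below the mean, which gives the error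
  \<open>exp (- a\<^sup>2 / 4)\<close> under the alternative and costs a factor
  \<open>exp (a * sqrt D)\<close> under the null.\<close>

lemma total_variation_H0_H1_ge:
  fixes m n :: nat and \<rho> a D N :: real
  defines "N \<equiv> real (n choose m)" and "D \<equiv> 2 * real n * ln (real n)"
  assumes n: "1 \<le> n" and N: "0 < N" and D: "0 < D" "D / N \<le> 1 / 8" and a: "0 < a" "a \<le> 2 * sqrt D"
    and \<rho>: "0 \<le> \<rho>" "\<rho> \<le> 1" "D / N \<le> \<rho>\<^sup>2"
  shows "1 - exp (- a\<^sup>2 / 4) - exp (ln (real n) - real n + 1 + a * sqrt D + D\<^sup>2 / N) \<le>
    total_variation (H0_law n m) (H1_law n m \<rho>)"
proof -
  let ?E = "hyperedges n m"
  let ?A = "arrays n m"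
  let ?\<Omega> = "{\<pi>. \<pi> permutes {1..n}}"
  have fin\<Omega>: "finite ?\<Omega>" by (rule finite_permutations) simp
  have card\<Omega>: "card ?\<Omega> = fact n" by (rule card_permutations) simp_all
  define r\<^sub>0 where "r\<^sub>0 = D / N"
  define \<rho>\<^sub>0 where "\<rho>\<^sub>0 = sqrt r\<^sub>0"
  define \<theta> where "\<theta> = a / sqrt N"
  define t where "t = sqrt N * (sqrt D - a)"
  have r0: "0 \<le> r\<^sub>0" "r\<^sub>0 \<le> 1 / 8" "r\<^sub>0 * N = D" using D N by (auto simp: r\<^sub>0_def)
  have \<rho>0: "0 \<le> \<rho>\<^sub>0" "\<rho>\<^sub>0\<^sup>2 = r\<^sub>0" "\<rho>\<^sub>0 * sqrt N = sqrt D" using r0 N D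
    by (auto simp: \<rho>\<^sub>0_def r\<^sub>0_def real_sqrt_divide power_divide)
  have \<rho>0le: "\<rho>\<^sub>0 \<le> \<rho>" using \<rho> unfolding \<rho>\<^sub>0_def r\<^sub>0_def by (intro real_le_lsqrt) auto
  have cardE: "real (card ?E) = N" by (simp add: card_hyperedges N_def)
  have sq: "sqrt N * sqrt N = N" "sqrt D * sqrt D = D" using N D by simp_all
  define X where "X \<pi> w = (\<Sum>e\<in>?E. fst w e * snd w (\<pi> ` e))" for \<pi> and w :: "(nat set \<Rightarrow> real) \<times> (nat set \<Rightarrow> real)"
  define A where "A \<pi> = {w \<in> space ?A. t \<le> X \<pi> w}" for \<pi>
  have A [measurable]: "A \<pi> \<in> sets ?A" if \<pi>: "\<pi> \<in> ?\<Omega>" for \<pi>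
  proof -
    have [measurable]: "X \<pi> \<in> borel_measurable ?A"
      unfolding X_def using \<pi>
      by (intro borel_measurable_overlap) auto
    show ?thesis unfolding A_def by measurable
  qed
  define E where "E = (\<Union>\<pi>\<in>?\<Omega>. A \<pi>)"
  have E: "E \<in> sets ?A" unfolding E_def using fin\<Omega> A by (intro sets.finite_UN) auto
  have P: "measure (H0_law n m) E \<le> exp (ln (real n) - real n + 1 + a * sqrt D + D\<^sup>2 / N)"
  proof -
    interpret P: prob_space "H0_law n m" by (rule prob_space_H0_law)
    have "measure (H0_law n m) E \<le> (\<Sum>\<pi>\<in>?\<Omega>. measure (H0_law n m) (A \<pi>))"
      unfolding E_def using fin\<Omega> A by (intro measure_UNION_le) auto
    also have "\<dots> \<le> (\<Sum>\<pi>\<in>?\<Omega>. exp (a * sqrt D - D / 2 + D\<^sup>2 / N))"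
    proof (rule sum_mono)
      fix \<pi> assume "\<pi> \<in> ?\<Omega>"
      then have \<pi>: "\<pi> permutes {1..n}" by simp
      have "measure (H0_law n m) (A \<pi>) = measure (H1_cond_law n m 0 \<pi>) (A \<pi>)"
        by (simp add: H0_law_eq H1_cond_law_0[OF \<pi>])
      also have "\<dots> \<le> exp (- (\<rho>\<^sub>0 * t)) * (1 / sqrt (1 - 2 * 0 * \<rho>\<^sub>0 - \<rho>\<^sub>0\<^sup>2 * (1 - 0\<^sup>2))) ^ card ?E"
        using \<pi> r0 \<rho>0 A[of \<pi>]
        by (intro measure_H1_cond_law_Chernoff[OF \<pi>]) (auto simp: A_def X_def intro: mult_left_mono)
      also have "\<dots> \<le> exp (- (\<rho>\<^sub>0 * t)) * exp ((r\<^sub>0 + 2 * r\<^sub>0\<^sup>2) / 2) ^ card ?E"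
        using inverse_sqrt_one_minus_le_exp[of r\<^sub>0] r0 \<rho>0 by (intro mult_left_mono power_mono) auto
      also have "\<dots> = exp (- (\<rho>\<^sub>0 * t) + N * ((r\<^sub>0 + 2 * r\<^sub>0\<^sup>2) / 2))"
        by (simp only: exp_of_nat_mult[symmetric] exp_add[symmetric] cardE)
      also have "- (\<rho>\<^sub>0 * t) + N * ((r\<^sub>0 + 2 * r\<^sub>0\<^sup>2) / 2) = a * sqrt D - D / 2 + D\<^sup>2 / N"
      proof -
        have "\<rho>\<^sub>0 * t = (\<rho>\<^sub>0 * sqrt N) * (sqrt D - a)" by (simp add: t_def)
        then have "\<rho>\<^sub>0 * t = D - a * sqrt D" using \<rho>0 sq by (simp add: algebra_simps)
        moreover have "N * ((r\<^sub>0 + 2 * r\<^sub>0\<^sup>2) / 2) = (r\<^sub>0 * N) / 2 + (r\<^sub>0 * N)\<^sup>2 / N"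
          using N by (simp add: power2_eq_square field_simps)
        ultimately show ?thesis using r0(3) by simp
      qed
      finally show "measure (H0_law n m) (A \<pi>) \<le> exp (a * sqrt D - D / 2 + D\<^sup>2 / N)" .
    qed
    also have "\<dots> = fact n * exp (a * sqrt D - D / 2 + D\<^sup>2 / N)"
      by (simp only: sum_constant card\<Omega> of_nat_fact)
    \<comment> \<open>Here \<open>D / 2 = n * ln n\<close> cancels the main term of the bound on
      \<open>fact n\<close>; the surviving \<open>- n\<close> has to pay for
      \<open>a * sqrt D\<close>.\<close>
    also have "\<dots> \<le> exp ((real n + 1) * ln (real n) - real n + 1) * exp (a * sqrt D - D / 2 + D\<^sup>2 / N)"
      by (intro mult_right_mono fact_le_exp n) auto
    also have "\<dots> = exp (ln (real n) - real n + 1 + a * sqrt D + D\<^sup>2 / N)"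
      by (simp add: exp_add[symmetric] D_def algebra_simps)
    finally show ?thesis .
  qed
  have Q: "1 - exp (- a\<^sup>2 / 4) \<le> measure (H1_law n m \<rho>) E"
  proof -
    have cond: "1 - exp (- a\<^sup>2 / 4) \<le> measure (H1_cond_law n m \<rho> \<pi>) E" if "\<pi> \<in> ?\<Omega>" for \<pi>
    proof -
      interpret Q: prob_space "H1_cond_law n m \<rho> \<pi>" by (rule prob_space_H1_cond_law)
      have \<pi>: "\<pi> permutes {1..n}" using that by simp
      define v where "v = 2 * \<rho>\<^sub>0 * \<theta> - \<theta>\<^sup>2"
      have \<theta>: "0 \<le> \<theta>" "\<theta>\<^sup>2 * N = a\<^sup>2" "\<rho>\<^sub>0 * \<theta> * N = a * sqrt D"
      proof -
        show "0 \<le> \<theta>" "\<theta>\<^sup>2 * N = a\<^sup>2" using a N by (auto simp: \<theta>_def power_divide)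
        have "\<rho>\<^sub>0 * \<theta> * N = (\<rho>\<^sub>0 * sqrt N) * a * (sqrt N / sqrt N)"
          unfolding \<theta>_def using sq N by (simp add: field_simps)
        then show "\<rho>\<^sub>0 * \<theta> * N = a * sqrt D" using \<rho>0 N by simp
      qed
      have \<theta>le: "\<theta> \<le> 2 * \<rho>\<^sub>0"
      proof -
        have "a / sqrt N \<le> 2 * sqrt D / sqrt N" using a N by (intro divide_right_mono) auto
        then show ?thesis by (simp add: \<theta>_def \<rho>\<^sub>0_def r\<^sub>0_def real_sqrt_divide)
      qed
      have v0: "0 \<le> v"
      proof -
        have "\<theta> * \<theta> \<le> 2 * \<rho>\<^sub>0 * \<theta>" using \<theta>le \<theta> by (intro mult_right_mono) auto
        then show ?thesis by (simp add: v_def power2_eq_square)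
      qed
      have vle: "v \<le> 2 * \<rho>\<^sub>0 * \<theta>" by (simp add: v_def)
      have "2 * \<rho>\<^sub>0 * \<theta> \<le> 2 * \<rho>\<^sub>0 * (2 * \<rho>\<^sub>0)" using \<theta>le \<rho>0 by (intro mult_left_mono) auto
      also have "\<dots> = 4 * r\<^sub>0" using \<rho>0(2) by (simp add: power2_eq_square)
      finally have v1: "v \<le> 1" using vle r0 by simp
      \<comment> \<open>By \<open>D / N \<le> 1 / 8\<close> the second-order term costs at most
        \<open>a\<^sup>2 / 4\<close>, half of the Gaussian gain
        \<open>a\<^sup>2 / 2\<close>.\<close>
      have v2: "N * v\<^sup>2 \<le> a\<^sup>2 / 2"
      proof -
        have "v\<^sup>2 \<le> (2 * \<rho>\<^sub>0 * \<theta>)\<^sup>2" using v0 vle by (intro power_mono) auto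
        also have "\<dots> = 4 * r\<^sub>0 * \<theta>\<^sup>2" using \<rho>0(2) by (simp add: power_mult_distrib)
        also have "\<dots> \<le> 4 * (1 / 8) * \<theta>\<^sup>2" using r0 by (intro mult_right_mono) auto
        finally have "N * v\<^sup>2 \<le> N * (\<theta>\<^sup>2 / 2)" using N by (intro mult_left_mono) auto
        then show ?thesis using \<theta>(2) by (simp add: mult.commute)
      qed
      \<comment> \<open>A correlation above the threshold value only improves the lower tail, so
        \<open>\<rho>\<^sub>0\<close> can stand in for \<open>\<rho>\<close>.\<close>
      have pos: "1 + v \<le> 1 - 2 * \<rho> * (- \<theta>) - (- \<theta>)\<^sup>2 * (1 - \<rho>\<^sup>2)"
      proof -
        have "\<rho>\<^sub>0 * \<theta> \<le> \<rho> * \<theta>" using \<rho>0le \<theta> by (intro mult_right_mono) auto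
        moreover have "\<theta>\<^sup>2 * (1 - \<rho>\<^sup>2) \<le> \<theta>\<^sup>2" by (simp add: mult_left_le)
        ultimately show ?thesis by (simp add: v_def)
      qed
      have "measure (H1_cond_law n m \<rho> \<pi>) (space ?A - A \<pi>) \<le>
        exp (- (- \<theta> * t)) * (1 / sqrt (1 - 2 * \<rho> * (- \<theta>) - (- \<theta>)\<^sup>2 * (1 - \<rho>\<^sup>2))) ^ card ?E"
      proof (rule measure_H1_cond_law_Chernoff[OF \<pi> \<rho>(1,2)])
        show "0 < 1 - 2 * \<rho> * (- \<theta>) - (- \<theta>)\<^sup>2 * (1 - \<rho>\<^sup>2)" using pos v0 by linarith
        show "space ?A - A \<pi> \<in> sets ?A" using A[OF that] by auto
        show "- \<theta> * t \<le> - \<theta> * (\<Sum>e\<in>?E. fst w e * snd w (\<pi> ` e))" if "w \<in> space ?A - A \<pi>" for w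
          using that \<theta>(1) by (auto simp: A_def X_def not_le intro: mult_left_mono)
      qed simp
      also have "\<dots> \<le> exp (\<theta> * t) * exp (- (v - v\<^sup>2) / 2) ^ card ?E"
      proof -
        have "1 / sqrt (1 - 2 * \<rho> * (- \<theta>) - (- \<theta>)\<^sup>2 * (1 - \<rho>\<^sup>2)) \<le> 1 / sqrt (1 + v)"
          using pos v0 by (intro divide_left_mono real_sqrt_le_mono mult_pos_pos) auto
        also have "\<dots> \<le> exp (- (v - v\<^sup>2) / 2)" by (rule inverse_sqrt_one_plus_le_exp[OF v0 v1])
        finally have "(1 / sqrt (1 - 2 * \<rho> * (- \<theta>) - (- \<theta>)\<^sup>2 * (1 - \<rho>\<^sup>2))) ^ card ?E \<le> exp (- (v - v\<^sup>2) / 2) ^ card ?E"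
          using pos v0 by (intro power_mono) auto
        then show ?thesis by simp
      qed
      also have "\<dots> = exp (\<theta> * t + N * (- (v - v\<^sup>2) / 2))"
        by (simp only: exp_of_nat_mult[symmetric] exp_add[symmetric] cardE)
      also have "\<dots> \<le> exp (- a\<^sup>2 / 4)"
      proof -
        have "\<theta> * t = a * (sqrt D - a)" unfolding \<theta>_def t_def using N by simp
        moreover have "N * v = 2 * (\<rho>\<^sub>0 * \<theta> * N) - \<theta>\<^sup>2 * N" by (simp add: v_def algebra_simps)
        then have "N * v = 2 * (a * sqrt D) - a\<^sup>2" unfolding \<theta>(2,3) .
        moreover have "N * (- (v - v\<^sup>2) / 2) = - (N * v) / 2 + N * v\<^sup>2 / 2" by (simp add: field_simps)
        moreover have "a * (sqrt D - a) = a * sqrt D - a\<^sup>2" by (simp add: power2_eq_square algebra_simps)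
        ultimately have "\<theta> * t + N * (- (v - v\<^sup>2) / 2) \<le> - a\<^sup>2 / 4" using v2 by linarith
        then show ?thesis by simp
      qed
      finally have "measure (H1_cond_law n m \<rho> \<pi>) (space ?A - A \<pi>) \<le> exp (- a\<^sup>2 / 4)" .
      moreover have "measure (H1_cond_law n m \<rho> \<pi>) (space ?A - A \<pi>) = 1 - measure (H1_cond_law n m \<rho> \<pi>) (A \<pi>)"
        using Q.prob_compl[of "A \<pi>"] A[OF that] sets_eq_imp_space_eq[OF sets_H1_cond_law, of n m \<rho> \<pi>] by simp
      moreover have "measure (H1_cond_law n m \<rho> \<pi>) (A \<pi>) \<le> measure (H1_cond_law n m \<rho> \<pi>) E"
        using that E by (intro Q.finite_measure_mono) (auto simp: E_def)
      ultimately show ?thesis by simp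
    qed
    have "fact n * (1 - exp (- a\<^sup>2 / 4)) = (\<Sum>\<pi>\<in>?\<Omega>. 1 - exp (- a\<^sup>2 / 4))"
      by (simp only: sum_constant card\<Omega> of_nat_fact)
    also have "\<dots> \<le> (\<Sum>\<pi>\<in>?\<Omega>. measure (H1_cond_law n m \<rho> \<pi>) E)" by (intro sum_mono cond)
    finally show ?thesis unfolding measure_H1_law[OF E] by (simp add: pos_le_divide_eq mult.commute)
  qed
  have "measure (H1_law n m \<rho>) E - measure (H0_law n m) E \<le> \<bar>measure (H0_law n m) E - measure (H1_law n m \<rho>) E\<bar>"
    by simp
  also have "\<dots> \<le> total_variation (H0_law n m) (H1_law n m \<rho>)"
    using E by (intro total_variation_bounds(3) prob_space_H0_law prob_space_H1_law) simp
  finally show ?thesis using P Q by linarith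
qed

section \<open>Passage to the limit\<close>

lemma eventually_binomial_ge:
  assumes "1 \<le> m"
  shows "\<forall>\<^sub>F n in sequentially. real n ^ m / real m ^ m \<le> real (n choose m)"
  using eventually_ge_at_top[of m]
proof eventually_elim
  case (elim n)
  then show ?case using binomial_ge_n_over_k_pow_k[of m n, where 'a = real] by (simp add: power_divide)
qed

text \<open>For \<open>m \<ge> 2\<close> the binomial coefficient is at least of order
  \<open>n\<^sup>2\<close>, so the threshold for \<open>\<rho>\<^sup>2\<close> vanishes at least as
  fast as \<open>ln n / n\<close>. This is what makes the second-order errors harmless.\<close>

lemma eventually_threshold_le:
  assumes m: "2 \<le> m"
  shows "\<forall>\<^sub>F n in sequentially. 0 < real (n choose m) \<and>
    2 * real n * ln (real n) / real (n choose m) \<le> 2 * real m ^ m * ln (real n) / real n"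
proof -
  have "1 \<le> m" using m by simp
  from eventually_binomial_ge[OF this] eventually_ge_at_top[of m] show ?thesis
  proof eventually_elim
    case (elim n)
    have n: "1 \<le> real n" using elim m by simp
    have N: "0 < real (n choose m)" using elim by simp
    have "real n ^ 2 \<le> real n ^ m" using n m by (intro power_increasing)
    then have "real n ^ 2 / real m ^ m \<le> real (n choose m)"
      using elim(1) m by (meson divide_right_mono order_trans zero_le_power of_nat_0_le_iff)
    then have "2 * real n * ln (real n) / real (n choose m) \<le> 2 * real n * ln (real n) / (real n ^ 2 / real m ^ m)"
      using n N m by (intro divide_left_mono mult_pos_pos) auto
    also have "\<dots> = 2 * real m ^ m * ln (real n) / real n" using n by (simp add: power2_eq_square)
    finally show ?case using N by simp
  qed
qed

lemma distinguishable:
  assumes m: "2 \<le> m" and \<rho>: "\<And>n. 0 \<le> \<rho> n" "\<And>n. \<rho> n \<le> 1"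
    and ev: "\<forall>\<^sub>F n in sequentially. (\<rho> n)\<^sup>2 \<ge> 2 * real n * ln (real n) / real (n choose m)"
  shows "(\<lambda>n. total_variation (H0_law n m) (H1_law n m (\<rho> n))) \<longlonglongrightarrow> 1"
proof (rule tendsto_sandwich)
  define K where "K = real m ^ m"
  have K: "0 < K" using m by (simp add: K_def)
  \<comment> \<open>With \<open>a = n powr (1/4)\<close> the lower-tail error vanishes, while
    \<open>a * sqrt D\<close> is of order \<open>n powr (3/4)\<close> up to a logarithmic factor and
    \<open>D\<^sup>2 / N\<close> is at most of order \<open>(ln n)\<^sup>2\<close>; both are
    dominated by \<open>n\<close>.\<close>
  define f where "f n = 1 - exp (- (real n powr (1/4))\<^sup>2 / 4) -
     exp (ln (real n) - real n + 1 + real n powr (1/4) * sqrt (2 * real n * ln (real n)) + 4 * K * (ln (real n))\<^sup>2)" for n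
  show "f \<longlonglongrightarrow> 1" unfolding f_def using K by real_asymp
  show "(\<lambda>n::nat. 1::real) \<longlonglongrightarrow> 1" by simp
  show "\<forall>\<^sub>F n in sequentially. total_variation (H0_law n m) (H1_law n m (\<rho> n)) \<le> 1"
    by (intro always_eventually allI total_variation_bounds prob_space_H0_law prob_space_H1_law)
  have "(\<lambda>n. 2 * K * ln (real n) / real n) \<longlonglongrightarrow> 0" using K by real_asymp
  then have e1: "\<forall>\<^sub>F n in sequentially. 2 * K * ln (real n) / real n < 1 / 8"
    by (rule order_tendstoD) simp
  have e2: "\<forall>\<^sub>F n in sequentially. real n powr (1/4) \<le> 2 * sqrt (2 * real n * ln (real n))" by real_asymp
  have e3: "\<forall>\<^sub>F n in sequentially. 0 < ln (real n)" by real_asymp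
  show "\<forall>\<^sub>F n in sequentially. f n \<le> total_variation (H0_law n m) (H1_law n m (\<rho> n))"
    using eventually_threshold_le[OF m] e1 e2 e3 ev eventually_ge_at_top[of 1]
  proof eventually_elim
    case (elim n)
    define N where "N = real (n choose m)"
    define D where "D = 2 * real n * ln (real n)"
    have D: "0 < D" using elim by (simp add: D_def)
    have thr: "D / N \<le> 2 * K * ln (real n) / real n" using elim(1) by (simp add: D_def N_def K_def)
    have "1 - exp (- (real n powr (1/4))\<^sup>2 / 4) - exp (ln (real n) - real n + 1 + real n powr (1/4) * sqrt D + D\<^sup>2 / N)
      \<le> total_variation (H0_law n m) (H1_law n m (\<rho> n))"
      unfolding D_def N_def
    proof (rule total_variation_H0_H1_ge)
      show "1 \<le> n" "0 < real (n choose m)" "0 \<le> \<rho> n" "\<rho> n \<le> 1" "0 < real n powr (1/4)"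
        using elim \<rho> by auto
      show "0 < 2 * real n * ln (real n)" using D by (simp add: D_def)
      show "2 * real n * ln (real n) / real (n choose m) \<le> 1 / 8"
        using thr elim(2) unfolding D_def N_def by linarith
      show "real n powr (1/4) \<le> 2 * sqrt (2 * real n * ln (real n))"
        "2 * real n * ln (real n) / real (n choose m) \<le> (\<rho> n)\<^sup>2" using elim by blast+
    qed
    moreover have "D\<^sup>2 / N \<le> 4 * K * (ln (real n))\<^sup>2"
    proof -
      have "D\<^sup>2 / N = D * (D / N)" by (simp add: power2_eq_square)
      also have "\<dots> \<le> D * (2 * K * ln (real n) / real n)" using thr D by (intro mult_left_mono) auto
      also have "\<dots> = 4 * K * (ln (real n))\<^sup>2" using elim by (simp add: D_def power2_eq_square)
      finally show ?thesis .
    qed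
    then have "exp (ln (real n) - real n + 1 + real n powr (1/4) * sqrt D + D\<^sup>2 / N) \<le>
       exp (ln (real n) - real n + 1 + real n powr (1/4) * sqrt D + 4 * K * (ln (real n))\<^sup>2)" by simp
    ultimately show ?case unfolding f_def D_def by linarith
  qed
qed

lemma indistinguishable:
  assumes m: "2 \<le> m" and \<rho>: "\<And>n. 0 \<le> \<rho> n" and \<epsilon>: "0 < \<epsilon>" "\<epsilon> < 1"
    and ev: "\<forall>\<^sub>F n in sequentially. (\<rho> n)\<^sup>2 < (1 - \<epsilon>) * 2 * real n * ln (real n) / real (n choose m)"
  shows "(\<lambda>n. total_variation (H0_law n m) (H1_law n m (\<rho> n))) \<longlonglongrightarrow> 0"
proof -
  define K where "K = real m ^ m"
  have K: "0 < K" using m by (simp add: K_def)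
  define \<omega> where "\<omega> n = 32 * (K * ln (real n)) ^ 3 / real n" for n
  define te where "te n = truncation_error m n \<epsilon>" for n
  define \<kappa> where "\<kappa> n = exp (4 * ln (real n) / sqrt (real n) + 2 * \<omega> n) / (1 - \<omega> n * exp (2 * \<omega> n)) +
    (real n + 1) * exp (- (real n powr (1/4)) / 32 + (real n + 2) * \<omega> n) - 1" for n
  have \<omega>0: "\<omega> \<longlonglongrightarrow> 0" unfolding \<omega>_def using K by real_asymp
  have te0: "te \<longlonglongrightarrow> 0"
  proof -
    define c where "c = \<epsilon>\<^sup>2 * (1 - \<epsilon>) / (72 * (32 * real m) ^ m)"
    have "0 < c" using \<epsilon> m by (simp add: c_def)
    \<comment> \<open>The extra \<open>ln n\<close> in the exponent is what absorbs the
      \<open>2 ^ n\<close> vertex sets.\<close>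
    then have "(\<lambda>n. 2 ^ n * exp (- (c * (real n * ln (real n))))) \<longlonglongrightarrow> 0" by real_asymp
    then show ?thesis unfolding te_def truncation_error_def c_def .
  qed
  have \<kappa>0: "\<kappa> \<longlonglongrightarrow> 0"
  proof -
    have "(\<lambda>n. 4 * ln (real n) / sqrt (real n)) \<longlonglongrightarrow> 0" by real_asymp
    then have "(\<lambda>n. exp (4 * ln (real n) / sqrt (real n) + 2 * \<omega> n) / (1 - \<omega> n * exp (2 * \<omega> n))) \<longlonglongrightarrow>
        exp (0 + 2 * 0) / (1 - 0 * exp (2 * 0))"
      using \<omega>0 by (intro tendsto_intros) auto
    note first = this
    \<comment> \<open>\<open>n * \<omega> n\<close> is polylogarithmic, so
      \<open>n powr (1/4)\<close> dominates the exponent.\<close>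
    have second: "(\<lambda>n. (real n + 1) * exp (- (real n powr (1/4)) / 32 + (real n + 2) * \<omega> n)) \<longlonglongrightarrow> 0"
      unfolding \<omega>_def using K by real_asymp
    have "\<kappa> \<longlonglongrightarrow> exp (0 + 2 * 0) / (1 - 0 * exp (2 * 0)) + 0 - 1"
      unfolding \<kappa>_def by (rule tendsto_diff[OF tendsto_add[OF first second] tendsto_const])
    then show ?thesis by simp
  qed
  have "(\<lambda>n. \<omega> n * exp (2 * \<omega> n)) \<longlonglongrightarrow> 0 * exp (2 * 0)" using \<omega>0 by (intro tendsto_intros)
  then have e1: "\<forall>\<^sub>F n in sequentially. \<omega> n * exp (2 * \<omega> n) < 1" by (rule order_tendstoD) simp
  have "(\<lambda>n. 2 * K * ln (real n) / real n) \<longlonglongrightarrow> 0" using K by real_asymp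
  then have e2: "\<forall>\<^sub>F n in sequentially. 2 * K * ln (real n) / real n < \<epsilon> / 36"
    by (rule order_tendstoD) (use \<epsilon> in simp)
  have e3: "\<forall>\<^sub>F n in sequentially. 16 \<le> ln (real n)" by real_asymp
  have "filterlim (\<lambda>n. \<epsilon>\<^sup>2 * ln (real n)) at_top sequentially" using \<epsilon> by real_asymp
  then have e4: "\<forall>\<^sub>F n in sequentially. 7 \<le> \<epsilon>\<^sup>2 * ln (real n)" by (simp add: filterlim_at_top)
  have bound: "\<forall>\<^sub>F n in sequentially. total_variation (H0_law n m) (H1_law n m (\<rho> n)) \<le>
      te n + s / 2 + (\<kappa> n + 2 * te n) / (2 * s)" if s: "0 < s" for s
    using eventually_threshold_le[OF m] e1 e2 e3 e4 ev eventually_ge_at_top[of "32 * m"]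
  proof eventually_elim
    case (elim n)
    define r where "r = (1 - \<epsilon>) * 2 * real n * ln (real n) / real (n choose m)"
    have r0: "0 \<le> r" using elim \<epsilon> by (simp add: r_def)
    have "r = (1 - \<epsilon>) * (2 * real n * ln (real n) / real (n choose m))" by (simp add: r_def)
    also have "\<dots> \<le> 1 * (2 * real n * ln (real n) / real (n choose m))"
      using \<epsilon> elim by (intro mult_right_mono) auto
    finally have r1: "r \<le> \<epsilon> / 36" using elim by (simp add: K_def)
    have sq: "(sqrt r)\<^sup>2 = r" using r0 by simp
    \<comment> \<open>\<open>sqrt r\<close>, the correlation exactly at the level
      \<open>1 - \<epsilon>\<close> of the threshold, plays the role of
      \<open>\<rho>\<^sub>1\<close>.\<close>
    have "\<rho> n \<le> sqrt r" using elim \<rho> by (intro real_le_rsqrt) (simp add: r_def)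
    then show ?case
      unfolding te_def \<kappa>_def using elim m \<epsilon> r1 \<rho>
      by (intro total_variation_H0_H1_le[where \<rho>\<^sub>1 = "sqrt r"] s) (auto simp: sq r_def \<omega>_def K_def)
  qed
  show ?thesis
  proof (rule tendstoI)
    fix s :: real assume s: "0 < s"
    \<comment> \<open>For fixed \<open>s\<close> the bound tends to \<open>s / 2\<close>, which is
      below \<open>s\<close>, and \<open>s\<close> is arbitrary.\<close>
    have "(\<lambda>n. te n + s / 2 + (\<kappa> n + 2 * te n) / (2 * s)) \<longlonglongrightarrow> 0 + s / 2 + (0 + 2 * 0) / (2 * s)"
      using s by (intro tendsto_intros te0 \<kappa>0) auto
    then have "\<forall>\<^sub>F n in sequentially. te n + s / 2 + (\<kappa> n + 2 * te n) / (2 * s) < s"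
      by (rule order_tendstoD) (use s in simp)
    with bound[OF s] show "\<forall>\<^sub>F n in sequentially. dist (total_variation (H0_law n m) (H1_law n m (\<rho> n))) 0 < s"
    proof eventually_elim
      case (elim n)
      then show ?case
        using total_variation_bounds(1)[OF prob_space_H0_law prob_space_H1_law, of n m n m "\<rho> n"]
        by (simp add: dist_real_def)
    qed
  qed
qed

theorem theorem2p1:
  fixes m :: nat and \<rho> :: "nat \<Rightarrow> real"
  assumes "2 \<le> m"
    and "\<And>n. 0 \<le> \<rho> n" and "\<And>n. \<rho> n \<le> 1"
  shows "((\<forall>\<^sub>F n in sequentially. (\<rho> n)\<^sup>2 \<ge> 2 * real n * ln (real n) / real (n choose m))
        \<longrightarrow> (\<lambda>n. total_variation (H0_law n m) (H1_law n m (\<rho> n))) \<longlonglongrightarrow> 1)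
    \<and> (\<forall>\<epsilon>>0.
        (\<forall>\<^sub>F n in sequentially.
          (\<rho> n)\<^sup>2 < (1 - \<epsilon>) * 2 * real n * ln (real n) / real (n choose m))
        \<longrightarrow> (\<lambda>n. total_variation (H0_law n m) (H1_law n m (\<rho> n))) \<longlonglongrightarrow> 0)"
proof (intro conjI impI allI)
  assume "\<forall>\<^sub>F n in sequentially. (\<rho> n)\<^sup>2 \<ge> 2 * real n * ln (real n) / real (n choose m)"
  then show "(\<lambda>n. total_variation (H0_law n m) (H1_law n m (\<rho> n))) \<longlonglongrightarrow> 1"
    by (rule distinguishable[OF assms])
next
  fix \<epsilon> :: real
  assume \<epsilon>: "0 < \<epsilon>"
    and ev: "\<forall>\<^sub>F n in sequentially. (\<rho> n)\<^sup>2 < (1 - \<epsilon>) * 2 * real n * ln (real n) / real (n choose m)"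
  show "(\<lambda>n. total_variation (H0_law n m) (H1_law n m (\<rho> n))) \<longlonglongrightarrow> 0"
  proof (cases "\<epsilon> < 1")
    case True
    then show ?thesis using indistinguishable[OF assms(1,2) \<epsilon> _ ev] by simp
  next
    case False
    \<comment> \<open>For \<open>\<epsilon> \<ge> 1\<close> the right-hand side is at most zero once
      \<open>n \<ge> 1\<close>, and no square lies below it, so the hypothesis is
      contradictory.\<close>
    have "\<forall>\<^sub>F n in sequentially. False"
      using ev eventually_ge_at_top[of 1]
    proof eventually_elim
      case (elim n)
      have "(1 - \<epsilon>) * (2 * real n * ln (real n) / real (n choose m)) \<le> 0"
        using False elim by (intro mult_nonpos_nonneg) auto
      moreover have "(1 - \<epsilon>) * 2 * real n * ln (real n) / real (n choose m) =
          (1 - \<epsilon>) * (2 * real n * ln (real n) / real (n choose m))" by simp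
      ultimately show ?case using elim(1) zero_le_power2[of "\<rho> n"] by linarith
    qed
    then show ?thesis by simp
  qed
qed

end
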